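(* Let $\Omega\subset\mathbb{R}^d$ be a compact convex set with nonempty interior, let $f:[0,+\infty[\to\mathbb{R}$ be a $C^1$ strictly convex function with $f(0)=0$ which is superlinear at infinity (i.e. $f(t)/t\to+\infty$ as $t\to+\infty$), and let $V:[0,+\infty[\to[0,+\infty[$ be a $C^2$ function with $V'>0$. Then the minimization problem over $(\mu,\nu)\in\mathcal{P}(\Omega)^2$ for the functional $$\mathfrak{F}(\mu,\nu)=\frac12W_2^2(\mu,\nu)+F(\mu)+G(\nu)$$ admits solutions, and in any minimizing pair $(\mu,\nu)$ both $\mu$ and $\nu$ are absolutely continuous, $\mu=u\cdot\mathcal{L}^d$ and $\nu=v\cdot\mathcal{L}^d$, with $u\in C^0(\Omega)$ and $v\in L^\infty(\Omega)$. Here $$F(\mu)=\begin{cases}\int_\Omega f(u)\,d\mathcal{L}^d&\text{if }\mu=u\cdot\mathcal{L}^d,\\ +\infty&\text{otherwise,}\end{cases}\qquad G(\nu)=\int_{\Omega\times\Omega}V(|x-y|^2)\,\nu(dx)\,\nu(dy).$$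
   Context: $\mathcal{P}(\Omega)$ is the set of Borel probability measures on $\Omega$, $\mathcal{L}^d$ is the Lebesgue measure, and $W_2$ is the 2-Wasserstein distance: $W_2^2(\mu,\nu)=\min\{\int_{\Omega\times\Omega}|x-y|^2\,d\gamma\}$ over all $\gamma\in\mathcal{P}(\Omega\times\Omega)$ with marginals $\mu$ and $\nu$. *)

theory Defs
  imports "HOL-Probability.Probability"
begin

definition strictly_convex_on :: "real set \<Rightarrow> (real \<Rightarrow> real) \<Rightarrow> bool" where
  "strictly_convex_on S f \<longleftrightarrow> convex S \<and>
    (\<forall>x\<in>S. \<forall>y\<in>S. \<forall>t. x \<noteq> y \<longrightarrow> 0 < t \<longrightarrow> t < 1 \<longrightarrow>
      f ((1 - t) * x + t * y) < (1 - t) * f x + t * f y)"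

definition prob_on :: "'a::topological_space set \<Rightarrow> 'a measure set" where
  "prob_on \<Omega> = {\<mu>. prob_space \<mu> \<and> sets \<mu> = sets (restrict_space borel \<Omega>)}"

definition couplings ::
    "'a::euclidean_space set \<Rightarrow> 'a measure \<Rightarrow> 'a measure \<Rightarrow> ('a \<times> 'a) measure set" where
  "couplings \<Omega> \<mu> \<nu> = {\<gamma> \<in> prob_on (\<Omega> \<times> \<Omega>).
     distr \<gamma> (restrict_space borel \<Omega>) fst = \<mu> \<and> distr \<gamma> (restrict_space borel \<Omega>) snd = \<nu>}"

text \<open>The squared 2-Wasserstein distance. The infimum is the minimum whenever the latter exists,
  as it does for probability measures on a compact set.\<close>

definition W2_squared :: "'a::euclidean_space set \<Rightarrow> 'a measure \<Rightarrow> 'a measure \<Rightarrow> ennreal" where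
  "W2_squared \<Omega> \<mu> \<nu> =
     (INF \<gamma>\<in>couplings \<Omega> \<mu> \<nu>. \<integral>\<^sup>+ z. ennreal ((norm (fst z - snd z))\<^sup>2) \<partial>\<gamma>)"

definition lebesgue_density :: "'a::euclidean_space set \<Rightarrow> 'a measure \<Rightarrow> ('a \<Rightarrow> real) \<Rightarrow> bool" where
  "lebesgue_density \<Omega> \<mu> u \<longleftrightarrow>
     u \<in> borel_measurable (restrict_space lborel \<Omega>) \<and> (\<forall>x\<in>\<Omega>. 0 \<le> u x) \<and>
     \<mu> = density (restrict_space lborel \<Omega>) (\<lambda>x. ennreal (u x))"

text \<open>The integral of a function as the difference of the integrals of its positive and negative
  parts; the positive part may have infinite integral. It is meaningful only if one of the two
  integrals is finite, which holds for the negative part of \<open>f \<circ> u\<close> below when \<open>f\<close> is bounded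
  below on \<open>{0..}\<close> and \<open>\<Omega>\<close> is bounded.\<close>

definition extended_integral :: "'a measure \<Rightarrow> ('a \<Rightarrow> real) \<Rightarrow> ereal" where
  "extended_integral M g =
     enn2ereal (\<integral>\<^sup>+ x. ennreal (g x) \<partial>M) - enn2ereal (\<integral>\<^sup>+ x. ennreal (- g x) \<partial>M)"

definition internal_energy ::
    "(real \<Rightarrow> real) \<Rightarrow> 'a::euclidean_space set \<Rightarrow> 'a measure \<Rightarrow> ereal" where
  "internal_energy f \<Omega> \<mu> =
     (if \<exists>u. lebesgue_density \<Omega> \<mu> u
      then extended_integral (restrict_space lborel \<Omega>) (\<lambda>x. f ((SOME u. lebesgue_density \<Omega> \<mu> u) x))
      else \<infinity>)"

text \<open>The value does not depend on the chosen density.\<close>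

lemma internal_energy_eq:
  fixes \<Omega> :: "'a::euclidean_space set"
  assumes "\<Omega> \<in> sets borel" and u: "lebesgue_density \<Omega> \<mu> u"
  shows "internal_energy f \<Omega> \<mu> = extended_integral (restrict_space lborel \<Omega>) (\<lambda>x. f (u x))"
proof -
  let ?L = "restrict_space lborel \<Omega> :: 'a measure"
  define w where "w = (SOME u. lebesgue_density \<Omega> \<mu> u)"
  have w: "lebesgue_density \<Omega> \<mu> w"
    unfolding w_def using u by (metis someI_ex)
  have "sigma_finite_measure (lborel :: 'a measure)" ..
  then interpret sigma_finite_measure ?L
    using assms(1) by (intro sigma_finite_measure_restrict_space) auto
  have "AE x in ?L. ennreal (w x) = ennreal (u x)"
    using u w unfolding lebesgue_density_def by (intro density_unique) auto
  then have "AE x in ?L. w x = u x"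
    using AE_space
  proof eventually_elim
    case (elim x)
    then have "x \<in> \<Omega>" by (auto simp: space_restrict_space)
    with elim u w show ?case by (auto simp: lebesgue_density_def)
  qed
  then have
    "(\<integral>\<^sup>+ x. ennreal (f (w x)) \<partial>?L) = (\<integral>\<^sup>+ x. ennreal (f (u x)) \<partial>?L)"
    "(\<integral>\<^sup>+ x. ennreal (- f (w x)) \<partial>?L) = (\<integral>\<^sup>+ x. ennreal (- f (u x)) \<partial>?L)"
    by (auto intro!: nn_integral_cong_AE)
  then show ?thesis
    using u unfolding internal_energy_def extended_integral_def w_def[symmetric] by auto
qed

definition interaction_energy :: "(real \<Rightarrow> real) \<Rightarrow> 'a::euclidean_space measure \<Rightarrow> ennreal" where
  "interaction_energy V \<nu> =
     (\<integral>\<^sup>+ z. ennreal (V ((norm (fst z - snd z))\<^sup>2)) \<partial>(\<nu> \<Otimes>\<^sub>M \<nu>))"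

definition total_functional ::
    "(real \<Rightarrow> real) \<Rightarrow> (real \<Rightarrow> real) \<Rightarrow> 'a::euclidean_space set \<Rightarrow> 'a measure \<Rightarrow> 'a measure \<Rightarrow> ereal"
  where
  "total_functional f V \<Omega> \<mu> \<nu> =
     1 / 2 * enn2ereal (W2_squared \<Omega> \<mu> \<nu>) + internal_energy f \<Omega> \<mu>
       + enn2ereal (interaction_energy V \<nu>)"

definition minimizing_pair ::
    "(real \<Rightarrow> real) \<Rightarrow> (real \<Rightarrow> real) \<Rightarrow> 'a::euclidean_space set \<Rightarrow> 'a measure \<Rightarrow> 'a measure \<Rightarrow> bool"
  where
  "minimizing_pair f V \<Omega> \<mu> \<nu> \<longleftrightarrow>
     \<mu> \<in> prob_on \<Omega> \<and> \<nu> \<in> prob_on \<Omega> \<and>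
     (\<forall>\<mu>'\<in>prob_on \<Omega>. \<forall>\<nu>'\<in>prob_on \<Omega>.
        total_functional f V \<Omega> \<mu> \<nu> \<le> total_functional f V \<Omega> \<mu>' \<nu>')"

end

theory Submission
  imports Defs "HOL-Real_Asymp.Real_Asymp"
begin

text \<open>
  The problem is read as one about transport plans. For a plan \<open>\<gamma>\<close> on \<open>\<Omega> \<times> \<Omega>\<close> whose first marginal has
  density \<open>u\<close>, the energy is half of the transport cost of \<open>\<gamma>\<close>, plus the integral of \<open>f \<circ> u\<close>, plus the
  interaction energy of the second marginal. Two measures always have an optimal coupling, so a pair
  minimizes the functional exactly when it is the pair of marginals of a plan of least energy
  (\<open>minimizing_pair_energy\<close>, \<open>minimizing_pair_of_energy\<close>). A plan also records which point is
  transported where, and this makes both optimality conditions pointwise statements about the pairs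
  \<open>(x, y)\<close> that \<open>\<gamma>\<close> charges.

  Existence is the direct argument of the calculus of variations. A bounded set in a Euclidean space
  lies on a continuous curve that has a Borel section over it
  (\<open>bounded_set_coded_by_reals\<close>), so the selection theorem of Helly and the representation theorem of
  Skorohod on the line carry over: a sequence of probability measures on a compact set has a
  subsequence that is the sequence of laws of a pointwise convergent sequence of random variables
  (\<open>skorohod_compact\<close>). Cost and interaction then converge by dominated convergence. The internal
  energy is the supremum over nonnegative continuous \<open>w\<close> of the functionals
  \<open>\<mu> \<mapsto> \<integral> f(w) - f'(w) w dx + \<integral> f'(w) d\<mu>\<close>, each of which is weakly continuous, so it is lower
  semicontinuous; superlinearity of \<open>f\<close> keeps the limit absolutely continuous
  (\<open>internal_energy_of_dual_bound\<close>).

  For the second marginal \<open>\<nu>\<close>, moving the second coordinate of a plan leaves the first marginal alone.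
  Hence for almost every \<open>(x, y)\<close> the point \<open>y\<close> minimizes \<open>z \<mapsto> |x - z|\<^sup>2 / 2 + 2 \<integral> V(|z - w|\<^sup>2) d\<nu>(w)\<close> on
  \<open>\<Omega>\<close> (\<open>second_optimality\<close>). If \<open>y\<close> is a boundary point, the gradient \<open>g\<close> of this function at \<open>y\<close>
  might be nonzero, with \<open>g \<bullet> (z - y) \<ge> 0\<close> for all \<open>z\<close> in \<open>\<Omega>\<close>; but \<open>g\<close> itself is a nonnegative combination
  of vectors \<open>y - z\<close> with \<open>z\<close> in \<open>\<Omega>\<close>, because \<open>V' > 0\<close>, so \<open>g \<bullet> g \<le> 0\<close>. Thus
  \<open>x = S y\<close> with \<open>S y = y + 4 \<integral> V'(|y - w|\<^sup>2) (y - w) d\<nu>(w)\<close>, a Lipschitz map (\<open>transport_relation\<close>). A cube of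
  side \<open>s\<close> is mapped into a cube of side proportional to \<open>s\<close>, and \<open>\<nu>(Q) \<le> \<mu>(S Q)\<close>; so a bounded
  density of the first marginal \<open>\<mu>\<close> forces a bounded density of \<open>\<nu>\<close>
  (\<open>second_marginal_bounded_density\<close>).

  For the first marginal, moving the first coordinate from \<open>x\<close> to \<open>x'\<close> changes the cost by the difference
  of the half squares and the internal energy by \<open>f'(u x') - f'(u x)\<close> to first order. Hence
  \<open>f'(u x) + |x - y|\<^sup>2 / 2 \<le> f'(u x') + |x' - y|\<^sup>2 / 2\<close> for almost every \<open>(x, y)\<close> and almost every
  \<open>x'\<close> (\<open>first_optimality\<close>). With \<open>H\<close> the supremum over such \<open>(x, y)\<close> of
  \<open>f'(u x) + |x - y|\<^sup>2 / 2 - |x' - y|\<^sup>2 / 2\<close> as a function of \<open>x'\<close>, a Lipschitz function, this says that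
  \<open>f'(u) = max (f'(0)) H\<close> almost everywhere; as \<open>f'\<close> is continuous and strictly increasing, \<open>u\<close> has
  a continuous version (\<open>first_marginal_continuous_density\<close>).
\<close>

section \<open>Coding bounded sets by real numbers\<close>

definition binary_digit :: "nat \<Rightarrow> real \<Rightarrow> real" where
  "binary_digit k s = real_of_int (\<lfloor>2 ^ Suc k * s\<rfloor> mod 2)"

lemma binary_digit_01: "binary_digit k s = 0 \<or> binary_digit k s = 1"
proof -
  have "\<lfloor>2 ^ Suc k * s\<rfloor> mod 2 = 0 \<or> \<lfloor>2 ^ Suc k * s\<rfloor> mod 2 = 1" by auto
  then show ?thesis unfolding binary_digit_def by auto
qed

lemma borel_measurable_binary_digit [measurable]: "binary_digit k \<in> borel_measurable borel"
proof -
  have *: "binary_digit k = (\<lambda>s. of_int \<lfloor>2 ^ Suc k * s\<rfloor> - 2 * of_int \<lfloor>(of_int \<lfloor>2 ^ Suc k * s\<rfloor> :: real) / 2\<rfloor>)"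
  proof
    fix s :: real
    have "\<lfloor>(of_int \<lfloor>2 ^ Suc k * s\<rfloor> :: real) / 2\<rfloor> = \<lfloor>2 ^ Suc k * s\<rfloor> div 2"
      using floor_divide_of_int_eq[of "\<lfloor>2 ^ Suc k * s\<rfloor>" 2, where 'a=real] by simp
    then show "binary_digit k s = of_int \<lfloor>2 ^ Suc k * s\<rfloor> - 2 * of_int \<lfloor>(of_int \<lfloor>2 ^ Suc k * s\<rfloor> :: real) / 2\<rfloor>"
      unfolding binary_digit_def minus_mult_div_eq_mod[symmetric] by simp
  qed
  show ?thesis unfolding * by measurable
qed

text \<open>The partial sums telescope to \<open>\<lfloor>2\<^sup>n s\<rfloor> /
  2\<^sup>n\<close>.\<close>

lemma binary_expansion_sums:
  assumes "0 \<le> s" "s < 1"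
  shows "(\<lambda>k. binary_digit k s / 2 ^ Suc k) sums s"
proof -
  have partial: "(\<Sum>k<n. binary_digit k s / 2 ^ Suc k) = of_int \<lfloor>2 ^ n * s\<rfloor> / 2 ^ n" for n
  proof (induction n)
    case 0
    have "\<lfloor>s\<rfloor> = 0" using assms by linarith
    then show ?case by simp
  next
    case (Suc n)
    have "\<lfloor>2 ^ n * s\<rfloor> = \<lfloor>2 ^ Suc n * s\<rfloor> div 2"
      using floor_divide_real_eq_div[of 2 "2 ^ Suc n * s"] by simp
    then have "\<lfloor>2 ^ Suc n * s\<rfloor> = 2 * \<lfloor>2 ^ n * s\<rfloor> + \<lfloor>2 ^ Suc n * s\<rfloor> mod 2"
      by simp
    then have "of_int \<lfloor>2 ^ Suc n * s\<rfloor> = 2 * of_int \<lfloor>2 ^ n * s\<rfloor> + binary_digit n s"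
      unfolding binary_digit_def by (metis of_int_add of_int_mult of_int_numeral)
    with Suc show ?case by (simp add: field_simps)
  qed
  have "(\<lambda>n. of_int \<lfloor>2 ^ n * s\<rfloor> / 2 ^ n) \<longlonglongrightarrow> s"
  proof (rule tendsto_sandwich)
    show "\<forall>\<^sub>F n in sequentially. s - (1/2) ^ n \<le> of_int \<lfloor>2 ^ n * s\<rfloor> / 2 ^ n"
    proof (intro always_eventually allI)
      fix n :: nat
      have "2 ^ n * s - 1 \<le> of_int \<lfloor>2 ^ n * s\<rfloor>" by linarith
      then have "(2 ^ n * s - 1) / 2 ^ n \<le> of_int \<lfloor>2 ^ n * s\<rfloor> / 2 ^ n"
        by (intro divide_right_mono) auto
      then show "s - (1/2) ^ n \<le> of_int \<lfloor>2 ^ n * s\<rfloor> / 2 ^ n"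
        by (simp add: diff_divide_distrib power_divide)
    qed
    show "\<forall>\<^sub>F n in sequentially. of_int \<lfloor>2 ^ n * s\<rfloor> / 2 ^ n \<le> s"
    proof (intro always_eventually allI)
      fix n :: nat
      show "of_int \<lfloor>2 ^ n * s\<rfloor> / 2 ^ n \<le> s"
        by (simp add: divide_le_eq mult.commute)
    qed
    have "(\<lambda>n. s - (1/2) ^ n) \<longlonglongrightarrow> s - 0"
      by (intro tendsto_intros) auto
    then show "(\<lambda>n. s - (1/2) ^ n) \<longlonglongrightarrow> s" by simp
  qed auto
  then show ?thesis unfolding sums_def partial .
qed

text \<open>Any continuous function of period 2 that vanishes on \<open>[0, 1/3]\<close> and equals
  1 on \<open>[2/3, 1]\<close> would do; clamping a cosine gives periodicity and continuity for
  free. Schoenberg built his space-filling curve from such a function.\<close>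

definition schoenberg_wave :: "real \<Rightarrow> real" where
  "schoenberg_wave t = min 1 (max 0 (1 / 2 - cos (pi * t)))"

lemma schoenberg_wave_bounds: "\<bar>schoenberg_wave t\<bar> \<le> 1"
  unfolding schoenberg_wave_def by auto

lemma schoenberg_wave_low:
  assumes "0 \<le> t" "t \<le> 1 / 3" shows "schoenberg_wave t = 0"
proof -
  have "pi * t \<le> pi * (1/3)" using assms by (intro mult_left_mono) auto
  then have "cos (pi / 3) \<le> cos (pi * t)"
    using assms by (intro cos_monotone_0_pi_le) auto
  then show ?thesis unfolding schoenberg_wave_def by (auto simp: cos_60)
qed

lemma schoenberg_wave_high:
  assumes "2 / 3 \<le> t" "t \<le> 1" shows "schoenberg_wave t = 1"
proof -
  have a: "pi * (2/3) \<le> pi * t" using assms by (intro mult_left_mono) auto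
  have "cos (pi * t) \<le> cos (pi * (2/3))"
    using assms a by (intro cos_monotone_0_pi_le) auto
  also have "cos (pi * (2/3)) = - 1 / 2" using cos_120 by (simp add: mult.commute)
  finally show ?thesis unfolding schoenberg_wave_def by (auto simp: min_def max_def)
qed

lemma schoenberg_wave_periodic: "schoenberg_wave (2 * of_int m + t) = schoenberg_wave t"
proof -
  have "cos (pi * (2 * of_int m + t)) = cos (pi * t + 2 * pi * of_int m)"
    by (simp add: algebra_simps)
  also have "\<dots> = cos (pi * t)"
    by (simp add: cos_add cos_int_2pin sin_int_2pin)
  finally show ?thesis unfolding schoenberg_wave_def by simp
qed

definition ternary_value :: "(nat \<Rightarrow> real) \<Rightarrow> real" where
  "ternary_value c = (\<Sum>j. 2 * c j / 3 ^ Suc j)"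

lemma ternary_value_summable:
  assumes "\<And>j. c j = 0 \<or> c j = (1::real)"
  shows "summable (\<lambda>j. 2 * c j / 3 ^ Suc j)"
proof (rule summable_comparison_test')
  show "summable (\<lambda>j. 2/3 * (1/3) ^ j :: real)" by (intro summable_mult summable_geometric) auto
  show "norm (2 * c j / 3 ^ Suc j) \<le> 2/3 * (1/3) ^ j" if "j \<ge> 0" for j
    using assms[of j] by (auto simp: power_divide)
qed

lemma ternary_value_bounds:
  assumes "\<And>j. c j = 0 \<or> c j = (1::real)"
  shows "0 \<le> ternary_value c" "ternary_value c \<le> 1"
proof -
  have c01: "0 \<le> c j" "c j \<le> 1" for j using assms[of j] by auto
  show "0 \<le> ternary_value c" unfolding ternary_value_def
    using c01 by (intro suminf_nonneg ternary_value_summable assms) auto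
  have "(\<lambda>j. 2/3 * (1/3) ^ j :: real) sums (2/3 * (1 / (1 - 1/3)))"
    by (intro sums_mult geometric_sums) auto
  then have s: "(\<lambda>j. 2/3 * (1/3) ^ j :: real) sums 1" by simp
  have "ternary_value c \<le> (\<Sum>j. 2/3 * (1/3) ^ j)" unfolding ternary_value_def
  proof (rule suminf_le)
    show "2 * c j / 3 ^ Suc j \<le> 2/3 * (1/3) ^ j" for j
      using c01[of j] by (simp add: power_divide divide_right_mono)
  qed (use s ternary_value_summable[OF assms] in \<open>auto simp: sums_iff\<close>)
  then show "ternary_value c \<le> 1" using s by (simp add: sums_iff)
qed

text \<open>Multiplication by 3 shifts the ternary expansion, which is how the individual digits are
  reached.\<close>

lemma ternary_value_shift:
  assumes "\<And>j. c j = 0 \<or> c j = (1::real)"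
  shows "3 * ternary_value c = 2 * c 0 + ternary_value (\<lambda>j. c (Suc j))"
proof -
  have "ternary_value c = 2 * c 0 / 3 + (\<Sum>j. 2 * c (Suc j) / 3 ^ Suc (Suc j))"
    unfolding ternary_value_def
    using suminf_split_head[OF ternary_value_summable[of c]] assms by simp
  also have "(\<Sum>j. 2 * c (Suc j) / 3 ^ Suc (Suc j)) = (\<Sum>j. (2 * c (Suc j) / 3 ^ Suc j) / 3)"
    by (simp add: field_simps)
  also have "\<dots> = ternary_value (\<lambda>j. c (Suc j)) / 3"
    unfolding ternary_value_def using assms
    by (intro suminf_divide ternary_value_summable) auto
  finally show ?thesis by simp
qed

text \<open>Up to an even integer, \<open>3\<^sup>n\<close> times the number is the number with the
  first \<open>n\<close> digits removed. Its leading ternary digit is 0 or 2, so it lies where the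
  wave is constant with value 0 or 1.\<close>

lemma schoenberg_wave_ternary:
  assumes c: "\<And>j. c j = 0 \<or> c j = (1::real)"
  shows "schoenberg_wave (3 ^ n * ternary_value c) = c n"
proof -
  have "\<exists>m::int. 3 ^ n * ternary_value c = 2 * of_int m + ternary_value (\<lambda>j. c (j + n))"
  proof (induction n)
    case 0
    show ?case by (intro exI[of _ 0]) simp
  next
    case (Suc n)
    then obtain m :: int where m: "3 ^ n * ternary_value c = 2 * of_int m + ternary_value (\<lambda>j. c (j + n))"
      by blast
    obtain k :: int where k: "c n = of_int k" using c[of n] by (metis of_int_0 of_int_1)
    have "3 * ternary_value (\<lambda>j. c (j + n)) = 2 * c n + ternary_value (\<lambda>j. c (j + Suc n))"
      using ternary_value_shift[of "\<lambda>j. c (j + n)"] c by simp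
    with m k have "3 ^ Suc n * ternary_value c = 2 * of_int (3 * m + k) + ternary_value (\<lambda>j. c (j + Suc n))"
      by simp
    then show ?case by blast
  qed
  then obtain m :: int where m: "3 ^ n * ternary_value c = 2 * of_int m + ternary_value (\<lambda>j. c (j + n))"
    by blast
  define \<tau> where "\<tau> = ternary_value (\<lambda>j. c (j + n))"
  have \<tau>: "3 * \<tau> = 2 * c n + ternary_value (\<lambda>j. c (Suc j + n))"
    unfolding \<tau>_def using ternary_value_shift[of "\<lambda>j. c (j + n)"] c by simp
  have b: "0 \<le> ternary_value (\<lambda>j. c (Suc j + n))" "ternary_value (\<lambda>j. c (Suc j + n)) \<le> 1"
    using ternary_value_bounds[of "\<lambda>j. c (Suc j + n)"] c by auto
  have "schoenberg_wave \<tau> = c n"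
    using c[of n]
  proof
    assume "c n = 0" then show ?thesis using \<tau> b by (subst schoenberg_wave_low) auto
  next
    assume "c n = 1" then show ?thesis using \<tau> b by (subst schoenberg_wave_high) auto
  qed
  then show ?thesis unfolding m \<tau>_def[symmetric] by (simp add: schoenberg_wave_periodic)
qed

text \<open>The digits with index congruent to \<open>i\<close> modulo \<open>d\<close> are read as
  binary digits; this yields the coordinate with number \<open>i\<close> of Schoenberg's curve in
  dimension \<open>d\<close>.\<close>

definition schoenberg_coordinate :: "nat \<Rightarrow> nat \<Rightarrow> real \<Rightarrow> real" where
  "schoenberg_coordinate d i t = (\<Sum>k. schoenberg_wave (3 ^ (d * k + i) * t) / 2 ^ Suc k)"

lemma continuous_on_schoenberg_coordinate: "continuous_on UNIV (schoenberg_coordinate d i)"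
proof -
  have "uniform_limit UNIV (\<lambda>n t. \<Sum>k<n. schoenberg_wave (3 ^ (d * k + i) * t) / 2 ^ Suc k)
      (\<lambda>t. \<Sum>k. schoenberg_wave (3 ^ (d * k + i) * t) / 2 ^ Suc k) sequentially"
  proof (rule Weierstrass_m_test)
    show "summable (\<lambda>k. 1/2 * (1/2)^k :: real)" by (intro summable_mult summable_geometric) auto
    show "norm (schoenberg_wave (3 ^ (d * k + i) * t) / 2 ^ Suc k) \<le> 1/2 * (1/2)^k" for k t
      using schoenberg_wave_bounds[of "3 ^ (d * k + i) * t"]
      by (simp add: power_divide divide_right_mono)
  qed
  then have "continuous_on UNIV (\<lambda>t. \<Sum>k. schoenberg_wave (3 ^ (d * k + i) * t) / 2 ^ Suc k)"
  proof (rule uniform_limit_theorem[rotated])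
    show "\<forall>\<^sub>F n in sequentially. continuous_on UNIV (\<lambda>t. \<Sum>k<n. schoenberg_wave (3 ^ (d * k + i) * t) / 2 ^ Suc k)"
      unfolding schoenberg_wave_def by (intro always_eventually allI continuous_intros) auto
  qed auto
  then show ?thesis unfolding schoenberg_coordinate_def[abs_def] .
qed

text \<open>The curve \<open>c\<close> is Schoenberg's space-filling curve on a cube that contains
  \<open>K\<close>, and \<open>e\<close> interleaves the binary digits of the coordinates into
  ternary digits 0 and 2. The curve is continuous, the section only Borel; this asymmetry is what
  weak convergence needs, since measures are pushed forward along \<open>e\<close> to the line and
  their limits are pushed back along \<open>c\<close>.\<close>

lemma bounded_set_coded_by_reals:
  fixes K :: "'b::euclidean_space set"
  assumes "bounded K"
  obtains c :: "real \<Rightarrow> 'b" and e :: "'b \<Rightarrow> real"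
  where "continuous_on UNIV c" "e \<in> borel_measurable borel"
    "\<And>x. 0 \<le> e x" "\<And>x. e x \<le> 1" "\<And>x. x \<in> K \<Longrightarrow> c (e x) = x"
proof -
  define d where "d = DIM('b)"
  obtain h where h: "bij_betw h {0..<d} (Basis :: 'b set)"
    unfolding d_def using ex_bij_betw_nat_finite[OF finite_Basis] by blast
  define idx where "idx = inv_into {0..<d} h"
  have idx: "idx b < d" "h (idx b) = b" if "b \<in> Basis" for b
    using h that unfolding idx_def bij_betw_def
    by (metis atLeastLessThan_iff inv_into_into, metis f_inv_into_f)
  obtain a where a: "a > 0" "\<And>x. x \<in> K \<Longrightarrow> norm x < a"
    using assms by (meson bounded_pos_less)
  define coord where "coord = (\<lambda>(x::'b) b. (x \<bullet> b + a) / (2 * a))"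
  define dig where "dig = (\<lambda>x j. binary_digit (j div d) (coord x (h (j mod d))))"
  define e where "e = (\<lambda>x. ternary_value (dig x))"
  define c where "c = (\<lambda>t. \<Sum>b\<in>(Basis::'b set). (2 * a * schoenberg_coordinate d (idx b) t - a) *\<^sub>R b)"
  have dig01: "dig x j = 0 \<or> dig x j = 1" for x j
    unfolding dig_def by (rule binary_digit_01)
  show ?thesis
  proof (rule that[of c e])
    show "continuous_on UNIV c"
      unfolding c_def by (intro continuous_intros continuous_on_schoenberg_coordinate)
    show "e \<in> borel_measurable borel"
      unfolding e_def ternary_value_def dig_def coord_def by measurable
    show "0 \<le> e x" "e x \<le> 1" for x
      unfolding e_def using ternary_value_bounds[of "dig x"] dig01 by auto
    show "c (e x) = x" if x: "x \<in> K" for x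
    proof -
      have "2 * a * schoenberg_coordinate d (idx b) (e x) - a = x \<bullet> b" if b: "b \<in> Basis" for b
      proof -
        have "\<bar>x \<bullet> b\<bar> < a" using a(2)[OF x] Basis_le_norm[OF b, of x] by linarith
        then have "0 \<le> coord x b" "coord x b < 1" unfolding coord_def using a(1) by (auto simp: field_simps)
        note s = binary_expansion_sums[OF this]
        have "schoenberg_wave (3 ^ (d * k + idx b) * e x) = binary_digit k (coord x b)" for k
          unfolding e_def schoenberg_wave_ternary[of "dig x", OF dig01]
          unfolding dig_def using idx[OF b] by simp
        then have "schoenberg_coordinate d (idx b) (e x) = coord x b"
          unfolding schoenberg_coordinate_def using s by (simp add: sums_iff)
        then show ?thesis unfolding coord_def using a(1) by (simp add: field_simps)
      qed
      then show ?thesis unfolding c_def by (simp add: euclidean_representation)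
    qed
  qed
qed

section \<open>Probability measures on a subset\<close>

lemma prob_onD:
  assumes "M \<in> prob_on K"
  shows "prob_space M" "sets M = sets (restrict_space borel K)" "space M = K"
proof -
  show "prob_space M" and s: "sets M = sets (restrict_space borel K)" using assms by (auto simp: prob_on_def)
  show "space M = K" using sets_eq_imp_space_eq[OF s] by (simp add: space_restrict_space)
qed

lemma prob_on_measurable_restrict:
  assumes "M \<in> prob_on K" "h \<in> measurable (restrict_space borel K) N"
  shows "h \<in> measurable M N"
  using assms(2) measurable_cong_sets[OF prob_onD(2)[OF assms(1)] refl, of N] by simp

lemma prob_on_measurable:
  assumes "M \<in> prob_on K" "h \<in> measurable borel N"
  shows "h \<in> measurable M N"
  by (rule prob_on_measurable_restrict[OF assms(1) measurable_restrict_space1[OF assms(2)]])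

lemma prob_on_measurable_continuous:
  fixes h :: "'b::topological_space \<Rightarrow> 'c::topological_space"
  assumes "M \<in> prob_on K" "continuous_on K h"
  shows "h \<in> borel_measurable M"
  by (rule prob_on_measurable_restrict[OF assms(1) borel_measurable_continuous_on_restrict[OF assms(2)]])

lemma distr_in_prob_on:
  assumes "prob_space P" "X \<in> measurable P (restrict_space borel K)"
  shows "distr P (restrict_space borel K) X \<in> prob_on K"
  using prob_space.prob_space_distr[OF assms] by (simp add: prob_on_def)

lemma prob_on_integrable_bounded:
  fixes h :: "'b::topological_space \<Rightarrow> real"
  assumes M: "M \<in> prob_on K" and h: "h \<in> borel_measurable M" and B: "\<And>x. x \<in> K \<Longrightarrow> \<bar>h x\<bar> \<le> B"
  shows "integrable M h"
proof -
  interpret prob_space M by (rule prob_onD[OF M])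
  show ?thesis by (rule integrable_const_bound[of _ B]) (use B h AE_space[of M] prob_onD(3)[OF M] in auto)
qed

lemma compact_continuous_bounded:
  fixes h :: "'b::topological_space \<Rightarrow> real"
  assumes "compact K" "continuous_on K h"
  obtains B where "B > 0" "\<And>x. x \<in> K \<Longrightarrow> \<bar>h x\<bar> \<le> B"
proof -
  have "bounded (h ` K)" using assms by (intro compact_imp_bounded compact_continuous_image)
  then show ?thesis using that unfolding bounded_pos by auto
qed

lemma prob_on_integrable_continuous:
  fixes h :: "'b::topological_space \<Rightarrow> real"
  assumes "M \<in> prob_on K" "compact K" "continuous_on K h"
  shows "integrable M h"
  by (rule compact_continuous_bounded[OF assms(2,3)])
     (rule prob_on_integrable_bounded[OF assms(1) prob_on_measurable_continuous[OF assms(1,3)]])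

text \<open>These cut-off functions are the continuous approximations of the indicator of a closed
  set.\<close>

lemma infdist_cutoff_tendsto:
  fixes x :: "'b::metric_space"
  assumes "closed A" "A \<noteq> {}"
  shows "(\<lambda>k. max 0 (1 - real k * infdist x A)) \<longlonglongrightarrow> indicator A x"
proof (cases "x \<in> A")
  case False
  then have pos: "infdist x A > 0"
    using assms in_closed_iff_infdist_zero infdist_nonneg[of x A] by (metis less_eq_real_def)
  obtain k0 :: nat where "1 / infdist x A < k0" using reals_Archimedean2 by blast
  then have "1 - real k * infdist x A \<le> 0" if "k \<ge> k0" for k
  proof -
    have "1 / infdist x A < k" using that \<open>1 / infdist x A < k0\<close> by linarith
    then show ?thesis using pos by (simp add: field_simps)
  qed
  then have "\<forall>\<^sub>F k in sequentially. max 0 (1 - real k * infdist x A) = indicator A x"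
    using False by (auto simp: eventually_sequentially intro!: exI[of _ k0] max_absorb1)
  then show ?thesis by (rule tendsto_eventually)
qed (simp add: infdist_zero)

text \<open>The closed sets generate the Borel sets and are stable under intersection, and their
  indicators are limits of continuous functions.\<close>

lemma prob_on_eqI:
  fixes M N :: "'b::euclidean_space measure"
  assumes K: "K \<in> sets borel" and M: "M \<in> prob_on K" and N: "N \<in> prob_on K"
    and eq: "\<And>h. continuous_on UNIV h \<Longrightarrow> (\<And>x. 0 \<le> h x \<and> h x \<le> (1::real)) \<Longrightarrow> (\<integral>x. h x \<partial>M) = (\<integral>x. h x \<partial>N)"
  shows "M = N"
proof -
  let ?M = "distr M borel (\<lambda>x. x)" and ?N = "distr N borel (\<lambda>x. x)"
  have idM: "(\<lambda>x. x) \<in> borel_measurable M" "(\<lambda>x. x) \<in> borel_measurable N"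
    by (rule prob_on_measurable[OF M]; simp) (rule prob_on_measurable[OF N]; simp)
  have pM: "prob_space ?M" "prob_space ?N"
    using prob_space.prob_space_distr[OF prob_onD(1)[OF M] idM(1)] prob_space.prob_space_distr[OF prob_onD(1)[OF N] idM(2)] by auto
  have closed_lim: "(\<lambda>k. \<integral>x. max 0 (1 - real k * infdist x A) \<partial>Q) \<longlonglongrightarrow> measure Q A"
    if A: "closed A" "A \<noteq> {}" and Q: "prob_space Q" "sets Q = sets borel" for A :: "'b set" and Q
  proof -
    interpret Q: prob_space Q by (rule Q)
    have As: "A \<in> sets Q" using A Q by simp
    have "(\<lambda>k. \<integral>x. max 0 (1 - real k * infdist x A) \<partial>Q) \<longlonglongrightarrow> (\<integral>x. indicator A x \<partial>Q)"
    proof (rule integral_dominated_convergence[where w="\<lambda>_. 1"])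
      show "indicator A \<in> borel_measurable Q" using As by simp
      show "(\<lambda>x. max 0 (1 - real k * infdist x A)) \<in> borel_measurable Q" for k
        unfolding measurable_cong_sets[OF Q(2) refl]
        by (intro borel_measurable_continuous_onI continuous_intros)
      show "AE x in Q. norm (max 0 (1 - real k * infdist x A)) \<le> 1" for k
        by (intro always_eventually) (auto simp: infdist_nonneg)
      show "AE x in Q. (\<lambda>k. max 0 (1 - real k * infdist x A)) \<longlonglongrightarrow> indicator A x"
        by (intro AE_I2 infdist_cutoff_tendsto A)
    qed simp
    then show ?thesis using As by simp
  qed
  have "?M = ?N"
  proof (rule measure_eqI_generator_eq[where E="Collect closed" and \<Omega>=UNIV and A="\<lambda>_. UNIV"])
    show "Int_stable (Collect closed)" by (auto simp: Int_stable_def)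
    show "sets ?M = sigma_sets UNIV (Collect closed)" "sets ?N = sigma_sets UNIV (Collect closed)"
      by (simp_all add: borel_eq_closed)
    show "emeasure ?M UNIV \<noteq> \<infinity>"
      using finite_measure.emeasure_finite[OF prob_space.finite_measure[OF pM(1)]] by simp
    fix A :: "'b set" assume A: "A \<in> Collect closed"
    have "measure ?M A = measure ?N A"
    proof (cases "A = {}")
      case False
      have "(\<integral>x. max 0 (1 - real k * infdist x A) \<partial>?M) = (\<integral>x. max 0 (1 - real k * infdist x A) \<partial>?N)" for k
      proof -
        have c: "continuous_on UNIV (\<lambda>x. max 0 (1 - real k * infdist x A))" by (intro continuous_intros)
        then have b: "(\<lambda>x. max 0 (1 - real k * infdist x A)) \<in> borel_measurable borel"
          by (rule borel_measurable_continuous_onI)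
        show ?thesis
          unfolding integral_distr[OF idM(1) b] integral_distr[OF idM(2) b]
          by (rule eq[OF c]) (auto simp: infdist_nonneg)
      qed
      then show ?thesis
        using closed_lim[of A ?M] closed_lim[of A ?N] A False pM LIMSEQ_unique by auto
    qed simp
    then show "emeasure ?M A = emeasure ?N A"
      using pM by (simp add: finite_measure.emeasure_eq_measure prob_space.finite_measure)
  qed auto
  show ?thesis
  proof (rule measure_eqI)
    show "sets M = sets N" using prob_onD(2)[OF M] prob_onD(2)[OF N] by simp
    fix A assume "A \<in> sets M"
    then have A: "A \<in> sets borel" "A \<subseteq> K" using K prob_onD(2)[OF M] by (auto simp: sets_restrict_space_iff)
    have "emeasure M A = emeasure ?M A" using A idM prob_onD(3)[OF M] by (simp add: emeasure_distr Int_absorb2)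
    also have "\<dots> = emeasure ?N A" using \<open>?M = ?N\<close> by simp
    also have "\<dots> = emeasure N A" using A idM prob_onD(3)[OF N] by (simp add: emeasure_distr Int_absorb2)
    finally show "emeasure M A = emeasure N A" .
  qed
qed

section \<open>Sequential compactness of probability measures on a compact set\<close>

text \<open>The measures are transferred to the real line by the section of a continuous curve;
  there Helly's theorem and Skorohod's representation apply, and the curve carries the pointwise
  convergence back. Pointwise convergence of random variables turns all later passages to the limit,
  including those in the double integral of the interaction, into dominated convergence.\<close>

lemma skorohod_compact:
  fixes K :: "'b::euclidean_space set" and M :: "nat \<Rightarrow> 'b measure"
  assumes K: "compact K" and M: "\<And>n. M n \<in> prob_on K"
  obtains r :: "nat \<Rightarrow> nat" and P :: "real measure" and Z :: "nat \<Rightarrow> real \<Rightarrow> 'b" and Z' :: "real \<Rightarrow> 'b"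
  where "strict_mono r" "prob_space P"
    "\<And>n. Z n \<in> measurable P (restrict_space borel K)"
    "\<And>n. distr P (restrict_space borel K) (Z n) = M (r n)"
    "Z' \<in> measurable P (restrict_space borel K)"
    "\<And>\<omega>. \<omega> \<in> space P \<Longrightarrow> (\<lambda>n. Z n \<omega>) \<longlonglongrightarrow> Z' \<omega>"
proof -
  let ?B = "restrict_space borel K :: 'b measure"
  have Kb: "K \<in> sets borel" using K by (simp add: compact_imp_closed)
  obtain c :: "real \<Rightarrow> 'b" and e :: "'b \<Rightarrow> real" where ce: "continuous_on UNIV c"
    and e [measurable]: "e \<in> borel_measurable borel"
    and e01: "\<And>x. 0 \<le> e x" "\<And>x. e x \<le> 1" and inv: "\<And>x. x \<in> K \<Longrightarrow> c (e x) = x"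
    using bounded_set_coded_by_reals[OF compact_imp_bounded[OF K]] by metis
  have c [measurable]: "c \<in> borel_measurable borel" using ce by (rule borel_measurable_continuous_onI)
  have pM: "prob_space (M n)" and sM: "sets (M n) = sets ?B" for n
    using M[of n] by (auto simp: prob_on_def)
  have spM: "space (M n) = K" for n using sets_eq_imp_space_eq[OF sM[of n]] by (simp add: space_restrict_space)
  have eM [measurable]: "e \<in> measurable (M n) borel" for n
    using measurable_restrict_space1[OF e, of K] measurable_cong_sets[OF sM[of n] refl] by blast
  define N where "N = (\<lambda>n. distr (M n) borel e)"
  have rN: "real_distribution (N n)" for n
    unfolding N_def real_distribution_def real_distribution_axioms_def
    using prob_space.prob_space_distr[OF pM eM] by auto
  have "tight N"
    unfolding tight_def
  proof (intro conjI allI impI rN)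
    fix \<epsilon> :: real assume "\<epsilon> > 0"
    have "measure (N n) {-1<..2} = 1" for n
    proof -
      have "- 1 < e x \<and> e x \<le> 2" for x using e01[of x] by linarith
      then have "e -` {-1<..2} \<inter> space (M n) = space (M n)" by auto
      then show ?thesis unfolding N_def by (subst measure_distr) (auto simp: prob_space.prob_space[OF pM])
    qed
    then show "\<exists>a b. a < b \<and> (\<forall>n. 1 - \<epsilon> < measure (N n) {a<..b})"
      using \<open>\<epsilon> > 0\<close> by (intro exI[of _ "-1"] exI[of _ 2]) auto
  qed
  from tight_imp_convergent_subsubsequence[OF this strict_mono_id]
  obtain r N' where r: "strict_mono r" and N': "real_distribution N'" and w: "weak_conv_m (N \<circ> id \<circ> r) N'" by auto
  define N2 where "N2 = N \<circ> id \<circ> r"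
  have rN2: "real_distribution (N2 n)" for n unfolding N2_def using rN by simp
  obtain P :: "real measure" and Y Y' where P: "prob_space P"
    and Y [measurable]: "\<And>n. Y n \<in> borel_measurable P"
    and dY: "\<And>n. distr P borel (Y n) = N2 n" and Y'[measurable]: "Y' \<in> borel_measurable P"
    and conv: "\<And>\<omega>. \<omega> \<in> space P \<Longrightarrow> (\<lambda>n. Y n \<omega>) \<longlonglongrightarrow> Y' \<omega>"
  proof -
    obtain Q :: "real measure" and X X' where "prob_space Q \<and> (\<forall>n. X n \<in> measurable Q borel) \<and>
        (\<forall>n. distr Q borel (X n) = N2 n) \<and> X' \<in> measurable Q lborel \<and> distr Q borel X' = N' \<and>
        (\<forall>x \<in> space Q. (\<lambda>n. X n x) \<longlonglongrightarrow> X' x)"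
      using Skorohod[OF rN2 N' w[folded N2_def]] by (elim exE)
    then show ?thesis by (intro that[of Q X X']) auto
  qed
  interpret P: prob_space P by (rule P)
  have dist: "distr P borel (\<lambda>\<omega>. c (Y n \<omega>)) = distr (M (r n)) borel (\<lambda>x. x)" for n
  proof -
    have "distr P borel (\<lambda>\<omega>. c (Y n \<omega>)) = distr (distr P borel (Y n)) borel c"
      by (subst distr_distr) (auto simp: comp_def)
    also have "\<dots> = distr (M (r n)) borel (c \<circ> e)"
      unfolding dY N2_def N_def by (simp add: distr_distr)
    also have "\<dots> = distr (M (r n)) borel (\<lambda>x. x)"
      by (rule distr_cong) (auto simp: spM inv)
    finally show ?thesis .
  qed
  have idM [measurable]: "(\<lambda>x. x) \<in> measurable (M n) borel" for n
    using measurable_restrict_space1[of "\<lambda>x::'b. x" borel borel K] measurable_cong_sets[OF sM[of n] refl, of "borel :: 'b measure"] by simp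
  have "AE \<omega> in P. c (Y n \<omega>) \<in> K" for n
  proof -
    have "AE x in distr P borel (\<lambda>\<omega>. c (Y n \<omega>)). x \<in> K"
      unfolding dist by (subst AE_distr_iff) (use Kb AE_space[of "M (r n)"] spM in auto)
    then show ?thesis by (subst (asm) AE_distr_iff) (use Kb in auto)
  qed
  then have AEK: "AE \<omega> in P. \<forall>n. c (Y n \<omega>) \<in> K" by (simp add: AE_all_countable)
  \<comment> \<open>The represented variables take values in \<open>K\<close> only almost surely; on
    the exceptional null set they are replaced by a fixed point of \<open>K\<close>.\<close>
  define G where "G = {\<omega> \<in> space P. \<forall>n. c (Y n \<omega>) \<in> K}"
  have G [measurable]: "G \<in> sets P" unfolding G_def using Kb by measurable
  obtain x0 where x0: "x0 \<in> K" using spM prob_space.not_empty[OF pM[of 0]] by auto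
  define Z where "Z = (\<lambda>n \<omega>. if \<omega> \<in> G then c (Y n \<omega>) else x0)"
  define Z' where "Z' = (\<lambda>\<omega>. if \<omega> \<in> G then c (Y' \<omega>) else x0)"
  have convZ: "(\<lambda>n. Z n \<omega>) \<longlonglongrightarrow> Z' \<omega>" if "\<omega> \<in> space P" for \<omega>
  proof -
    have "isCont c (Y' \<omega>)" using ce by (simp add: continuous_on_eq_continuous_at)
    then have "(\<lambda>n. c (Y n \<omega>)) \<longlonglongrightarrow> c (Y' \<omega>)" using conv[OF that] by (rule isCont_tendsto_compose)
    then show ?thesis unfolding Z_def Z'_def by auto
  qed
  have ZK: "Z n \<omega> \<in> K" for n \<omega> unfolding Z_def G_def using x0 by auto
  have Z'K: "Z' \<omega> \<in> K" if "\<omega> \<in> space P" for \<omega>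
    by (rule closed_sequentially[OF compact_imp_closed[OF K] ZK convZ[OF that]])
  have GP: "G \<inter> space P \<in> sets P" using G by auto
  have Zm: "Z n \<in> borel_measurable P" for n unfolding Z_def by (rule measurable_If_set[OF _ _ GP]) auto
  have Zm': "Z' \<in> borel_measurable P" unfolding Z'_def by (rule measurable_If_set[OF _ _ GP]) auto
  have mZ: "Z n \<in> measurable P ?B" for n by (intro measurable_restrict_space2 Zm) (auto simp: ZK)
  have mZ': "Z' \<in> measurable P ?B" by (intro measurable_restrict_space2 Zm') (auto simp: Z'K)
  have dZ: "distr P ?B (Z n) = M (r n)" for n
  proof (rule measure_eqI)
    show "sets (distr P ?B (Z n)) = sets (M (r n))" by (simp add: sM)
    fix A assume "A \<in> sets (distr P ?B (Z n))"
    then have A: "A \<in> sets ?B" by simp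
    then have Ab: "A \<in> sets borel" "A \<subseteq> K" using Kb by (auto simp: sets_restrict_space_iff)
    have "emeasure (distr P ?B (Z n)) A = emeasure P (Z n -` A \<inter> space P)"
      by (rule emeasure_distr[OF mZ A])
    also have "\<dots> = emeasure (distr P borel (Z n)) A" by (rule emeasure_distr[OF Zm Ab(1), symmetric])
    also have "distr P borel (Z n) = distr P borel (\<lambda>\<omega>. c (Y n \<omega>))"
    proof (rule distr_cong_AE[OF refl refl])
      show "AE \<omega> in P. Z n \<omega> = c (Y n \<omega>)"
        using AEK AE_space by eventually_elim (simp add: Z_def G_def)
    qed (rule Zm, measurable)
    also have "emeasure \<dots> A = emeasure (M (r n)) A"
      unfolding dist using Ab by (subst emeasure_distr) (auto simp: spM Int_absorb2)
    finally show "emeasure (distr P ?B (Z n)) A = emeasure (M (r n)) A" .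
  qed
  show ?thesis by (rule that[OF r P mZ dZ mZ' convZ])
qed

lemma integral_tendsto_of_pointwise:
  fixes h :: "'b::topological_space \<Rightarrow> real"
  assumes P: "prob_space P" and K: "compact K" and h: "continuous_on K h"
    and X: "\<And>n. X n \<in> measurable P (restrict_space borel K)" and X': "X' \<in> measurable P (restrict_space borel K)"
    and lim: "\<And>\<omega>. \<omega> \<in> space P \<Longrightarrow> (\<lambda>n. X n \<omega>) \<longlonglongrightarrow> X' \<omega>"
  shows "(\<lambda>n. \<integral>x. h x \<partial>distr P (restrict_space borel K) (X n)) \<longlonglongrightarrow> (\<integral>x. h x \<partial>distr P (restrict_space borel K) X')"
proof -
  interpret P: prob_space P by (rule P)
  have hm: "h \<in> borel_measurable (restrict_space borel K)" by (rule borel_measurable_continuous_on_restrict[OF h])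
  obtain B where B: "\<And>x. x \<in> K \<Longrightarrow> \<bar>h x\<bar> \<le> B" using compact_continuous_bounded[OF K h] by metis
  have XK: "X n \<omega> \<in> K" "X' \<omega> \<in> K" if "\<omega> \<in> space P" for n \<omega>
    using measurable_space[OF X that] measurable_space[OF X' that] by (auto simp: space_restrict_space)
  have "(\<lambda>n. \<integral>\<omega>. h (X n \<omega>) \<partial>P) \<longlonglongrightarrow> (\<integral>\<omega>. h (X' \<omega>) \<partial>P)"
  proof (rule integral_dominated_convergence[where w="\<lambda>_. B"])
    show "(\<lambda>\<omega>. h (X' \<omega>)) \<in> borel_measurable P" "(\<lambda>\<omega>. h (X n \<omega>)) \<in> borel_measurable P" for n
      by (rule measurable_compose[OF X' hm], rule measurable_compose[OF X hm])
    show "AE \<omega> in P. (\<lambda>n. h (X n \<omega>)) \<longlonglongrightarrow> h (X' \<omega>)"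
    proof (rule AE_I2)
      fix \<omega> assume \<omega>: "\<omega> \<in> space P"
      show "(\<lambda>n. h (X n \<omega>)) \<longlonglongrightarrow> h (X' \<omega>)"
        by (rule continuous_on_tendsto_compose[OF h lim[OF \<omega>]]) (use XK \<omega> in auto)
    qed
    show "AE \<omega> in P. norm (h (X n \<omega>)) \<le> B" for n using XK B by (intro AE_I2) auto
  qed simp
  then show ?thesis by (simp add: integral_distr[OF X hm] integral_distr[OF X' hm])
qed

section \<open>Mixtures and parameter integrals\<close>

text \<open>The convex combination \<open>(1 - \<epsilon>) M + \<epsilon> N\<close>, drawn in two
  stages: a coin with success probability \<open>\<epsilon>\<close> decides from which measure to
  sample.\<close>

definition mixture :: "real \<Rightarrow> 'b measure \<Rightarrow> 'b measure \<Rightarrow> 'b measure" where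
  "mixture \<epsilon> M N = measure_pmf (bernoulli_pmf \<epsilon>) \<bind> (\<lambda>c. if c then N else M)"

lemma
  assumes M: "M \<in> prob_on K" and N: "N \<in> prob_on K" and \<epsilon>: "0 \<le> \<epsilon>" "\<epsilon> \<le> 1"
  shows mixture_in_prob_on: "mixture \<epsilon> M N \<in> prob_on K"
    and nn_integral_mixture: "h \<in> borel_measurable (restrict_space borel K) \<Longrightarrow>
       (\<integral>\<^sup>+x. h x \<partial>mixture \<epsilon> M N) = ennreal (1 - \<epsilon>) * (\<integral>\<^sup>+x. h x \<partial>M) + ennreal \<epsilon> * (\<integral>\<^sup>+x. h x \<partial>N)"
proof -
  let ?B = "restrict_space borel K"
  define b where "b = measure_pmf (bernoulli_pmf \<epsilon>)"
  define k where "k = (\<lambda>c. if c then N else M)"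
  have k: "k c \<in> space (subprob_algebra ?B)" for c
    unfolding k_def space_subprob_algebra
    using prob_onD[OF M] prob_onD[OF N] by (auto intro: prob_space_imp_subprob_space)
  then have km: "k \<in> measurable b (subprob_algebra ?B)" unfolding b_def by simp
  have Q: "mixture \<epsilon> M N = b \<bind> k" by (simp add: mixture_def b_def k_def)
  have sQ: "sets (mixture \<epsilon> M N) = sets ?B" unfolding Q by (rule sets_bind) (use prob_onD[OF M] prob_onD[OF N] in \<open>auto simp: b_def k_def\<close>)
  have nn: "(\<integral>\<^sup>+x. h x \<partial>mixture \<epsilon> M N) = ennreal (1 - \<epsilon>) * (\<integral>\<^sup>+x. h x \<partial>M) + ennreal \<epsilon> * (\<integral>\<^sup>+x. h x \<partial>N)"
    if h: "h \<in> borel_measurable ?B" for h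
    unfolding Q nn_integral_bind[OF h km] unfolding b_def k_def using \<epsilon>
    by (simp add: nn_integral_bernoulli_pmf mult.commute add.commute)
  then show "h \<in> borel_measurable ?B \<Longrightarrow>
       (\<integral>\<^sup>+x. h x \<partial>mixture \<epsilon> M N) = ennreal (1 - \<epsilon>) * (\<integral>\<^sup>+x. h x \<partial>M) + ennreal \<epsilon> * (\<integral>\<^sup>+x. h x \<partial>N)" .
  have "emeasure (mixture \<epsilon> M N) (space (mixture \<epsilon> M N)) = (\<integral>\<^sup>+x. 1 \<partial>mixture \<epsilon> M N)" by simp
  also have "\<dots> = ennreal (1 - \<epsilon>) * 1 + ennreal \<epsilon> * 1"
    using prob_space.emeasure_space_1[OF prob_onD(1)[OF M]] prob_space.emeasure_space_1[OF prob_onD(1)[OF N]]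
    by (subst nn) auto
  also have "\<dots> = 1" using \<epsilon> by (simp flip: ennreal_plus)
  finally show "mixture \<epsilon> M N \<in> prob_on K" using sQ by (auto simp: prob_on_def intro: prob_spaceI)
qed

text \<open>Adding the bound \<open>B\<close> reduces the claim to nonnegative functions.\<close>

lemma integral_mixture:
  fixes h :: "'b::topological_space \<Rightarrow> real"
  assumes M: "M \<in> prob_on K" and N: "N \<in> prob_on K" and \<epsilon>: "0 \<le> \<epsilon>" "\<epsilon> \<le> 1"
    and h: "h \<in> borel_measurable (restrict_space borel K)" and B: "\<And>x. x \<in> K \<Longrightarrow> \<bar>h x\<bar> \<le> B"
  shows "(\<integral>x. h x \<partial>mixture \<epsilon> M N) = (1 - \<epsilon>) * (\<integral>x. h x \<partial>M) + \<epsilon> * (\<integral>x. h x \<partial>N)"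
proof -
  let ?Q = "mixture \<epsilon> M N"
  note Q = mixture_in_prob_on[OF M N \<epsilon>]
  have e: "(\<integral>\<^sup>+x. ennreal (h x + B) \<partial>R) = ennreal ((\<integral>x. h x \<partial>R) + B) \<and> 0 \<le> (\<integral>x. h x \<partial>R) + B" if R: "R \<in> prob_on K" for R
  proof -
    interpret R: prob_space R by (rule prob_onD[OF R])
    have ih: "integrable R h"
      by (rule prob_on_integrable_bounded[OF R prob_on_measurable_restrict[OF R h] B])
    have pos: "AE x in R. 0 \<le> h x + B"
    proof (rule AE_I2)
      fix x assume "x \<in> space R"
      then have "\<bar>h x\<bar> \<le> B" using B prob_onD(3)[OF R] by simp
      then show "0 \<le> h x + B" by linarith
    qed
    have ii: "integrable R (\<lambda>x. h x + B)" using ih by simp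
    have ee: "(\<integral>x. h x + B \<partial>R) = (\<integral>x. h x \<partial>R) + B" using ih by (simp add: R.prob_space)
    show ?thesis using nn_integral_eq_integral[OF ii pos] integral_nonneg_AE[OF pos] ee by simp
  qed
  have "ennreal ((\<integral>x. h x \<partial>?Q) + B) = ennreal ((1 - \<epsilon>) * ((\<integral>x. h x \<partial>M) + B) + \<epsilon> * ((\<integral>x. h x \<partial>N) + B))"
    using nn_integral_mixture[OF M N \<epsilon>, of "\<lambda>x. ennreal (h x + B)"] h e[OF Q] e[OF M] e[OF N] \<epsilon>
    by (simp add: ennreal_mult ennreal_plus)
  then have "(\<integral>x. h x \<partial>?Q) + B = (1 - \<epsilon>) * ((\<integral>x. h x \<partial>M) + B) + \<epsilon> * ((\<integral>x. h x \<partial>N) + B)"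
    using e[OF Q] e[OF M] e[OF N] \<epsilon> by (subst (asm) ennreal_inj) auto
  then show ?thesis by (simp add: algebra_simps)
qed

lemma distr_mixture:
  assumes M: "M \<in> prob_on K" and N: "N \<in> prob_on K" and \<epsilon>: "0 \<le> \<epsilon>" "\<epsilon> \<le> 1"
    and h: "h \<in> measurable (restrict_space borel K) (restrict_space borel K')"
  shows "distr (mixture \<epsilon> M N) (restrict_space borel K') h
    = mixture \<epsilon> (distr M (restrict_space borel K') h) (distr N (restrict_space borel K') h)"
proof (rule measure_eqI)
  let ?B = "restrict_space borel K'"
  note Q = mixture_in_prob_on[OF M N \<epsilon>]
  note hm = prob_on_measurable_restrict[OF _ h]
  note d = distr_in_prob_on[OF prob_onD(1) hm]
  note Q' = mixture_in_prob_on[OF d[OF M M] d[OF N N] \<epsilon>]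
  show "sets (distr (mixture \<epsilon> M N) ?B h) = sets (mixture \<epsilon> (distr M ?B h) (distr N ?B h))"
    using prob_onD(2)[OF Q'] by simp
  fix A assume "A \<in> sets (distr (mixture \<epsilon> M N) ?B h)"
  then have A: "A \<in> sets ?B" by simp
  have im: "(\<lambda>x. indicator A x :: ennreal) \<in> borel_measurable ?B" using A by simp
  then have im': "(\<lambda>x. indicator A x :: ennreal) \<in> borel_measurable (distr R ?B h)" for R by simp
  have "emeasure (distr (mixture \<epsilon> M N) ?B h) A = (\<integral>\<^sup>+x. indicator A (h x) \<partial>mixture \<epsilon> M N)"
    using A nn_integral_distr[OF hm[OF Q] im'] by simp
  also have "\<dots> = ennreal (1 - \<epsilon>) * (\<integral>\<^sup>+x. indicator A x \<partial>distr M ?B h) + ennreal \<epsilon> * (\<integral>\<^sup>+x. indicator A x \<partial>distr N ?B h)"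
    unfolding nn_integral_mixture[OF M N \<epsilon> measurable_compose[OF h im]] nn_integral_distr[OF hm[OF M] im'] nn_integral_distr[OF hm[OF N] im'] ..
  also have "\<dots> = (\<integral>\<^sup>+x. indicator A x \<partial>mixture \<epsilon> (distr M ?B h) (distr N ?B h))"
    by (rule nn_integral_mixture[OF d[OF M M] d[OF N N] \<epsilon> im, symmetric])
  also have "\<dots> = emeasure (mixture \<epsilon> (distr M ?B h) (distr N ?B h)) A"
    using A prob_onD(2)[OF Q'] by simp
  finally show "emeasure (distr (mixture \<epsilon> M N) ?B h) A = emeasure (mixture \<epsilon> (distr M ?B h) (distr N ?B h)) A" .
qed

lemma mixture_self:
  assumes M: "M \<in> prob_on K" and \<epsilon>: "0 \<le> \<epsilon>" "\<epsilon> \<le> 1"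
  shows "mixture \<epsilon> M M = M"
proof (rule measure_eqI)
  note Q = mixture_in_prob_on[OF M M \<epsilon>]
  show "sets (mixture \<epsilon> M M) = sets M" using prob_onD(2)[OF Q] prob_onD(2)[OF M] by simp
  fix A assume "A \<in> sets (mixture \<epsilon> M M)"
  then have A: "A \<in> sets (mixture \<epsilon> M M)" "A \<in> sets M" "A \<in> sets (restrict_space borel K)"
    using prob_onD(2)[OF Q] prob_onD(2)[OF M] by simp_all
  have "(\<integral>\<^sup>+x. indicator A x \<partial>mixture \<epsilon> M M) = ennreal (1 - \<epsilon>) * (\<integral>\<^sup>+x. indicator A x \<partial>M) + ennreal \<epsilon> * (\<integral>\<^sup>+x. indicator A x \<partial>M)"
    using A by (intro nn_integral_mixture[OF M M \<epsilon>]) simp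
  also have "\<dots> = (ennreal (1 - \<epsilon>) + ennreal \<epsilon>) * emeasure M A"
    using A by (simp add: distrib_right)
  also have "ennreal (1 - \<epsilon>) + ennreal \<epsilon> = 1" using \<epsilon> by (simp flip: ennreal_plus)
  finally show "emeasure (mixture \<epsilon> M M) A = emeasure M A" using A by simp
qed

lemma continuous_on_parameter_integral:
  fixes h :: "'b::euclidean_space \<Rightarrow> 'b \<Rightarrow> 'c::{banach,second_countable_topology}"
  assumes K: "compact K" and h: "continuous_on (K \<times> K) (\<lambda>z. h (fst z) (snd z))" and M: "M \<in> prob_on K"
  shows "continuous_on K (\<lambda>z. \<integral>w. h z w \<partial>M)"
  unfolding continuous_on_sequentially
proof (intro allI ballI impI, elim conjE)
  fix x :: "nat \<Rightarrow> 'b" and a assume x: "\<forall>n. x n \<in> K" "x \<longlonglongrightarrow> a" and a: "a \<in> K"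
  have sec: "continuous_on K (h z)" if "z \<in> K" for z
  proof -
    have "continuous_on K (\<lambda>w. h (fst (z, w)) (snd (z, w)))"
      by (rule continuous_on_compose2[OF h]) (use that in \<open>auto intro!: continuous_intros\<close>)
    then show ?thesis by simp
  qed
  have "bounded ((\<lambda>z. h (fst z) (snd z)) ` (K \<times> K))"
    using h K by (intro compact_imp_bounded compact_continuous_image compact_Times)
  then obtain B where B: "\<And>z w. z \<in> K \<Longrightarrow> w \<in> K \<Longrightarrow> norm (h z w) \<le> B" unfolding bounded_pos by force
  have mz: "h z \<in> borel_measurable M" if "z \<in> K" for z by (rule prob_on_measurable_continuous[OF M sec[OF that]])
  interpret prob_space M by (rule prob_onD[OF M])
  have "(\<lambda>n. \<integral>w. h (x n) w \<partial>M) \<longlonglongrightarrow> (\<integral>w. h a w \<partial>M)"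
  proof (rule integral_dominated_convergence[where w="\<lambda>_. B"])
    show "AE w in M. (\<lambda>n. h (x n) w) \<longlonglongrightarrow> h a w"
    proof (rule AE_I2)
      fix w assume "w \<in> space M"
      then have w: "w \<in> K" using prob_onD(3)[OF M] by simp
      have "(\<lambda>n. h (fst (x n, w)) (snd (x n, w))) \<longlonglongrightarrow> h (fst (a, w)) (snd (a, w))"
        by (rule continuous_on_tendsto_compose[OF h]) (use x a w in \<open>auto intro!: tendsto_Pair\<close>)
      then show "(\<lambda>n. h (x n) w) \<longlonglongrightarrow> h a w" by simp
    qed
    show "AE w in M. norm (h (x n) w) \<le> B" for n
      by (rule AE_I2) (use x B prob_onD(3)[OF M] in auto)
  qed (use mz x a in auto)
  then show "((\<lambda>z. \<integral>w. h z w \<partial>M) \<circ> x) \<longlonglongrightarrow> (\<integral>w. h a w \<partial>M)" by (simp add: comp_def)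
qed

text \<open>Energies that are quadratic in the size of a perturbation give their first variations in
  this form.\<close>

lemma first_order_nonneg:
  fixes a b :: real
  assumes "\<And>\<epsilon>. 0 < \<epsilon> \<Longrightarrow> \<epsilon> < 1 \<Longrightarrow> 0 \<le> \<epsilon> * a + \<epsilon>\<^sup>2 * b"
  shows "0 \<le> a"
proof (rule tendsto_lowerbound)
  show "((\<lambda>\<epsilon>. a + \<epsilon> * b) \<longlongrightarrow> a) (at_right 0)" by real_asymp
  show "\<forall>\<^sub>F \<epsilon> in at_right 0. 0 \<le> a + \<epsilon> * b"
    unfolding eventually_at_right_field
  proof (intro exI[of _ 1] conjI allI impI)
    fix \<epsilon> :: real assume e: "0 < \<epsilon>" "\<epsilon> < 1"
    have "0 \<le> \<epsilon> * (a + \<epsilon> * b)" using assms[OF e] by (simp add: power2_eq_square algebra_simps)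
    then show "0 \<le> a + \<epsilon> * b" using e by (simp add: zero_le_mult_iff)
  qed simp
qed simp

section \<open>The cost functions and the interaction potential\<close>

locale concentration =
  fixes \<Omega> :: "'a::euclidean_space set" and f f' V V' V'' :: "real \<Rightarrow> real"
  assumes compact: "compact \<Omega>" and convex: "convex \<Omega>" and interior_nonempty: "interior \<Omega> \<noteq> {}"
    and f_deriv: "\<And>t. t \<ge> 0 \<Longrightarrow> (f has_real_derivative f' t) (at t within {0..})"
    and f'_continuous: "continuous_on {0..} f'"
    and f_strictly_convex: "strictly_convex_on {0..} f"
    and f_0: "f 0 = 0"
    and f_superlinear: "filterlim (\<lambda>t. f t / t) at_top at_top"
    and V_nonneg: "\<And>t. t \<ge> 0 \<Longrightarrow> V t \<ge> 0"
    and V_deriv: "\<And>t. t \<ge> 0 \<Longrightarrow> (V has_real_derivative V' t) (at t within {0..})"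
    and V'_deriv: "\<And>t. t \<ge> 0 \<Longrightarrow> (V' has_real_derivative V'' t) (at t within {0..})"
    and V''_continuous: "continuous_on {0..} V''"
    and V'_pos: "\<And>t. t \<ge> 0 \<Longrightarrow> V' t > 0"
begin

lemma f_continuous: "continuous_on {0..} f"
  using f_deriv by (intro DERIV_continuous_on) auto

lemma f_strict:
  assumes "s \<ge> 0" "t \<ge> 0" "s \<noteq> t" "0 < h" "h < 1"
  shows "f ((1 - h) * s + h * t) < (1 - h) * f s + h * f t"
  using f_strictly_convex assms unfolding strictly_convex_on_def by auto

text \<open>The difference quotients along the segment from \<open>s\<close> to \<open>t\<close> are
  at most \<open>f t - f s\<close>. The derivative at 0 is one-sided, so the limit is taken along a
  sequence inside the half line.\<close>

lemma f_tangent: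
  assumes s: "s \<ge> 0" and t: "t \<ge> 0" shows "f t \<ge> f s + f' s * (t - s)"
proof (cases "s = t")
  case False
  define \<theta> where "\<theta> = (\<lambda>n. 1 / (real n + 2))"
  define y where "y = (\<lambda>n. s + \<theta> n * (t - s))"
  have l: "0 < \<theta> n" "\<theta> n < 1" for n by (auto simp: \<theta>_def)
  have y0: "y n \<in> {0..} - {s}" for n
  proof -
    have "y n = (1 - \<theta> n) * s + \<theta> n * t" by (simp add: y_def algebra_simps)
    moreover have "0 \<le> (1 - \<theta> n) * s + \<theta> n * t" using l[of n] s t by (intro add_nonneg_nonneg mult_nonneg_nonneg) auto
    moreover have "y n \<noteq> s" using l[of n] False by (simp add: y_def)
    ultimately show ?thesis by auto
  qed
  have "\<theta> \<longlonglongrightarrow> 0" unfolding \<theta>_def by real_asymp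
  then have "y \<longlonglongrightarrow> s + 0 * (t - s)" unfolding y_def by (intro tendsto_intros)
  then have "filterlim y (at s within {0..}) sequentially"
    unfolding filterlim_at using y0 by (auto intro!: always_eventually)
  with f_deriv[OF s] have "(\<lambda>n. (f (y n) - f s) / (y n - s)) \<longlonglongrightarrow> f' s"
    unfolding has_field_derivative_iff by (rule filterlim_compose)
  then have "(\<lambda>n. (f (y n) - f s) / (y n - s) * (t - s)) \<longlonglongrightarrow> f' s * (t - s)" by (intro tendsto_intros)
  moreover have "(f (y n) - f s) / (y n - s) * (t - s) \<le> f t - f s" for n
  proof -
    have "f ((1 - \<theta> n) * s + \<theta> n * t) < (1 - \<theta> n) * f s + \<theta> n * f t"
      using f_strict[of s t "\<theta> n"] s t False l[of n] by auto
    also have "(1 - \<theta> n) * s + \<theta> n * t = y n" by (simp add: y_def algebra_simps)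
    finally have "f (y n) - f s \<le> \<theta> n * (f t - f s)" by (simp add: algebra_simps)
    then have "(f (y n) - f s) / \<theta> n \<le> f t - f s" using l[of n] by (simp add: field_simps)
    moreover have "(f (y n) - f s) / (y n - s) * (t - s) = (f (y n) - f s) / \<theta> n"
      using False l[of n] by (simp add: y_def)
    ultimately show ?thesis by simp
  qed
  ultimately have "f' s * (t - s) \<le> f t - f s" by (intro LIMSEQ_le_const2) auto
  then show ?thesis by simp
qed simp

text \<open>The two tangents at \<open>s\<close> and \<open>t\<close> lie below \<open>f\<close> at
  the midpoint, where \<open>f\<close> lies strictly below its chord.\<close>

lemma f'_strict_mono:
  assumes s: "s \<ge> 0" and st: "s < t" shows "f' s < f' t"
proof -
  define m where "m = (s + t) / 2"
  have m: "m \<ge> 0" "s < m" "m < t" using s st by (auto simp: m_def)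
  have "f ((1 - 1/2) * s + 1/2 * t) < (1 - 1/2) * f s + 1/2 * f t"
    using f_strict[of s t "1/2"] s st by auto
  also have "(1 - 1/2) * s + 1/2 * t = m" by (simp add: m_def field_simps)
  finally have c: "2 * f m < f s + f t" by simp
  have "f s + f' s * (m - s) \<le> f m" "f t + f' t * (m - t) \<le> f m"
    using f_tangent[of s m] f_tangent[of t m] m s st by auto
  with c have "f' s * (m - s) + f' t * (m - t) < 0" by linarith
  moreover have "m - t = - (m - s)" by (simp add: m_def field_simps)
  ultimately have "(f' s - f' t) * (m - s) < 0" by (simp add: algebra_simps)
  then show ?thesis using m by (simp add: mult_less_0_iff)
qed

lemma f'_mono: "0 \<le> s \<Longrightarrow> s \<le> t \<Longrightarrow> f' s \<le> f' t"
  using f'_strict_mono[of s t] by (cases "s = t") auto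

lemma f'_less_iff: "0 \<le> s \<Longrightarrow> 0 \<le> t \<Longrightarrow> f' s < f' t \<longleftrightarrow> s < t"
  using f'_strict_mono[of s t] f'_mono[of t s] by (meson not_le)

text \<open>The tangent at \<open>t\<close> does not pass above the origin, so \<open>f t / t \<le>
  f' t\<close>, and superlinearity applies.\<close>

lemma f'_unbounded: obtains t where "t > 0" "f' t > c"
proof -
  have "\<forall>\<^sub>F t in at_top. f t / t > c \<and> t > 0"
    using f_superlinear eventually_gt_at_top[of 0] by (auto simp: filterlim_at_top_dense intro: eventually_conj)
  then obtain t where t: "f t / t > c" "t > 0" by (auto simp: eventually_at_top_linorder)
  have "f t \<le> f' t * t" using f_tangent[of t 0] t f_0 by simp
  then have "f t / t \<le> f' t" using t by (simp add: field_simps)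
  then show ?thesis using t that by auto
qed

text \<open>A tangent with positive slope bounds \<open>f\<close> from below on the half
  line.\<close>

lemma f_bounded_below: obtains C where "C \<ge> 0" "\<And>t. t \<ge> 0 \<Longrightarrow> f t \<ge> - C"
proof -
  obtain s where s: "s > 0" "f' s > 0" using f'_unbounded[of 0] by blast
  show ?thesis
  proof (rule that[of "\<bar>f s - f' s * s\<bar>"])
    fix t :: real assume t: "t \<ge> 0"
    have "f t \<ge> f s + f' s * (t - s)" using f_tangent[of s t] s t by simp
    moreover have "f' s * t \<ge> 0" using s t by simp
    ultimately show "f t \<ge> - \<bar>f s - f' s * s\<bar>" by (simp add: algebra_simps)
  qed simp
qed

lemma measurable_nonneg_compose:
  assumes "continuous_on {0..} g" "u \<in> borel_measurable M" "\<And>x. x \<in> space M \<Longrightarrow> 0 \<le> u x"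
  shows "(\<lambda>x. g (u x) :: real) \<in> borel_measurable M"
proof (rule measurable_compose[OF _ borel_measurable_continuous_on_restrict[OF assms(1)]])
  show "u \<in> measurable M (restrict_space borel {0..})"
    using assms(2,3) by (intro measurable_restrict_space2) auto
qed

lemma conjugate_continuous: "continuous_on {0..} (\<lambda>t. f t - f' t * t)"
  by (intro continuous_intros f_continuous f'_continuous)

lemma f_bounds:
  obtains C where "C > 0" "\<And>t. t \<in> {0..B} \<Longrightarrow> \<bar>f t\<bar> \<le> C" "\<And>t. t \<in> {0..B} \<Longrightarrow> \<bar>f' t\<bar> \<le> C"
    "\<And>t. t \<in> {0..B} \<Longrightarrow> \<bar>f t - f' t * t\<bar> \<le> C"
proof -
  have sub: "{0..B} \<subseteq> {0..}" by auto
  have "continuous_on {0..B} (\<lambda>t. \<bar>f t\<bar> + \<bar>f' t\<bar> + \<bar>f t - f' t * t\<bar>)"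
    by (intro continuous_intros continuous_on_subset[OF f_continuous sub] continuous_on_subset[OF f'_continuous sub])
  then obtain C where C: "C > 0" "\<And>t. t \<in> {0..B} \<Longrightarrow> \<bar>\<bar>f t\<bar> + \<bar>f' t\<bar> + \<bar>f t - f' t * t\<bar>\<bar> \<le> C"
    by (rule compact_continuous_bounded[OF compact_Icc]) (rule that; assumption)
  show ?thesis using C(2) by (intro that[OF C(1)]) force+
qed

lemma f_integrable_bounded:
  assumes M: "finite_measure M" and u: "u \<in> borel_measurable M" "\<And>x. x \<in> space M \<Longrightarrow> 0 \<le> u x \<and> u x \<le> B"
  shows "integrable M (\<lambda>x. f (u x))"
proof -
  interpret finite_measure M by (rule M)
  obtain C where "\<And>t. t \<in> {0..B} \<Longrightarrow> \<bar>f t\<bar> \<le> C" by (rule f_bounds[of B]) (rule that; assumption)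
  then show ?thesis using measurable_nonneg_compose[OF f_continuous u(1)] u(2)
    by (intro integrable_const_bound[of _ C]) auto
qed

lemma \<Omega>_borel [measurable]: "\<Omega> \<in> sets borel"
  using compact by (simp add: compact_imp_closed)

abbreviation leb :: "'a measure" where "leb \<equiv> restrict_space lborel \<Omega>"
abbreviation borel\<Omega> :: "'a measure" where "borel\<Omega> \<equiv> restrict_space borel \<Omega>"

lemma sets_leb: "sets leb = sets borel\<Omega>"
  by (simp add: sets_restrict_space)

lemma space_leb: "space leb = \<Omega>"
  by (simp add: space_restrict_space)

lemma measurable_leb_iff: "g \<in> measurable leb N \<longleftrightarrow> g \<in> measurable borel\<Omega> N"
  by (simp only: measurable_cong_sets[OF sets_leb refl])

lemma finite_measure_leb: "finite_measure leb"
proof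
  have "emeasure lborel \<Omega> < \<infinity>" by (rule emeasure_bounded_finite[OF compact_imp_bounded[OF compact]])
  then show "emeasure leb (space leb) \<noteq> \<infinity>"
    by (simp add: space_leb emeasure_restrict_space)
qed

sublocale leb: finite_measure leb by (rule finite_measure_leb)

lemma measure_leb_pos: "measure leb \<Omega> > 0"
proof -
  have "\<not> negligible (interior \<Omega>)" using open_not_negligible[of "interior \<Omega>"] interior_nonempty by simp
  then have "\<not> negligible \<Omega>" using negligible_subset interior_subset by blast
  then have "emeasure lborel \<Omega> \<noteq> 0" by (auto simp: negligible_iff_null_sets null_sets_def)
  then have "emeasure leb \<Omega> \<noteq> 0" by (simp add: emeasure_restrict_space)
  then show ?thesis by (simp add: leb.emeasure_eq_measure less_le)
qed

lemma nonempty: "\<Omega> \<noteq> {}"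
  using interior_nonempty interior_subset by auto

lemma V_continuous: "continuous_on {0..} V"
  using V_deriv by (intro DERIV_continuous_on) auto

lemma V'_continuous: "continuous_on {0..} V'"
  using V'_deriv by (intro DERIV_continuous_on) auto

lemma kernel_continuous:
  "continuous_on UNIV (\<lambda>z::'a\<times>'a. V ((norm (fst z - snd z))\<^sup>2))"
  by (rule continuous_on_compose2[OF V_continuous]) (auto intro!: continuous_intros)

text \<open>The interaction energy of \<open>\<nu>\<close> is the integral of this function against
  \<open>\<nu>\<close>, and its first variation is twice this function.\<close>

definition potential :: "'a measure \<Rightarrow> 'a \<Rightarrow> real" where
  "potential \<nu> z = (\<integral>w. V ((norm (z - w))\<^sup>2) \<partial>\<nu>)"

lemma potential_continuous:
  assumes "\<nu> \<in> prob_on \<Omega>" shows "continuous_on \<Omega> (potential \<nu>)"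
  unfolding potential_def[abs_def]
  by (rule continuous_on_parameter_integral[OF compact _ assms])
     (rule continuous_on_subset[OF kernel_continuous subset_UNIV])

lemma kernel_section_continuous: "continuous_on S (\<lambda>w::'a. V ((norm (z - w))\<^sup>2))"
  by (rule continuous_on_compose2[OF V_continuous]) (auto intro!: continuous_intros)

lemma potential_nonneg: "potential \<nu> z \<ge> 0"
  unfolding potential_def using V_nonneg by (intro integral_nonneg_AE) auto

lemma pair_measurable:
  assumes "\<nu> \<in> prob_on \<Omega>" "\<nu>' \<in> prob_on \<Omega>"
  shows "(\<lambda>z. z) \<in> measurable (\<nu> \<Otimes>\<^sub>M \<nu>') (borel :: ('a\<times>'a) measure)"
proof -
  have "(\<lambda>x. x) \<in> borel_measurable \<nu>" "(\<lambda>x. x) \<in> borel_measurable \<nu>'"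
    by (rule prob_on_measurable[OF assms(1)]; simp) (rule prob_on_measurable[OF assms(2)]; simp)
  from borel_measurable_Pair[OF measurable_compose[OF measurable_fst this(1)] measurable_compose[OF measurable_snd this(2)]]
  show ?thesis by simp
qed

lemma kernel_pair_integrable:
  assumes "\<nu> \<in> prob_on \<Omega>" "\<nu>' \<in> prob_on \<Omega>"
  shows "integrable (\<nu> \<Otimes>\<^sub>M \<nu>') (\<lambda>z. V ((norm (fst z - snd z))\<^sup>2))"
proof -
  interpret n1: prob_space \<nu> by (rule prob_onD[OF assms(1)])
  interpret n2: prob_space \<nu>' by (rule prob_onD[OF assms(2)])
  interpret pair_prob_space \<nu> \<nu>' ..
  obtain B where B: "\<And>z. z \<in> \<Omega> \<times> \<Omega> \<Longrightarrow> \<bar>V ((norm (fst z - snd z))\<^sup>2)\<bar> \<le> B"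
    using compact_continuous_bounded[OF compact_Times[OF compact compact] continuous_on_subset[OF kernel_continuous subset_UNIV]] by metis
  show ?thesis
  proof (rule P.integrable_const_bound[of _ B])
    show "AE z in \<nu> \<Otimes>\<^sub>M \<nu>'. norm (V ((norm (fst z - snd z))\<^sup>2)) \<le> B"
      using B by (intro AE_I2) (auto simp: space_pair_measure prob_onD(3)[OF assms(1)] prob_onD(3)[OF assms(2)])
    show "(\<lambda>z. V ((norm (fst z - snd z))\<^sup>2)) \<in> borel_measurable (\<nu> \<Otimes>\<^sub>M \<nu>')"
      using measurable_compose[OF pair_measurable[OF assms] borel_measurable_continuous_onI[OF kernel_continuous]] .
  qed
qed

lemma potential_symmetric:
  assumes "\<nu> \<in> prob_on \<Omega>" "\<nu>' \<in> prob_on \<Omega>"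
  shows "(\<integral>z. potential \<nu>' z \<partial>\<nu>) = (\<integral>z. potential \<nu> z \<partial>\<nu>')"
proof -
  interpret n1: prob_space \<nu> by (rule prob_onD[OF assms(1)])
  interpret n2: prob_space \<nu>' by (rule prob_onD[OF assms(2)])
  interpret pair_prob_space \<nu> \<nu>' ..
  show ?thesis
    using Fubini_integral[of "\<lambda>z w. V ((norm (z - w))\<^sup>2)"] kernel_pair_integrable[OF assms]
    unfolding potential_def by (simp add: case_prod_beta' norm_minus_commute)
qed

lemma interaction_energy_eq:
  assumes \<nu>: "\<nu> \<in> prob_on \<Omega>"
  shows "interaction_energy V \<nu> = ennreal (\<integral>z. potential \<nu> z \<partial>\<nu>)"
proof -
  interpret n1: prob_space \<nu> by (rule prob_onD[OF \<nu>])
  interpret pair_prob_space \<nu> \<nu> ..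
  have "interaction_energy V \<nu> = ennreal (\<integral>z. V ((norm (fst z - snd z))\<^sup>2) \<partial>(\<nu> \<Otimes>\<^sub>M \<nu>))"
    unfolding interaction_energy_def
    by (rule nn_integral_eq_integral[OF kernel_pair_integrable[OF \<nu> \<nu>]]) (auto intro!: V_nonneg)
  also have "(\<integral>z. V ((norm (fst z - snd z))\<^sup>2) \<partial>(\<nu> \<Otimes>\<^sub>M \<nu>)) = (\<integral>z. potential \<nu> z \<partial>\<nu>)"
    unfolding potential_def using integral_fst'[OF kernel_pair_integrable[OF \<nu> \<nu>]] by simp
  finally show ?thesis .
qed

end

section \<open>Transport plans and the energy\<close>

context concentration begin

abbreviation plans :: "('a \<times> 'a) measure set" where "plans \<equiv> prob_on (\<Omega> \<times> \<Omega>)"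
abbreviation marg1 :: "('a \<times> 'a) measure \<Rightarrow> 'a measure" where "marg1 \<gamma> \<equiv> distr \<gamma> borel\<Omega> fst"
abbreviation marg2 :: "('a \<times> 'a) measure \<Rightarrow> 'a measure" where "marg2 \<gamma> \<equiv> distr \<gamma> borel\<Omega> snd"

definition cost :: "('a \<times> 'a) measure \<Rightarrow> real" where
  "cost \<gamma> = (\<integral>z. (norm (fst z - snd z))\<^sup>2 \<partial>\<gamma>)"

definition admissible :: "('a \<times> 'a) measure \<Rightarrow> ('a \<Rightarrow> real) \<Rightarrow> bool" where
  "admissible \<gamma> u \<longleftrightarrow> \<gamma> \<in> plans \<and> lebesgue_density \<Omega> (marg1 \<gamma>) u \<and> integrable leb (\<lambda>x. f (u x))"

text \<open>The density \<open>u\<close> is an argument of its own, so that the internal energy is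
  an ordinary integral.\<close>

definition energy :: "('a \<times> 'a) measure \<Rightarrow> ('a \<Rightarrow> real) \<Rightarrow> real" where
  "energy \<gamma> u = cost \<gamma> / 2 + (\<integral>x. f (u x) \<partial>leb) + (\<integral>z. potential (marg2 \<gamma>) z \<partial>marg2 \<gamma>)"

lemma projections_measurable:
  "fst \<in> measurable (restrict_space borel (\<Omega> \<times> \<Omega>)) borel\<Omega>" "snd \<in> measurable (restrict_space borel (\<Omega> \<times> \<Omega>)) borel\<Omega>"
proof -
  have "fst \<in> borel_measurable (borel :: ('a \<times> 'a) measure)" "snd \<in> borel_measurable (borel :: ('a \<times> 'a) measure)"
    by (intro borel_measurable_continuous_onI continuous_intros)+
  then show "fst \<in> measurable (restrict_space borel (\<Omega> \<times> \<Omega>)) borel\<Omega>" "snd \<in> measurable (restrict_space borel (\<Omega> \<times> \<Omega>)) borel\<Omega>"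
    by (auto intro!: measurable_restrict_space2[OF _ measurable_restrict_space1] simp: space_restrict_space)
qed

lemma plan_projections:
  assumes "\<gamma> \<in> plans"
  shows "fst \<in> measurable \<gamma> borel\<Omega>" "snd \<in> measurable \<gamma> borel\<Omega>"
  using prob_on_measurable_restrict[OF assms] projections_measurable by auto

lemma marginals_prob_on:
  assumes "\<gamma> \<in> plans" shows "marg1 \<gamma> \<in> prob_on \<Omega>" "marg2 \<gamma> \<in> prob_on \<Omega>"
  using distr_in_prob_on[OF prob_onD(1)[OF assms]] plan_projections[OF assms] by auto

lemma couplings_iff: "\<gamma> \<in> couplings \<Omega> \<mu> \<nu> \<longleftrightarrow> \<gamma> \<in> plans \<and> marg1 \<gamma> = \<mu> \<and> marg2 \<gamma> = \<nu>"
  by (auto simp: couplings_def)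

lemma compact2: "compact (\<Omega> \<times> \<Omega>)"
  by (intro compact_Times compact)

lemma cost_continuous: "continuous_on S (\<lambda>z::'a\<times>'a. (norm (fst z - snd z))\<^sup>2)"
  by (intro continuous_intros)

lemma cost_nonneg: "cost \<gamma> \<ge> 0"
  unfolding cost_def by (intro integral_nonneg_AE) auto

lemma nn_integral_cost:
  assumes "\<gamma> \<in> plans"
  shows "(\<integral>\<^sup>+z. ennreal ((norm (fst z - snd z))\<^sup>2) \<partial>\<gamma>) = ennreal (cost \<gamma>)"
  unfolding cost_def
  by (rule nn_integral_eq_integral[OF prob_on_integrable_continuous[OF assms compact2 cost_continuous]]) auto

lemma kernel_bounded: obtains B where "\<And>z w. z \<in> \<Omega> \<Longrightarrow> w \<in> \<Omega> \<Longrightarrow> \<bar>V ((norm (z - w))\<^sup>2)\<bar> \<le> B"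
proof -
  obtain B where "\<And>z. z \<in> \<Omega> \<times> \<Omega> \<Longrightarrow> \<bar>V ((norm (fst z - snd z))\<^sup>2)\<bar> \<le> B"
    using compact_continuous_bounded[OF compact2 continuous_on_subset[OF kernel_continuous subset_UNIV]] by metis
  then show ?thesis using that[of B] by force
qed

text \<open>Writing both integrals over the probability space on which the random variables live,
  the kernel converges pointwise; bounded convergence applies to the inner and then to the outer
  integral.\<close>

lemma interaction_tendsto:
  assumes P: "prob_space P" and Y: "\<And>n. Y n \<in> measurable P borel\<Omega>" and Y': "Y' \<in> measurable P borel\<Omega>"
    and lim: "\<And>\<omega>. \<omega> \<in> space P \<Longrightarrow> (\<lambda>n. Y n \<omega>) \<longlonglongrightarrow> Y' \<omega>"
  shows "(\<lambda>n. \<integral>z. potential (distr P borel\<Omega> (Y n)) z \<partial>distr P borel\<Omega> (Y n))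
    \<longlonglongrightarrow> (\<integral>z. potential (distr P borel\<Omega> Y') z \<partial>distr P borel\<Omega> Y')"
proof -
  interpret P: prob_space P by (rule P)
  obtain B where B: "\<And>z w. z \<in> \<Omega> \<Longrightarrow> w \<in> \<Omega> \<Longrightarrow> \<bar>V ((norm (z - w))\<^sup>2)\<bar> \<le> B" using kernel_bounded by metis
  have Yin: "Y n \<omega> \<in> \<Omega>" "Y' \<omega> \<in> \<Omega>" if "\<omega> \<in> space P" for n \<omega>
    using measurable_space[OF Y that] measurable_space[OF Y' that] by (auto simp: space_restrict_space)
  have km: "(\<lambda>w. V ((norm (z - w))\<^sup>2)) \<in> borel_measurable borel\<Omega>" for z :: 'a
    by (rule borel_measurable_continuous_on_restrict[OF kernel_section_continuous])
  have pot: "potential (distr P borel\<Omega> X) z = (\<integral>\<omega>'. V ((norm (z - X \<omega>'))\<^sup>2) \<partial>P)" if "X \<in> measurable P borel\<Omega>" for X z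
    unfolding potential_def by (rule integral_distr[OF that km])
  have pm: "potential (distr P borel\<Omega> X) \<in> borel_measurable borel\<Omega>" if "X \<in> measurable P borel\<Omega>" for X
    by (rule borel_measurable_continuous_on_restrict[OF potential_continuous[OF distr_in_prob_on[OF P that]]])
  have pb: "\<bar>potential (distr P borel\<Omega> X) z\<bar> \<le> B" if X: "X \<in> measurable P borel\<Omega>" and z: "z \<in> \<Omega>" for X z
  proof -
    have Xin: "X \<omega> \<in> \<Omega>" if "\<omega> \<in> space P" for \<omega> using measurable_space[OF X that] by (auto simp: space_restrict_space)
    have m: "(\<lambda>\<omega>'. V ((norm (z - X \<omega>'))\<^sup>2)) \<in> borel_measurable P" by (rule measurable_compose[OF X km])
    have i: "integrable P (\<lambda>\<omega>'. V ((norm (z - X \<omega>'))\<^sup>2))"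
      by (rule P.integrable_const_bound[OF _ m, of B]) (use B z Xin in \<open>auto intro!: AE_I2\<close>)
    have "(\<integral>\<omega>'. V ((norm (z - X \<omega>'))\<^sup>2) \<partial>P) \<le> (\<integral>\<omega>'. B \<partial>P)"
      by (rule integral_mono[OF i]) (use B[OF z Xin] in \<open>auto simp: abs_le_iff\<close>)
    then have "potential (distr P borel\<Omega> X) z \<le> B" unfolding pot[OF X] by (simp add: P.prob_space)
    then show ?thesis using potential_nonneg[of "distr P borel\<Omega> X" z] by simp
  qed
  have inner: "(\<lambda>n. potential (distr P borel\<Omega> (Y n)) (Y n \<omega>)) \<longlonglongrightarrow> potential (distr P borel\<Omega> Y') (Y' \<omega>)"
    if \<omega>: "\<omega> \<in> space P" for \<omega>
    unfolding pot[OF Y] pot[OF Y']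
  proof (rule integral_dominated_convergence[where w="\<lambda>_. B"])
    show "(\<lambda>\<omega>'. V ((norm (Y' \<omega> - Y' \<omega>'))\<^sup>2)) \<in> borel_measurable P" by (rule measurable_compose[OF Y' km])
    show "(\<lambda>\<omega>'. V ((norm (Y n \<omega> - Y n \<omega>'))\<^sup>2)) \<in> borel_measurable P" for n by (rule measurable_compose[OF Y km])
    show "AE \<omega>' in P. (\<lambda>n. V ((norm (Y n \<omega> - Y n \<omega>'))\<^sup>2)) \<longlonglongrightarrow> V ((norm (Y' \<omega> - Y' \<omega>'))\<^sup>2)"
    proof (rule AE_I2)
      fix \<omega>' assume "\<omega>' \<in> space P"
      from tendsto_Pair[OF lim[OF \<omega>] lim[OF this]]
      have "(\<lambda>n. (Y n \<omega>, Y n \<omega>')) \<longlonglongrightarrow> (Y' \<omega>, Y' \<omega>')" .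
      from continuous_on_tendsto_compose[OF kernel_continuous this]
      show "(\<lambda>n. V ((norm (Y n \<omega> - Y n \<omega>'))\<^sup>2)) \<longlonglongrightarrow> V ((norm (Y' \<omega> - Y' \<omega>'))\<^sup>2)" by simp
    qed
    show "AE \<omega>' in P. norm (V ((norm (Y n \<omega> - Y n \<omega>'))\<^sup>2)) \<le> B" for n
      using B Yin \<omega> by (intro AE_I2) auto
  qed simp
  have "(\<lambda>n. \<integral>\<omega>. potential (distr P borel\<Omega> (Y n)) (Y n \<omega>) \<partial>P) \<longlonglongrightarrow> (\<integral>\<omega>. potential (distr P borel\<Omega> Y') (Y' \<omega>) \<partial>P)"
  proof (rule integral_dominated_convergence[where w="\<lambda>_. B"])
    show "(\<lambda>\<omega>. potential (distr P borel\<Omega> Y') (Y' \<omega>)) \<in> borel_measurable P" by (rule measurable_compose[OF Y' pm[OF Y']])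
    show "(\<lambda>\<omega>. potential (distr P borel\<Omega> (Y n)) (Y n \<omega>)) \<in> borel_measurable P" for n by (rule measurable_compose[OF Y pm[OF Y]])
    show "AE \<omega> in P. norm (potential (distr P borel\<Omega> (Y n)) (Y n \<omega>)) \<le> B" for n
      using pb[OF Y Yin(1)] by (intro AE_I2) simp
    show "AE \<omega> in P. (\<lambda>n. potential (distr P borel\<Omega> (Y n)) (Y n \<omega>)) \<longlonglongrightarrow> potential (distr P borel\<Omega> Y') (Y' \<omega>)"
      by (rule AE_I2) (rule inner)
  qed simp
  then show ?thesis by (simp add: integral_distr[OF Y pm[OF Y]] integral_distr[OF Y' pm[OF Y']])
qed

text \<open>The passages to the limit that both existence proofs use: for optimal couplings of given
  marginals and for plans of least energy.\<close>

lemma plans_sequentially_compact: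
  assumes G: "\<And>n. G n \<in> plans"
  obtains r :: "nat \<Rightarrow> nat" and \<gamma> where "strict_mono r" "\<gamma> \<in> plans"
    "(\<lambda>n. cost (G (r n))) \<longlonglongrightarrow> cost \<gamma>"
    "(\<lambda>n. \<integral>z. potential (marg2 (G (r n))) z \<partial>marg2 (G (r n))) \<longlonglongrightarrow> (\<integral>z. potential (marg2 \<gamma>) z \<partial>marg2 \<gamma>)"
    "\<And>h :: 'a \<Rightarrow> real. continuous_on \<Omega> h \<Longrightarrow> (\<lambda>n. \<integral>x. h x \<partial>marg1 (G (r n))) \<longlonglongrightarrow> (\<integral>x. h x \<partial>marg1 \<gamma>)"
    "\<And>h :: 'a \<Rightarrow> real. continuous_on \<Omega> h \<Longrightarrow> (\<lambda>n. \<integral>x. h x \<partial>marg2 (G (r n))) \<longlonglongrightarrow> (\<integral>x. h x \<partial>marg2 \<gamma>)"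
proof -
  let ?B2 = "restrict_space borel (\<Omega> \<times> \<Omega>) :: ('a \<times> 'a) measure"
  note p1 = projections_measurable(1) and p2 = projections_measurable(2)
  obtain r :: "nat \<Rightarrow> nat" and P :: "real measure" and Z Z' where r: "strict_mono r" and P: "prob_space P"
    and Z: "\<And>n. Z n \<in> measurable P ?B2" and dZ: "\<And>n. distr P ?B2 (Z n) = G (r n)"
    and Z': "Z' \<in> measurable P ?B2" and lim: "\<And>\<omega>. \<omega> \<in> space P \<Longrightarrow> (\<lambda>n. Z n \<omega>) \<longlonglongrightarrow> Z' \<omega>"
    by (rule skorohod_compact[of "\<Omega> \<times> \<Omega>" G, OF compact2 G]) (rule that; assumption)
  define \<gamma> where "\<gamma> = distr P ?B2 Z'"
  have \<gamma>: "\<gamma> \<in> plans" unfolding \<gamma>_def by (rule distr_in_prob_on[OF P Z'])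
  have marg: "marg1 (G (r n)) = distr P borel\<Omega> (fst \<circ> Z n)" "marg2 (G (r n)) = distr P borel\<Omega> (snd \<circ> Z n)" for n
    using distr_distr[OF p1 Z[of n]] distr_distr[OF p2 Z[of n]] dZ[of n] by simp_all
  have marg': "marg1 \<gamma> = distr P borel\<Omega> (fst \<circ> Z')" "marg2 \<gamma> = distr P borel\<Omega> (snd \<circ> Z')"
    unfolding \<gamma>_def using distr_distr[OF p1 Z'] distr_distr[OF p2 Z'] by simp_all
  note Z1 = measurable_comp[OF Z p1] and Z2 = measurable_comp[OF Z p2]
  note Z1' = measurable_comp[OF Z' p1] and Z2' = measurable_comp[OF Z' p2]
  have l1: "(\<lambda>n. (fst \<circ> Z n) \<omega>) \<longlonglongrightarrow> (fst \<circ> Z') \<omega>" and l2: "(\<lambda>n. (snd \<circ> Z n) \<omega>) \<longlonglongrightarrow> (snd \<circ> Z') \<omega>"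
    if "\<omega> \<in> space P" for \<omega> using tendsto_fst[OF lim[OF that]] tendsto_snd[OF lim[OF that]] by simp_all
  show ?thesis
  proof (rule that[OF r \<gamma>])
    show "(\<lambda>n. cost (G (r n))) \<longlonglongrightarrow> cost \<gamma>"
      unfolding \<gamma>_def cost_def dZ[symmetric]
      by (rule integral_tendsto_of_pointwise[OF P compact2 cost_continuous Z Z' lim])
    show "(\<lambda>n. \<integral>z. potential (marg2 (G (r n))) z \<partial>marg2 (G (r n))) \<longlonglongrightarrow> (\<integral>z. potential (marg2 \<gamma>) z \<partial>marg2 \<gamma>)"
      unfolding marg marg' by (rule interaction_tendsto[OF P Z2 Z2' l2])
    fix h :: "'a \<Rightarrow> real" assume h: "continuous_on \<Omega> h"
    show "(\<lambda>n. \<integral>x. h x \<partial>marg1 (G (r n))) \<longlonglongrightarrow> (\<integral>x. h x \<partial>marg1 \<gamma>)"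
      unfolding marg marg' by (rule integral_tendsto_of_pointwise[OF P compact h Z1 Z1' l1])
    show "(\<lambda>n. \<integral>x. h x \<partial>marg2 (G (r n))) \<longlonglongrightarrow> (\<integral>x. h x \<partial>marg2 \<gamma>)"
      unfolding marg marg' by (rule integral_tendsto_of_pointwise[OF P compact h Z2 Z2' l2])
  qed
qed

text \<open>A limit of a minimizing sequence of couplings has the same marginals, because weak
  limits are unique, and the cost is continuous along the sequence.\<close>

lemma optimal_coupling_exists:
  assumes "couplings \<Omega> \<mu> \<nu> \<noteq> {}"
  obtains \<gamma> where "\<gamma> \<in> couplings \<Omega> \<mu> \<nu>" "W2_squared \<Omega> \<mu> \<nu> = ennreal (cost \<gamma>)"
proof -
  let ?c = "\<lambda>\<gamma>. \<integral>\<^sup>+ z. ennreal ((norm (fst z - snd z))\<^sup>2) \<partial>\<gamma>"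
  have "?c ` couplings \<Omega> \<mu> \<nu> \<noteq> {}" using assms by auto
  from Inf_as_limit[OF this] obtain a where a: "\<And>n. a n \<in> ?c ` couplings \<Omega> \<mu> \<nu>"
    and lim_a: "a \<longlonglongrightarrow> W2_squared \<Omega> \<mu> \<nu>" unfolding W2_squared_def by blast
  from a have "\<forall>n. \<exists>\<gamma>. \<gamma> \<in> couplings \<Omega> \<mu> \<nu> \<and> a n = ?c \<gamma>" by (auto simp: image_iff)
  then obtain G where G: "\<And>n. G n \<in> couplings \<Omega> \<mu> \<nu>" and aG: "\<And>n. a n = ?c (G n)" by metis
  have Gp: "G n \<in> plans" for n using G by (simp add: couplings_iff)
  have aG': "a n = ennreal (cost (G n))" for n using aG nn_integral_cost[OF Gp] by simp
  obtain r :: "nat \<Rightarrow> nat" and \<gamma> where r: "strict_mono r" and \<gamma>: "\<gamma> \<in> plans"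
    and cost: "(\<lambda>n. cost (G (r n))) \<longlonglongrightarrow> cost \<gamma>"
    and lim1: "\<And>h :: 'a \<Rightarrow> real. continuous_on \<Omega> h \<Longrightarrow> (\<lambda>n. \<integral>x. h x \<partial>marg1 (G (r n))) \<longlonglongrightarrow> (\<integral>x. h x \<partial>marg1 \<gamma>)"
    and lim2: "\<And>h :: 'a \<Rightarrow> real. continuous_on \<Omega> h \<Longrightarrow> (\<lambda>n. \<integral>x. h x \<partial>marg2 (G (r n))) \<longlonglongrightarrow> (\<integral>x. h x \<partial>marg2 \<gamma>)"
    by (rule plans_sequentially_compact[OF Gp]) (rule that; assumption)
  have "(\<lambda>n. a (r n)) \<longlonglongrightarrow> ennreal (cost \<gamma>)" unfolding aG' using cost by (intro tendsto_ennrealI)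
  moreover have "(\<lambda>n. a (r n)) \<longlonglongrightarrow> W2_squared \<Omega> \<mu> \<nu>"
    using LIMSEQ_subseq_LIMSEQ[OF lim_a r] by (simp add: comp_def)
  ultimately have W: "W2_squared \<Omega> \<mu> \<nu> = ennreal (cost \<gamma>)" using LIMSEQ_unique by blast
  have m: "marg1 (G n) = \<mu>" "marg2 (G n) = \<nu>" for n using G by (simp_all add: couplings_iff)
  have "marg1 \<gamma> = \<mu>"
  proof (rule prob_on_eqI[OF \<Omega>_borel marginals_prob_on(1)[OF \<gamma>]])
    show "\<mu> \<in> prob_on \<Omega>" using marginals_prob_on(1)[OF Gp, of 0] by (simp only: m)
    fix h :: "'a \<Rightarrow> real" assume "continuous_on UNIV h"
    from lim1[OF continuous_on_subset[OF this subset_UNIV]]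
    show "(\<integral>x. h x \<partial>marg1 \<gamma>) = (\<integral>x. h x \<partial>\<mu>)" unfolding m by (rule LIMSEQ_unique[OF _ tendsto_const])
  qed
  moreover have "marg2 \<gamma> = \<nu>"
  proof (rule prob_on_eqI[OF \<Omega>_borel marginals_prob_on(2)[OF \<gamma>]])
    show "\<nu> \<in> prob_on \<Omega>" using marginals_prob_on(2)[OF Gp, of 0] by (simp only: m)
    fix h :: "'a \<Rightarrow> real" assume "continuous_on UNIV h"
    from lim2[OF continuous_on_subset[OF this subset_UNIV]]
    show "(\<integral>x. h x \<partial>marg2 \<gamma>) = (\<integral>x. h x \<partial>\<nu>)" unfolding m by (rule LIMSEQ_unique[OF _ tendsto_const])
  qed
  ultimately have "\<gamma> \<in> couplings \<Omega> \<mu> \<nu>" using \<gamma> by (simp add: couplings_iff)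
  with W that show ?thesis by blast
qed

lemma density_measurable:
  assumes "lebesgue_density \<Omega> \<mu> u"
  shows "u \<in> borel_measurable leb" "\<And>x. x \<in> \<Omega> \<Longrightarrow> 0 \<le> u x" "(\<lambda>x. f (u x)) \<in> borel_measurable leb"
    "(\<lambda>x. f' (u x)) \<in> borel_measurable leb"
proof -
  show u: "u \<in> borel_measurable leb" and n: "\<And>x. x \<in> \<Omega> \<Longrightarrow> 0 \<le> u x"
    using assms by (auto simp: lebesgue_density_def)
  show "(\<lambda>x. f (u x)) \<in> borel_measurable leb" "(\<lambda>x. f' (u x)) \<in> borel_measurable leb"
    by (rule measurable_nonneg_compose[OF f_continuous u]; simp add: space_leb n)
       (rule measurable_nonneg_compose[OF f'_continuous u]; simp add: space_leb n)
qed

text \<open>As \<open>f\<close> is bounded below and \<open>\<Omega>\<close> has finite measure, the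
  negative part always has finite integral.\<close>

lemma extended_integral_f:
  assumes u: "lebesgue_density \<Omega> \<mu> u"
  shows "extended_integral leb (\<lambda>x. f (u x)) =
    (if integrable leb (\<lambda>x. f (u x)) then ereal (\<integral>x. f (u x) \<partial>leb) else \<infinity>)"
proof -
  let ?g = "\<lambda>x. f (u x)"
  have g: "?g \<in> borel_measurable leb" by (rule density_measurable[OF u])
  obtain C where C: "C \<ge> 0" "\<And>t. t \<ge> 0 \<Longrightarrow> f t \<ge> - C" using f_bounded_below by blast
  have "(\<integral>\<^sup>+x. ennreal (- ?g x) \<partial>leb) \<le> (\<integral>\<^sup>+x. ennreal C \<partial>leb)"
    using C(2) density_measurable(2)[OF u] by (intro nn_integral_mono ennreal_leI) (force simp: space_leb)
  also have "\<dots> < \<infinity>" by (simp add: leb.emeasure_eq_measure ennreal_mult_less_top)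
  finally have neg: "(\<integral>\<^sup>+x. ennreal (- ?g x) \<partial>leb) \<noteq> \<infinity>" by simp
  then obtain b where b: "b \<ge> 0" "(\<integral>\<^sup>+x. ennreal (- ?g x) \<partial>leb) = ennreal b" by (cases "\<integral>\<^sup>+x. ennreal (- ?g x) \<partial>leb") auto
  show ?thesis
  proof (cases "(\<integral>\<^sup>+x. ennreal (?g x) \<partial>leb) = \<infinity>")
    case True
    then have "\<not> integrable leb ?g" using real_integrable_def by blast
    moreover have "extended_integral leb ?g = \<infinity>" unfolding extended_integral_def True b using b by simp
    ultimately show ?thesis by simp
  next
    case False
    then obtain a where a: "a \<ge> 0" "(\<integral>\<^sup>+x. ennreal (?g x) \<partial>leb) = ennreal a" by (cases "\<integral>\<^sup>+x. ennreal (?g x) \<partial>leb") auto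
    have "integrable leb ?g" using False neg g by (simp add: real_integrable_def)
    moreover have "(\<integral>x. ?g x \<partial>leb) = a - b" using real_lebesgue_integral_def[OF calculation] a b by simp
    moreover have "extended_integral leb ?g = ereal (a - b)" unfolding extended_integral_def a b using a b by simp
    ultimately show ?thesis by simp
  qed
qed

lemma ereal_half_plus:
  assumes "c \<ge> 0" "p \<ge> 0"
  shows "1 / 2 * enn2ereal (ennreal c) + ereal i + enn2ereal (ennreal p) = ereal (c / 2 + i + p)"
proof -
  have "(1 / 2 :: ereal) = ereal (1/2)" by (simp add: one_ereal_def)
  then show ?thesis using assms by simp
qed

lemma potential_integral_nonneg: "(\<integral>z. potential \<nu> z \<partial>\<nu>') \<ge> 0"
  using potential_nonneg by (intro integral_nonneg_AE) auto

lemma total_functional_eq: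
  assumes \<nu>: "\<nu> \<in> prob_on \<Omega>" and u: "lebesgue_density \<Omega> \<mu> u" "integrable leb (\<lambda>x. f (u x))"
  shows "total_functional f V \<Omega> \<mu> \<nu> = 1 / 2 * enn2ereal (W2_squared \<Omega> \<mu> \<nu>) + ereal (\<integral>x. f (u x) \<partial>leb)
    + enn2ereal (ennreal (\<integral>z. potential \<nu> z \<partial>\<nu>))"
  unfolding total_functional_def interaction_energy_eq[OF \<nu>] internal_energy_eq[OF \<Omega>_borel u(1)] extended_integral_f[OF u(1)]
  using u(2) by simp

lemma total_functional_le_energy:
  assumes "admissible \<gamma> u"
  shows "total_functional f V \<Omega> (marg1 \<gamma>) (marg2 \<gamma>) \<le> ereal (energy \<gamma> u)"
proof -
  have \<gamma>: "\<gamma> \<in> plans" and u: "lebesgue_density \<Omega> (marg1 \<gamma>) u" "integrable leb (\<lambda>x. f (u x))"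
    using assms by (auto simp: admissible_def)
  have "W2_squared \<Omega> (marg1 \<gamma>) (marg2 \<gamma>) \<le> ennreal (cost \<gamma>)"
    unfolding W2_squared_def nn_integral_cost[OF \<gamma>, symmetric] using \<gamma> by (intro INF_lower) (simp add: couplings_iff)
  then have "enn2ereal (W2_squared \<Omega> (marg1 \<gamma>) (marg2 \<gamma>)) \<le> enn2ereal (ennreal (cost \<gamma>))"
    by (simp add: less_eq_ennreal.rep_eq)
  then have "total_functional f V \<Omega> (marg1 \<gamma>) (marg2 \<gamma>) \<le> 1 / 2 * enn2ereal (ennreal (cost \<gamma>)) + ereal (\<integral>x. f (u x) \<partial>leb)
    + enn2ereal (ennreal (\<integral>z. potential (marg2 \<gamma>) z \<partial>marg2 \<gamma>))"
    unfolding total_functional_eq[OF marginals_prob_on(2)[OF \<gamma>] u]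
    by (intro add_mono ereal_mult_left_mono) auto
  also have "\<dots> = ereal (energy \<gamma> u)"
    unfolding energy_def by (rule ereal_half_plus[OF cost_nonneg potential_integral_nonneg])
  finally show ?thesis .
qed

lemma total_functional_attained:
  assumes \<mu>: "\<mu> \<in> prob_on \<Omega>" and \<nu>: "\<nu> \<in> prob_on \<Omega>" and fin: "total_functional f V \<Omega> \<mu> \<nu> \<noteq> \<infinity>"
  obtains \<gamma> u where "admissible \<gamma> u" "marg1 \<gamma> = \<mu>" "marg2 \<gamma> = \<nu>" "total_functional f V \<Omega> \<mu> \<nu> = ereal (energy \<gamma> u)"
proof -
  have "internal_energy f \<Omega> \<mu> \<noteq> \<infinity>" "1 / 2 * enn2ereal (W2_squared \<Omega> \<mu> \<nu>) \<noteq> \<infinity>"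
    using fin unfolding total_functional_def by auto
  then obtain u where u: "lebesgue_density \<Omega> \<mu> u" by (auto simp: internal_energy_def split: if_splits)
  have i: "integrable leb (\<lambda>x. f (u x))"
    using \<open>internal_energy f \<Omega> \<mu> \<noteq> \<infinity>\<close> unfolding internal_energy_eq[OF \<Omega>_borel u] extended_integral_f[OF u]
    by (auto split: if_splits)
  have "couplings \<Omega> \<mu> \<nu> \<noteq> {}"
  proof
    assume "couplings \<Omega> \<mu> \<nu> = {}"
    then have "W2_squared \<Omega> \<mu> \<nu> = \<infinity>" by (simp add: W2_squared_def)
    moreover have "(1 / 2 :: ereal) = ereal (1/2)" by (simp add: one_ereal_def)
    ultimately show False using \<open>1 / 2 * enn2ereal (W2_squared \<Omega> \<mu> \<nu>) \<noteq> \<infinity>\<close> by (simp only:) simp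
  qed
  then obtain \<gamma> where \<gamma>: "\<gamma> \<in> couplings \<Omega> \<mu> \<nu>" "W2_squared \<Omega> \<mu> \<nu> = ennreal (cost \<gamma>)"
    using optimal_coupling_exists by blast
  then have *: "\<gamma> \<in> plans" "marg1 \<gamma> = \<mu>" "marg2 \<gamma> = \<nu>" by (auto simp: couplings_iff)
  show ?thesis
  proof (rule that[of \<gamma> u])
    show "admissible \<gamma> u" using * u i by (simp add: admissible_def)
    show "total_functional f V \<Omega> \<mu> \<nu> = ereal (energy \<gamma> u)"
      unfolding total_functional_eq[OF \<nu> u i] \<gamma>(2) energy_def *
      by (rule ereal_half_plus[OF cost_nonneg potential_integral_nonneg])
  qed (use * in auto)
qed

text \<open>The uniform distribution on \<open>\<Omega>\<close>, coupled with itself on the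
  diagonal, has finite energy; so every minimizing pair has finite energy too.\<close>

lemma uniform_admissible: obtains \<gamma> u where "admissible \<gamma> u"
proof -
  define c where "c = 1 / measure leb \<Omega>"
  have c: "c > 0" using measure_leb_pos by (simp add: c_def)
  define \<mu> where "\<mu> = density leb (\<lambda>x. ennreal c)"
  have "emeasure \<mu> (space \<mu>) = ennreal c * emeasure leb \<Omega>"
    by (simp add: \<mu>_def space_leb emeasure_density_const sets.top[of leb, unfolded space_leb])
  also have "\<dots> = 1" using c measure_leb_pos by (simp add: leb.emeasure_eq_measure c_def flip: ennreal_mult)
  finally have p: "prob_space \<mu>" by (rule prob_spaceI)
  have s: "sets \<mu> = sets borel\<Omega>" by (simp add: \<mu>_def sets_leb)
  have d: "(\<lambda>x. (x, x)) \<in> measurable \<mu> (restrict_space borel (\<Omega> \<times> \<Omega>))"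
  proof -
    have "(\<lambda>x::'a. (x, x)) \<in> measurable borel borel"
      by (intro borel_measurable_continuous_onI continuous_intros)
    then show ?thesis unfolding measurable_cong_sets[OF s refl]
      by (intro measurable_restrict_space2 measurable_restrict_space1) (auto simp: space_restrict_space)
  qed
  define \<gamma> where "\<gamma> = distr \<mu> (restrict_space borel (\<Omega> \<times> \<Omega>)) (\<lambda>x. (x, x))"
  have "marg1 \<gamma> = distr \<mu> borel\<Omega> (\<lambda>x. x)"
    unfolding \<gamma>_def by (subst distr_distr[OF projections_measurable(1) d]) (simp add: comp_def)
  also have "\<dots> = \<mu>" using s by (rule distr_id2[OF sym])
  finally have "marg1 \<gamma> = \<mu>" .
  then have "admissible \<gamma> (\<lambda>x. c)"
    unfolding admissible_def lebesgue_density_def using c distr_in_prob_on[OF p d]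
    by (auto simp: \<mu>_def \<gamma>_def)
  then show ?thesis by (rule that)
qed

lemma energy_bounded_below: obtains C where "\<And>\<gamma> u. admissible \<gamma> u \<Longrightarrow> C \<le> energy \<gamma> u"
proof -
  obtain C where C: "C \<ge> 0" "\<And>t. t \<ge> 0 \<Longrightarrow> f t \<ge> - C" using f_bounded_below by blast
  show ?thesis
  proof (rule that[of "- C * measure leb \<Omega>"])
    fix \<gamma> u assume a: "admissible \<gamma> u"
    then have u: "lebesgue_density \<Omega> (marg1 \<gamma>) u" "integrable leb (\<lambda>x. f (u x))" by (auto simp: admissible_def)
    have "(\<integral>x. - C \<partial>leb) \<le> (\<integral>x. f (u x) \<partial>leb)"
      using u(2) C(2) density_measurable(2)[OF u(1)] by (intro integral_mono) (auto simp: space_leb)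
    then show "- C * measure leb \<Omega> \<le> energy \<gamma> u"
      unfolding energy_def using cost_nonneg[of \<gamma>] potential_integral_nonneg[of "marg2 \<gamma>" "marg2 \<gamma>"]
      by (simp add: space_leb mult.commute)
  qed
qed

lemma minimizing_pair_energy:
  assumes "minimizing_pair f V \<Omega> \<mu> \<nu>"
  obtains \<gamma> u where "admissible \<gamma> u" "marg1 \<gamma> = \<mu>" "marg2 \<gamma> = \<nu>"
    "\<And>\<gamma>' u'. admissible \<gamma>' u' \<Longrightarrow> energy \<gamma> u \<le> energy \<gamma>' u'"
proof -
  have m: "\<mu> \<in> prob_on \<Omega>" "\<nu> \<in> prob_on \<Omega>"
    and min: "\<And>\<mu>' \<nu>'. \<mu>' \<in> prob_on \<Omega> \<Longrightarrow> \<nu>' \<in> prob_on \<Omega> \<Longrightarrow> total_functional f V \<Omega> \<mu> \<nu> \<le> total_functional f V \<Omega> \<mu>' \<nu>'"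
    using assms by (auto simp: minimizing_pair_def)
  have le: "total_functional f V \<Omega> \<mu> \<nu> \<le> ereal (energy \<gamma>' u')" if "admissible \<gamma>' u'" for \<gamma>' u'
  proof -
    have "\<gamma>' \<in> plans" using that by (simp add: admissible_def)
    from min[OF marginals_prob_on[OF this]] total_functional_le_energy[OF that] show ?thesis by (rule order_trans)
  qed
  obtain \<gamma>0 u0 where "admissible \<gamma>0 u0" by (rule uniform_admissible)
  from le[OF this] have "total_functional f V \<Omega> \<mu> \<nu> \<noteq> \<infinity>" by auto
  from total_functional_attained[OF m this] obtain \<gamma> u where *: "admissible \<gamma> u" "marg1 \<gamma> = \<mu>" "marg2 \<gamma> = \<nu>"
      "total_functional f V \<Omega> \<mu> \<nu> = ereal (energy \<gamma> u)" by blast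
  show ?thesis using le by (intro that[OF *(1-3)]) (simp add: *(4))
qed

lemma minimizing_pair_of_energy:
  assumes a: "admissible \<gamma> u" and min: "\<And>\<gamma>' u'. admissible \<gamma>' u' \<Longrightarrow> energy \<gamma> u \<le> energy \<gamma>' u'"
  shows "minimizing_pair f V \<Omega> (marg1 \<gamma>) (marg2 \<gamma>)"
  unfolding minimizing_pair_def
proof (intro conjI ballI)
  show "marg1 \<gamma> \<in> prob_on \<Omega>" "marg2 \<gamma> \<in> prob_on \<Omega>"
    using a marginals_prob_on by (auto simp: admissible_def)
  fix \<mu>' \<nu>' assume m: "\<mu>' \<in> prob_on \<Omega>" "\<nu>' \<in> prob_on \<Omega>"
  show "total_functional f V \<Omega> (marg1 \<gamma>) (marg2 \<gamma>) \<le> total_functional f V \<Omega> \<mu>' \<nu>'"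
  proof (cases "total_functional f V \<Omega> \<mu>' \<nu>' = \<infinity>")
    case False
    from total_functional_attained[OF m False] obtain \<gamma>' u' where *: "admissible \<gamma>' u'"
      "total_functional f V \<Omega> \<mu>' \<nu>' = ereal (energy \<gamma>' u')" by blast
    have "total_functional f V \<Omega> (marg1 \<gamma>) (marg2 \<gamma>) \<le> ereal (energy \<gamma> u)" by (rule total_functional_le_energy[OF a])
    also have "\<dots> \<le> ereal (energy \<gamma>' u')" using min[OF *(1)] by simp
    finally show ?thesis using * by simp
  qed simp
qed

end

section \<open>Lower semicontinuity of the internal energy\<close>

context concentration begin

lemma density_integral:
  fixes h :: "'a \<Rightarrow> real"
  assumes u: "lebesgue_density \<Omega> \<mu> u" and h: "h \<in> borel_measurable borel\<Omega>"
  shows "(\<integral>x. h x \<partial>\<mu>) = (\<integral>x. u x * h x \<partial>leb)" "integrable \<mu> h \<longleftrightarrow> integrable leb (\<lambda>x. u x * h x)"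
proof -
  have h': "h \<in> borel_measurable leb" using h by (simp only: measurable_leb_iff)
  have nn: "AE x in leb. 0 \<le> u x" using density_measurable(2)[OF u] by (intro AE_I2) (simp add: space_leb)
  have \<mu>: "\<mu> = density leb (\<lambda>x. ennreal (u x))" using u by (simp add: lebesgue_density_def)
  show "(\<integral>x. h x \<partial>\<mu>) = (\<integral>x. u x * h x \<partial>leb)" "integrable \<mu> h \<longleftrightarrow> integrable leb (\<lambda>x. u x * h x)"
    unfolding \<mu> using integral_real_density[OF density_measurable(1)[OF u] nn h'] integrable_real_density[OF density_measurable(1)[OF u] nn h']
    by simp_all
qed

lemma density_integrable:
  assumes u: "lebesgue_density \<Omega> \<mu> u" and \<mu>: "\<mu> \<in> prob_on \<Omega>"
  shows "integrable leb u" "(\<integral>x. u x \<partial>leb) = 1"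
proof -
  interpret prob_space \<mu> by (rule prob_onD[OF \<mu>])
  show "integrable leb u" using density_integral(2)[OF u, of "\<lambda>_. 1"] by simp
  show "(\<integral>x. u x \<partial>leb) = 1" using density_integral(1)[OF u, of "\<lambda>_. 1"] prob_space by simp
qed

lemma density_exists:
  assumes \<mu>: "\<mu> \<in> prob_on \<Omega>" and ac: "absolutely_continuous leb \<mu>"
  obtains u where "lebesgue_density \<Omega> \<mu> u"
proof -
  have "sets \<mu> = sets leb" using prob_onD(2)[OF \<mu>] sets_leb by simp
  from leb.Radon_Nikodym[OF ac this] obtain g where g: "g \<in> borel_measurable leb" "density leb g = \<mu>" by blast
  have "emeasure (density leb g) (space leb) = (\<integral>\<^sup>+x. g x * indicator (space leb) x \<partial>leb)"
    by (rule emeasure_density[OF g(1) sets.top])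
  also have "\<dots> = (\<integral>\<^sup>+x. g x \<partial>leb)" by (intro nn_integral_cong) simp
  finally have "(\<integral>\<^sup>+x. g x \<partial>leb) = emeasure \<mu> (space \<mu>)" unfolding g(2)[symmetric] by simp
  also have "\<dots> = 1" by (rule prob_space.emeasure_space_1[OF prob_onD(1)[OF \<mu>]])
  finally have "AE x in leb. g x \<noteq> \<infinity>" using g(1) by (intro nn_integral_PInf_AE) auto
  then have "AE x in leb. g x = ennreal (enn2real (g x))" by eventually_elim (simp add: less_top)
  then have "\<mu> = density leb (\<lambda>x. ennreal (enn2real (g x)))"
    unfolding g(2)[symmetric] using g(1) by (intro density_cong) auto
  then have "lebesgue_density \<Omega> \<mu> (\<lambda>x. enn2real (g x))"
    using g(1) by (simp add: lebesgue_density_def)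
  then show ?thesis by (rule that)
qed

lemma density_measure:
  assumes u: "lebesgue_density \<Omega> \<mu> u" and \<mu>: "\<mu> \<in> prob_on \<Omega>" and E: "E \<in> sets leb"
  shows "measure \<mu> E = (\<integral>x. u x * indicator E x \<partial>leb)"
proof -
  have E': "E \<in> sets borel\<Omega>" "E \<in> sets \<mu>" using E sets_leb prob_onD(2)[OF \<mu>] by simp_all
  have "measure \<mu> E = (\<integral>x. indicator E x \<partial>\<mu>)" using E'(2) sets.sets_into_space[OF E'(2)] by (simp add: Int_absorb2)
  also have "\<dots> = (\<integral>x. u x * indicator E x \<partial>leb)" by (rule density_integral(1)[OF u]) (use E' in simp)
  finally show ?thesis .
qed

text \<open>Testing with the set where \<open>w < u\<close> shows that this set is null.\<close>

lemma density_le_on: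
  assumes u: "lebesgue_density \<Omega> \<mu> u" and \<mu>: "\<mu> \<in> prob_on \<Omega>" and w: "integrable leb w" and F: "F \<in> sets leb"
    and le: "\<And>E. E \<in> sets leb \<Longrightarrow> E \<subseteq> F \<Longrightarrow> measure \<mu> E \<le> (\<integral>x. w x * indicator E x \<partial>leb)"
  shows "AE x in leb. x \<in> F \<longrightarrow> u x \<le> w x"
proof -
  have iu: "integrable leb u" by (rule density_integrable[OF u \<mu>])
  have um: "u \<in> borel_measurable leb" and wm: "w \<in> borel_measurable leb" using iu w by auto
  define E where "E = F \<inter> {x \<in> space leb. w x < u x}"
  have E: "E \<in> sets leb" unfolding E_def by (intro sets.Int F borel_measurable_less[OF wm um])
  have iuE: "integrable leb (\<lambda>x. u x * indicator E x)" using integrable_mult_indicator[OF E iu] by (simp add: mult.commute)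
  have iwE: "integrable leb (\<lambda>x. w x * indicator E x)" using integrable_mult_indicator[OF E w] by (simp add: mult.commute)
  have nn: "AE x in leb. 0 \<le> u x * indicator E x - w x * indicator E x"
    by (intro AE_I2) (auto simp: E_def indicator_def)
  have i: "integrable leb (\<lambda>x. u x * indicator E x - w x * indicator E x)" using iuE iwE by simp
  have "(\<integral>x. u x * indicator E x - w x * indicator E x \<partial>leb) = measure \<mu> E - (\<integral>x. w x * indicator E x \<partial>leb)"
    unfolding density_measure[OF u \<mu> E] by (rule Bochner_Integration.integral_diff[OF iuE iwE])
  also have "\<dots> \<le> 0" using le[OF E] by (simp add: E_def)
  finally have "(\<integral>x. u x * indicator E x - w x * indicator E x \<partial>leb) = 0"
    using integral_nonneg_AE[OF nn] by simp
  then have "AE x in leb. u x * indicator E x - w x * indicator E x = 0"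
    using integral_nonneg_eq_0_iff_AE[OF i nn] by simp
  then show ?thesis using AE_space
  proof eventually_elim
    case (elim x)
    show ?case
    proof (intro impI, rule ccontr)
      assume "x \<in> F" "\<not> u x \<le> w x"
      then have "x \<in> E" using elim(2) by (simp add: E_def)
      then show False using elim(1) \<open>\<not> u x \<le> w x\<close> by simp
    qed
  qed
qed

text \<open>Finite Borel measures are inner regular with respect to compact sets.\<close>

lemma null_sets_from_compact:
  assumes \<mu>: "\<mu> \<in> prob_on \<Omega>"
    and null: "\<And>C. compact C \<Longrightarrow> C \<subseteq> \<Omega> \<Longrightarrow> emeasure leb C = 0 \<Longrightarrow> measure \<mu> C = 0"
  shows "absolutely_continuous leb \<mu>"
  unfolding absolutely_continuous_def
proof
  fix N assume N: "N \<in> null_sets leb"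
  let ?M = "distr \<mu> borel (\<lambda>x. x)"
  interpret m: prob_space \<mu> by (rule prob_onD[OF \<mu>])
  have id: "(\<lambda>x. x) \<in> borel_measurable \<mu>" by (rule prob_on_measurable[OF \<mu>]) simp
  have Ns: "N \<in> sets borel\<Omega>" using N sets_leb by auto
  then have Nb: "N \<in> sets borel" "N \<subseteq> \<Omega>" by (auto simp: sets_restrict_space_iff)
  have e: "emeasure ?M A = emeasure \<mu> A" if "A \<in> sets borel" "A \<subseteq> \<Omega>" for A
    using that id prob_onD(3)[OF \<mu>] by (simp add: emeasure_distr Int_absorb2)
  have "emeasure ?M N = (SUP K\<in>{K. K \<subseteq> N \<and> compact K}. emeasure ?M K)"
    using prob_space.emeasure_space_1[OF m.prob_space_distr[OF id]] Nb(1)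
    by (intro inner_regular) auto
  also have "\<dots> = (SUP K\<in>{K. K \<subseteq> N \<and> compact K}. 0)"
  proof (intro SUP_cong refl)
    fix K assume K: "K \<in> {K. K \<subseteq> N \<and> compact K}"
    then have Kb: "K \<in> sets borel" "K \<subseteq> \<Omega>" using Nb by (auto simp: compact_imp_closed)
    have "emeasure leb K \<le> emeasure leb N" using K N by (intro emeasure_mono) auto
    then have "emeasure leb K = 0" using null_setsD1[OF N] by simp
    then have "measure \<mu> K = 0" using K Kb by (intro null) auto
    then show "emeasure ?M K = 0" using e[OF Kb] by (simp add: m.emeasure_eq_measure)
  qed
  also have "\<dots> = 0" by (intro antisym SUP_least) auto
  finally show "N \<in> null_sets \<mu>" using e[OF Nb] Ns prob_onD(2)[OF \<mu>] by (auto simp: null_sets_def)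
qed

text \<open>Weak convergence controls the internal energy only through integrals of continuous
  functions. The tangent inequality \<open>f u \<ge> f w + f' w (u - w)\<close> integrates to such a
  bound for every test function \<open>w\<close>. If \<open>c\<close> is the internal energy of
  \<open>\<mu> = u dx\<close>, the choice \<open>w = u\<close> would give equality.\<close>

definition dual_bound :: "'a measure \<Rightarrow> real \<Rightarrow> ('a \<Rightarrow> real) \<Rightarrow> bool" where
  "dual_bound \<mu> c w \<longleftrightarrow> (\<integral>x. f (w x) - f' (w x) * w x \<partial>leb) + (\<integral>x. f' (w x) \<partial>\<mu>) \<le> c"

lemma dual_bound_integral:
  assumes u: "lebesgue_density \<Omega> \<mu> u" "\<mu> \<in> prob_on \<Omega>"
    and w: "w \<in> borel_measurable borel\<Omega>" "\<And>x. x \<in> \<Omega> \<Longrightarrow> 0 \<le> w x \<and> w x \<le> B"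
  shows "integrable leb (\<lambda>x. (f (w x) - f' (w x) * w x) + u x * f' (w x))"
    "(\<integral>x. f (w x) - f' (w x) * w x \<partial>leb) + (\<integral>x. f' (w x) \<partial>\<mu>) = (\<integral>x. (f (w x) - f' (w x) * w x) + u x * f' (w x) \<partial>leb)"
proof -
  have w': "w \<in> borel_measurable leb" using w(1) by (simp only: measurable_leb_iff)
  obtain C where C1: "\<And>t. t \<in> {0..B} \<Longrightarrow> \<bar>f t - f' t * t\<bar> \<le> C" and C2: "\<And>t. t \<in> {0..B} \<Longrightarrow> \<bar>f' t\<bar> \<le> C"
    by (rule f_bounds[of B]) (rule that; assumption)
  have m1: "(\<lambda>x. f (w x) - f' (w x) * w x) \<in> borel_measurable leb"
    by (rule measurable_nonneg_compose[OF conjugate_continuous w']) (use w in \<open>auto simp: space_leb\<close>)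
  have m2: "(\<lambda>x. f' (w x)) \<in> borel_measurable borel\<Omega>"
    by (rule measurable_nonneg_compose[OF f'_continuous w(1)]) (use w in \<open>auto simp: space_restrict_space\<close>)
  have i1: "integrable leb (\<lambda>x. f (w x) - f' (w x) * w x)"
    by (rule leb.integrable_const_bound[OF _ m1, of C]) (use C1 w in \<open>auto simp: space_leb intro!: AE_I2\<close>)
  have "integrable \<mu> (\<lambda>x. f' (w x))"
    by (rule prob_on_integrable_bounded[OF u(2) prob_on_measurable_restrict[OF u(2) m2], of C]) (use C2 w in auto)
  then have i2: "integrable leb (\<lambda>x. u x * f' (w x))" using density_integral(2)[OF u(1) m2] by simp
  show i12: "integrable leb (\<lambda>x. (f (w x) - f' (w x) * w x) + u x * f' (w x))" using i1 i2 by simp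
  show eq: "(\<integral>x. f (w x) - f' (w x) * w x \<partial>leb) + (\<integral>x. f' (w x) \<partial>\<mu>) = (\<integral>x. (f (w x) - f' (w x) * w x) + u x * f' (w x) \<partial>leb)"
    unfolding density_integral(1)[OF u(1) m2] by (rule Bochner_Integration.integral_add[OF i1 i2, symmetric])
qed

lemma dual_bound_density:
  assumes u: "lebesgue_density \<Omega> \<mu> u" "\<mu> \<in> prob_on \<Omega>" and i: "integrable leb (\<lambda>x. f (u x))"
    and w: "w \<in> borel_measurable borel\<Omega>" "\<And>x. x \<in> \<Omega> \<Longrightarrow> 0 \<le> w x \<and> w x \<le> B"
  shows "dual_bound \<mu> (\<integral>x. f (u x) \<partial>leb) w"
proof -
  have "(\<integral>x. (f (w x) - f' (w x) * w x) + u x * f' (w x) \<partial>leb) \<le> (\<integral>x. f (u x) \<partial>leb)"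
  proof (rule integral_mono[OF dual_bound_integral(1)[OF u w] i])
    fix x assume "x \<in> space leb"
    then have "w x \<ge> 0" "u x \<ge> 0" using w density_measurable(2)[OF u(1)] by (auto simp: space_leb)
    from f_tangent[OF this] show "(f (w x) - f' (w x) * w x) + u x * f' (w x) \<le> f (u x)" by (simp add: algebra_simps)
  qed
  then show ?thesis using dual_bound_integral(2)[OF u w] by (simp add: dual_bound_def)
qed

text \<open>The test functions are uniformly bounded, so \<open>f\<close> and \<open>f'\<close> stay
  bounded along them, and dominated convergence applies for both measures.\<close>

lemma dual_bound_limit:
  assumes \<mu>: "\<mu> \<in> prob_on \<Omega>"
    and b: "\<And>k. dual_bound \<mu> c (W k)"
    and W: "\<And>k. W k \<in> borel_measurable borel\<Omega>" "\<And>k x. x \<in> \<Omega> \<Longrightarrow> 0 \<le> W k x \<and> W k x \<le> B"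
    and w: "w \<in> borel_measurable borel\<Omega>" "\<And>x. x \<in> \<Omega> \<Longrightarrow> 0 \<le> w x"
    and lim: "AE x in leb. (\<lambda>k. W k x) \<longlonglongrightarrow> w x" "AE x in \<mu>. (\<lambda>k. W k x) \<longlonglongrightarrow> w x"
  shows "dual_bound \<mu> c w"
proof -
  interpret m: prob_space \<mu> by (rule prob_onD[OF \<mu>])
  obtain C where C1: "\<And>t. t \<in> {0..B} \<Longrightarrow> \<bar>f t - f' t * t\<bar> \<le> C" and C2: "\<And>t. t \<in> {0..B} \<Longrightarrow> \<bar>f' t\<bar> \<le> C"
    by (rule f_bounds[of B]) (rule that; assumption)
  have ml: "g \<in> borel_measurable leb" if "g \<in> borel_measurable borel\<Omega>" for g :: "'a \<Rightarrow> real"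
    using that by (simp only: measurable_leb_iff)
  have m1: "(\<lambda>x. f (v x) - f' (v x) * v x) \<in> borel_measurable leb" "(\<lambda>x. f' (v x)) \<in> borel_measurable \<mu>"
    if v: "v \<in> borel_measurable borel\<Omega>" "\<And>x. x \<in> \<Omega> \<Longrightarrow> 0 \<le> v x" for v
    by (rule measurable_nonneg_compose[OF conjugate_continuous ml[OF v(1)]], use v in \<open>auto simp: space_leb\<close>)
       (rule measurable_nonneg_compose[OF f'_continuous prob_on_measurable_restrict[OF \<mu> v(1)]],
        use v prob_onD(3)[OF \<mu>] in auto)
  have comp: "(\<lambda>k. g (W k x)) \<longlonglongrightarrow> g (w x)" if "continuous_on {0..} g" "x \<in> \<Omega>" "(\<lambda>k. W k x) \<longlonglongrightarrow> w x" for x and g :: "real \<Rightarrow> real"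
    by (rule continuous_on_tendsto_compose[OF that(1,3)]) (use W w that in auto)
  have "(\<lambda>k. \<integral>x. f (W k x) - f' (W k x) * W k x \<partial>leb) \<longlonglongrightarrow> (\<integral>x. f (w x) - f' (w x) * w x \<partial>leb)"
  proof (rule integral_dominated_convergence[where w="\<lambda>_. C"])
    show "AE x in leb. (\<lambda>k. f (W k x) - f' (W k x) * W k x) \<longlonglongrightarrow> f (w x) - f' (w x) * w x"
      using lim(1) AE_space by eventually_elim (rule comp[OF conjugate_continuous], auto simp: space_leb)
    show "AE x in leb. norm (f (W k x) - f' (W k x) * W k x) \<le> C" for k
      using C1 W by (intro AE_I2) (auto simp: space_leb)
  qed (use m1 W w in auto)
  moreover have "(\<lambda>k. \<integral>x. f' (W k x) \<partial>\<mu>) \<longlonglongrightarrow> (\<integral>x. f' (w x) \<partial>\<mu>)"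
  proof (rule integral_dominated_convergence[where w="\<lambda>_. C"])
    show "AE x in \<mu>. (\<lambda>k. f' (W k x)) \<longlonglongrightarrow> f' (w x)"
      using lim(2) AE_space by eventually_elim (rule comp[OF f'_continuous], auto simp: prob_onD(3)[OF \<mu>])
    show "AE x in \<mu>. norm (f' (W k x)) \<le> C" for k
      using C2 W by (intro AE_I2) (auto simp: prob_onD(3)[OF \<mu>])
  qed (use m1 W w in auto)
  ultimately have "(\<lambda>k. (\<integral>x. f (W k x) - f' (W k x) * W k x \<partial>leb) + (\<integral>x. f' (W k x) \<partial>\<mu>))
      \<longlonglongrightarrow> (\<integral>x. f (w x) - f' (w x) * w x \<partial>leb) + (\<integral>x. f' (w x) \<partial>\<mu>)" by (rule tendsto_add)
  then show ?thesis unfolding dual_bound_def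
    by (rule LIMSEQ_le_const2) (use b in \<open>auto simp: dual_bound_def\<close>)
qed

text \<open>Tested with \<open>t\<close> times the indicator of a null compact set \<open>C\<close>,
  the bound reads \<open>f' 0 (1 - \<mu> C) + f' t (\<mu> C) \<le> c\<close>. Since
  \<open>f'\<close> is unbounded, \<open>\<mu> C = 0\<close>.\<close>

lemma dual_bound_absolutely_continuous:
  assumes \<mu>: "\<mu> \<in> prob_on \<Omega>"
    and b: "\<And>w. continuous_on \<Omega> w \<Longrightarrow> (\<And>x. x \<in> \<Omega> \<Longrightarrow> 0 \<le> w x) \<Longrightarrow> dual_bound \<mu> c w"
  shows "absolutely_continuous leb \<mu>"
proof (rule null_sets_from_compact[OF \<mu>])
  fix C assume C: "compact C" "C \<subseteq> \<Omega>" "emeasure leb C = 0"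
  interpret m: prob_space \<mu> by (rule prob_onD[OF \<mu>])
  have Cs: "C \<in> sets borel\<Omega>" using C by (auto simp: sets_restrict_space_iff compact_imp_closed)
  then have Cm: "C \<in> sets \<mu>" "C \<in> sets leb" using prob_onD(2)[OF \<mu>] sets_leb by auto
  show "measure \<mu> C = 0"
  proof (cases "C = {}")
    case False
    have key: "f' 0 * (1 - measure \<mu> C) + f' t * measure \<mu> C \<le> c" if t: "t > 0" for t
    proof -
      define w where "w = (\<lambda>x. t * indicator C x)"
      have "dual_bound \<mu> c w"
      proof (rule dual_bound_limit[OF \<mu>, where W="\<lambda>k x. t * max 0 (1 - real k * infdist x C)" and B=t])
        have ct: "continuous_on S (\<lambda>x. t * max 0 (1 - real k * infdist x C))" for S k by (intro continuous_intros)
        show "dual_bound \<mu> c (\<lambda>x. t * max 0 (1 - real k * infdist x C))" for k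
          by (rule b[OF ct]) (use t in auto)
        show "(\<lambda>x. t * max 0 (1 - real k * infdist x C)) \<in> borel_measurable borel\<Omega>" for k
          by (rule borel_measurable_continuous_on_restrict[OF ct])
        show "0 \<le> t * max 0 (1 - real k * infdist x C) \<and> t * max 0 (1 - real k * infdist x C) \<le> t" for k x
          using t by (auto simp: infdist_nonneg mult_le_cancel_left1)
        show "w \<in> borel_measurable borel\<Omega>" unfolding w_def using Cs by simp
        show "0 \<le> w x" for x using t by (simp add: w_def)
        have "(\<lambda>k. t * max 0 (1 - real k * infdist x C)) \<longlonglongrightarrow> w x" for x
          unfolding w_def using C(1) False
          by (intro tendsto_mult tendsto_const infdist_cutoff_tendsto) (simp_all add: compact_imp_closed)
        then show "AE x in leb. (\<lambda>k. t * max 0 (1 - real k * infdist x C)) \<longlonglongrightarrow> w x"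
          "AE x in \<mu>. (\<lambda>k. t * max 0 (1 - real k * infdist x C)) \<longlonglongrightarrow> w x" by auto
      qed
      moreover have "(\<integral>x. f (w x) - f' (w x) * w x \<partial>leb) = 0"
      proof (rule integral_eq_zero_AE)
        have "AE x in leb. x \<notin> C" using C(3) Cm by (intro AE_not_in) auto
        then show "AE x in leb. f (w x) - f' (w x) * w x = 0" by eventually_elim (simp add: w_def f_0)
      qed
      moreover have "(\<integral>x. f' (w x) \<partial>\<mu>) = f' 0 * (1 - measure \<mu> C) + f' t * measure \<mu> C"
      proof -
        have "(\<integral>x. f' (w x) \<partial>\<mu>) = (\<integral>x. f' 0 + (f' t - f' 0) * indicator C x \<partial>\<mu>)"
          by (intro Bochner_Integration.integral_cong) (auto simp: w_def indicator_def)
        also have "\<dots> = f' 0 + (f' t - f' 0) * measure \<mu> C"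
          using Cm m.integrable_const_bound[of "indicator C :: 'a \<Rightarrow> real" 1] by (subst Bochner_Integration.integral_add) (auto simp: m.prob_space)
        finally show ?thesis by (simp add: algebra_simps)
      qed
      ultimately show ?thesis unfolding dual_bound_def by simp
    qed
    show ?thesis
    proof (rule ccontr)
      assume "measure \<mu> C \<noteq> 0"
      then have p: "measure \<mu> C > 0" by (simp add: less_le)
      obtain t where t: "t > 0" "f' t > (c - f' 0 * (1 - measure \<mu> C)) / measure \<mu> C" using f'_unbounded by blast
      then have "f' t * measure \<mu> C > c - f' 0 * (1 - measure \<mu> C)" using p by (simp add: field_simps)
      then show False using key[OF t(1)] by simp
    qed
  qed simp
qed

text \<open>Lebesgue measurable functions are limits almost everywhere of continuous ones; clamping
  preserves the bounds.\<close>

lemma continuous_approximation: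
  assumes w: "w \<in> borel_measurable leb" "\<And>x. x \<in> \<Omega> \<Longrightarrow> 0 \<le> w x \<and> w x \<le> B"
  obtains W :: "nat \<Rightarrow> 'a \<Rightarrow> real" where "\<And>k. continuous_on UNIV (W k)" "\<And>k x. 0 \<le> W k x \<and> W k x \<le> B"
    "AE x in leb. (\<lambda>k. W k x) \<longlonglongrightarrow> w x"
proof -
  have B0: "B \<ge> 0" using w(2) nonempty by force
  define w' where "w' = (\<lambda>x. if x \<in> \<Omega> then w x else 0)"
  have "w' \<in> borel_measurable lborel"
  proof -
    have "(\<lambda>x. indicator \<Omega> x *\<^sub>R w x) \<in> borel_measurable lborel"
      using w(1) by (subst (asm) borel_measurable_restrict_space_iff) auto
    also have "(\<lambda>x. indicator \<Omega> x *\<^sub>R w x) = w'" by (auto simp: w'_def indicator_def)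
    finally show ?thesis .
  qed
  then have "w' \<in> borel_measurable lebesgue" by (simp add: measurable_completion)
  then have "w' measurable_on UNIV"
    by (rule lebesgue_measurable_imp_measurable_on_nnreal_UNIV) (use w in \<open>auto simp: w'_def\<close>)
  then obtain N g where N: "negligible N" and g: "\<And>n. continuous_on UNIV (g n)"
    and lim: "\<And>x. x \<notin> N \<Longrightarrow> (\<lambda>n. g n x) \<longlonglongrightarrow> w' x"
    unfolding measurable_on_def by (auto simp: Ball_def)
  define W where "W = (\<lambda>k x. max 0 (min B (g k x)))"
  show ?thesis
  proof (rule that[of W])
    show "continuous_on UNIV (W k)" for k unfolding W_def by (intro continuous_intros g)
    show "0 \<le> W k x \<and> W k x \<le> B" for k x using B0 by (simp add: W_def)
    have "AE x in lebesgue. x \<notin> N" using N by (intro AE_not_in) (simp add: negligible_iff_null_sets)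
    then have "AE x in lborel. x \<notin> N" by (simp add: AE_completion_iff)
    then have "AE x in lborel. x \<in> \<Omega> \<longrightarrow> (\<lambda>k. W k x) \<longlonglongrightarrow> w x"
    proof eventually_elim
      case (elim x)
      have "(\<lambda>k. W k x) \<longlonglongrightarrow> max 0 (min B (w' x))"
        unfolding W_def by (intro tendsto_intros lim elim)
      then show ?case using w(2)[of x] by (auto simp: w'_def)
    qed
    then show "AE x in leb. (\<lambda>k. W k x) \<longlonglongrightarrow> w x" by (subst AE_restrict_space_iff) auto
  qed
qed

text \<open>With a density \<open>u\<close> at hand, the test function \<open>min u M\<close> gives
  \<open>\<integral> f (min u M) dx \<le> c\<close>: the remaining term \<open>f' (min u M) (u - min
  u M)\<close> lives where \<open>u > M\<close> and is nonnegative there as soon as \<open>f' M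
  \<ge> 0\<close>. Fatou's lemma lets \<open>M\<close> tend to infinity.\<close>

lemma internal_energy_of_dual_bound:
  assumes \<mu>: "\<mu> \<in> prob_on \<Omega>"
    and b: "\<And>w. continuous_on \<Omega> w \<Longrightarrow> (\<And>x. x \<in> \<Omega> \<Longrightarrow> 0 \<le> w x) \<Longrightarrow> dual_bound \<mu> c w"
  obtains u where "lebesgue_density \<Omega> \<mu> u" "integrable leb (\<lambda>x. f (u x))" "(\<integral>x. f (u x) \<partial>leb) \<le> c"
proof -
  have ac: "absolutely_continuous leb \<mu>" by (rule dual_bound_absolutely_continuous[OF \<mu> b])
  obtain u where u: "lebesgue_density \<Omega> \<mu> u" using density_exists[OF \<mu> ac] .
  note um = density_measurable[OF u]
  have sets\<mu>: "sets \<mu> = sets leb" using prob_onD(2)[OF \<mu>] sets_leb by simp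
  obtain T where T: "T > 0" "f' T > 0" using f'_unbounded by blast
  obtain C where C: "C \<ge> 0" "\<And>t. t \<ge> 0 \<Longrightarrow> f t \<ge> - C" using f_bounded_below by blast
  have trunc: "(\<integral>\<^sup>+x. ennreal (f (min (u x) M) + C) \<partial>leb) \<le> ennreal (c + C * measure leb \<Omega>)"
    "0 \<le> c + C * measure leb \<Omega>" if M: "M \<ge> T" for M
  proof -
    define w where "w = (\<lambda>x. min (u x) M)"
    have w: "w \<in> borel_measurable leb" "\<And>x. x \<in> \<Omega> \<Longrightarrow> 0 \<le> w x \<and> w x \<le> M"
      using um M T by (auto simp: w_def)
    have w': "w \<in> borel_measurable borel\<Omega>" using w(1) by (simp only: measurable_leb_iff)
    obtain W where W: "\<And>k. continuous_on UNIV (W k)" "\<And>k x. 0 \<le> W k x \<and> W k x \<le> M"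
      "AE x in leb. (\<lambda>k. W k x) \<longlonglongrightarrow> w x"
      using continuous_approximation[OF w] by metis
    have cW: "continuous_on \<Omega> (W k)" for k using W(1) continuous_on_subset by blast
    have "dual_bound \<mu> c w"
    proof (rule dual_bound_limit[OF \<mu>, where W=W and B=M])
      show "dual_bound \<mu> c (W k)" for k by (rule b[OF cW]) (use W(2) in auto)
      show "W k \<in> borel_measurable borel\<Omega>" for k by (rule borel_measurable_continuous_on_restrict[OF cW])
      show "AE x in \<mu>. (\<lambda>k. W k x) \<longlonglongrightarrow> w x" by (rule absolutely_continuous_AE[OF sets\<mu> ac W(3)])
    qed (use W w w' in auto)
    have iw: "integrable leb (\<lambda>x. f (w x))"
      by (rule f_integrable_bounded[OF finite_measure_leb w(1)]) (use w(2) in \<open>auto simp: space_leb\<close>)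
    have iuw: "integrable leb (\<lambda>x. f' (w x) * (u x - w x))"
    proof -
      have "integrable leb (\<lambda>x. f' (w x) * (u x - w x)) \<longleftrightarrow> integrable leb (\<lambda>x. f' M * (u x - w x))"
        by (intro Bochner_Integration.integrable_cong) (auto simp: w_def min_def)
      moreover have "integrable leb w"
        by (rule leb.integrable_const_bound[of _ M]) (use w in \<open>auto simp: space_leb intro!: AE_I2\<close>)
      ultimately show ?thesis using density_integrable[OF u \<mu>] by simp
    qed
    have "(\<integral>x. f (w x) \<partial>leb) \<le> (\<integral>x. f (w x) + f' (w x) * (u x - w x) \<partial>leb)"
    proof (rule integral_mono[OF iw Bochner_Integration.integrable_add[OF iw iuw]])
      fix x
      have "f' (w x) * (u x - w x) \<ge> 0"
      proof (cases "u x \<le> M")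
        case False
        have "f' M > 0" using f'_mono[of T M] T M by simp
        then show ?thesis using False by (simp add: w_def min_def)
      qed (simp add: w_def)
      then show "f (w x) \<le> f (w x) + f' (w x) * (u x - w x)" by simp
    qed
    also have "\<dots> = (\<integral>x. (f (w x) - f' (w x) * w x) + u x * f' (w x) \<partial>leb)"
      by (intro Bochner_Integration.integral_cong) (auto simp: algebra_simps)
    also have "\<dots> = (\<integral>x. f (w x) - f' (w x) * w x \<partial>leb) + (\<integral>x. f' (w x) \<partial>\<mu>)"
      by (rule dual_bound_integral(2)[OF u \<mu> w' w(2), symmetric])
    also have "\<dots> \<le> c" using \<open>dual_bound \<mu> c w\<close> by (simp add: dual_bound_def)
    finally have le: "(\<integral>x. f (w x) \<partial>leb) \<le> c" .
    have pos: "AE x in leb. 0 \<le> f (w x) + C"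
    proof (rule AE_I2)
      fix x assume "x \<in> space leb"
      then show "0 \<le> f (w x) + C" using C(2)[of "w x"] w(2)[of x] by (simp add: space_leb)
    qed
    have "(\<integral>\<^sup>+x. ennreal (f (w x) + C) \<partial>leb) = ennreal (\<integral>x. f (w x) + C \<partial>leb)"
      by (rule nn_integral_eq_integral[OF _ pos]) (use iw in simp)
    moreover have e: "(\<integral>x. f (w x) + C \<partial>leb) = (\<integral>x. f (w x) \<partial>leb) + C * measure leb \<Omega>"
      using iw by (simp add: space_leb mult.commute)
    ultimately show "(\<integral>\<^sup>+x. ennreal (f (min (u x) M) + C) \<partial>leb) \<le> ennreal (c + C * measure leb \<Omega>)"
      using le by (simp add: w_def ennreal_leI)
    show "0 \<le> c + C * measure leb \<Omega>" using integral_nonneg_AE[OF pos] e le by simp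
  qed
  have "(\<integral>\<^sup>+x. ennreal (f (u x) + C) \<partial>leb) = (\<integral>\<^sup>+x. liminf (\<lambda>k. ennreal (f (min (u x) (T + real k)) + C)) \<partial>leb)"
  proof (rule nn_integral_cong)
    fix x
    obtain k0 :: nat where k0: "u x \<le> real k0" using real_arch_simple by blast
    have "\<forall>\<^sub>F k in sequentially. ennreal (f (min (u x) (T + real k)) + C) = ennreal (f (u x) + C)"
      using k0 T by (intro eventually_sequentiallyI[of k0]) (simp add: min_def)
    then have "(\<lambda>k. ennreal (f (min (u x) (T + real k)) + C)) \<longlonglongrightarrow> ennreal (f (u x) + C)" by (rule tendsto_eventually)
    then show "ennreal (f (u x) + C) = liminf (\<lambda>k. ennreal (f (min (u x) (T + real k)) + C))"
      by (metis lim_imp_Liminf sequentially_bot)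
  qed
  also have "\<dots> \<le> liminf (\<lambda>k. \<integral>\<^sup>+x. ennreal (f (min (u x) (T + real k)) + C) \<partial>leb)"
  proof (rule nn_integral_liminf)
    fix k :: nat
    have "(\<lambda>x. f (min (u x) (T + real k))) \<in> borel_measurable leb"
      by (rule measurable_nonneg_compose[OF f_continuous]) (use um T in \<open>auto simp: space_leb\<close>)
    then show "(\<lambda>x. ennreal (f (min (u x) (T + real k)) + C)) \<in> borel_measurable leb" by simp
  qed
  also have "\<dots> \<le> liminf (\<lambda>k::nat. ennreal (c + C * measure leb \<Omega>))"
    by (intro Liminf_mono always_eventually allI trunc(1)) (use T in simp)
  also have "\<dots> = ennreal (c + C * measure leb \<Omega>)" by (simp add: Liminf_const)
  finally have fat: "(\<integral>\<^sup>+x. ennreal (f (u x) + C) \<partial>leb) \<le> ennreal (c + C * measure leb \<Omega>)" .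
  have pos: "AE x in leb. 0 \<le> f (u x) + C"
  proof (rule AE_I2)
    fix x assume "x \<in> space leb"
    then show "0 \<le> f (u x) + C" using C(2)[of "u x"] um(2)[of x] by (simp add: space_leb)
  qed
  have "(\<integral>\<^sup>+x. ennreal (f (u x) + C) \<partial>leb) < \<infinity>" using fat le_less_trans by fastforce
  then have i: "integrable leb (\<lambda>x. f (u x) + C)"
    using um by (intro integrableI_nonneg[OF _ pos]) auto
  then have "integrable leb (\<lambda>x. (f (u x) + C) - C)" by (intro Bochner_Integration.integrable_diff) auto
  then have iu: "integrable leb (\<lambda>x. f (u x))" by simp
  have c0: "0 \<le> c + C * measure leb \<Omega>" by (rule trunc(2)[OF order_refl])
  have "ennreal (\<integral>x. f (u x) + C \<partial>leb) \<le> ennreal (c + C * measure leb \<Omega>)"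
    using fat nn_integral_eq_integral[OF i pos] by simp
  then have "(\<integral>x. f (u x) + C \<partial>leb) \<le> c + C * measure leb \<Omega>" using c0 by (simp add: ennreal_le_iff)
  then have "(\<integral>x. f (u x) \<partial>leb) \<le> c" using iu by (simp add: space_leb mult.commute)
  with u iu that show ?thesis by blast
qed

end

section \<open>Existence of minimizers\<close>

context concentration begin

text \<open>Along a minimizing sequence the cost and the interaction converge, hence so do the
  internal energies. The dual bounds of the sequence pass to the limit plan, with the limit of the
  internal energies as their constant.\<close>

lemma energy_minimizer_exists:
  obtains \<gamma> u where "admissible \<gamma> u" "\<And>\<gamma>' u'. admissible \<gamma>' u' \<Longrightarrow> energy \<gamma> u \<le> energy \<gamma>' u'"
proof -
  define E where "E = {energy \<gamma> u | \<gamma> u. admissible \<gamma> u}"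
  define m where "m = Inf E"
  have ne: "E \<noteq> {}"
  proof -
    obtain \<gamma> u where "admissible \<gamma> u" by (rule uniform_admissible)
    then show ?thesis by (auto simp: E_def)
  qed
  have bdd: "bdd_below E"
  proof -
    obtain C where "\<And>\<gamma> u. admissible \<gamma> u \<Longrightarrow> C \<le> energy \<gamma> u" using energy_bounded_below by metis
    then show ?thesis by (auto simp: E_def intro!: bdd_belowI[of _ C])
  qed
  have m_le: "m \<le> energy \<gamma> u" if "admissible \<gamma> u" for \<gamma> u
    unfolding m_def using that by (intro cInf_lower bdd) (auto simp: E_def)
  have "\<exists>\<gamma> u. admissible \<gamma> u \<and> energy \<gamma> u < m + 1 / real (Suc n)" for n
  proof -
    have "Inf E < m + 1 / real (Suc n)" by (simp add: m_def)
    from cInf_lessD[OF ne this] show ?thesis by (auto simp: E_def)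
  qed
  then obtain G U where adm: "\<And>n. admissible (G n) (U n)" and near: "\<And>n. energy (G n) (U n) < m + 1 / real (Suc n)" by metis
  have elim: "(\<lambda>n. energy (G n) (U n)) \<longlonglongrightarrow> m"
  proof (rule tendsto_sandwich[where f="\<lambda>_. m"])
    show "(\<lambda>n. m + 1 / real (Suc n)) \<longlonglongrightarrow> m" by real_asymp
  qed (use m_le[OF adm] near in \<open>auto intro!: always_eventually less_imp_le\<close>)
  have Gp: "G n \<in> plans" for n using adm by (simp add: admissible_def)
  obtain r :: "nat \<Rightarrow> nat" and \<gamma> where r: "strict_mono r" and \<gamma>: "\<gamma> \<in> plans"
    and cost: "(\<lambda>n. cost (G (r n))) \<longlonglongrightarrow> cost \<gamma>"
    and inter: "(\<lambda>n. \<integral>z. potential (marg2 (G (r n))) z \<partial>marg2 (G (r n))) \<longlonglongrightarrow> (\<integral>z. potential (marg2 \<gamma>) z \<partial>marg2 \<gamma>)"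
    and lim: "\<And>h :: 'a \<Rightarrow> real. continuous_on \<Omega> h \<Longrightarrow> (\<lambda>n. \<integral>x. h x \<partial>marg1 (G (r n))) \<longlonglongrightarrow> (\<integral>x. h x \<partial>marg1 \<gamma>)"
    by (rule plans_sequentially_compact[OF Gp]) (rule that; assumption)
  note cost inter
  moreover have "(\<lambda>n. energy (G (r n)) (U (r n))) \<longlonglongrightarrow> m"
    using LIMSEQ_subseq_LIMSEQ[OF elim r] by (simp add: comp_def)
  ultimately have "(\<lambda>n. energy (G (r n)) (U (r n)) - cost (G (r n)) / 2 - (\<integral>z. potential (marg2 (G (r n))) z \<partial>marg2 (G (r n))))
      \<longlonglongrightarrow> m - cost \<gamma> / 2 - (\<integral>z. potential (marg2 \<gamma>) z \<partial>marg2 \<gamma>)"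
    by (intro tendsto_diff tendsto_divide tendsto_const) auto
  then have intlim: "(\<lambda>n. \<integral>x. f (U (r n) x) \<partial>leb) \<longlonglongrightarrow> m - cost \<gamma> / 2 - (\<integral>z. potential (marg2 \<gamma>) z \<partial>marg2 \<gamma>)" (is "_ \<longlonglongrightarrow> ?c")
    by (simp add: energy_def)
  have db: "dual_bound (marg1 \<gamma>) ?c w" if w: "continuous_on \<Omega> w" "\<And>x. x \<in> \<Omega> \<Longrightarrow> 0 \<le> w x" for w
  proof -
    have wm: "w \<in> borel_measurable borel\<Omega>" by (rule borel_measurable_continuous_on_restrict[OF w(1)])
    obtain B where B: "\<And>x. x \<in> \<Omega> \<Longrightarrow> \<bar>w x\<bar> \<le> B" using compact_continuous_bounded[OF compact w(1)] by metis
    have "dual_bound (marg1 (G (r n))) (\<integral>x. f (U (r n) x) \<partial>leb) w" for n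
    proof (rule dual_bound_density[OF _ marginals_prob_on(1)[OF Gp] _ wm, where B=B])
      show "0 \<le> w x \<and> w x \<le> B" if "x \<in> \<Omega>" for x using w(2)[OF that] B[OF that] by simp
    qed (use adm[of "r n"] in \<open>auto simp: admissible_def\<close>)
    moreover have "(\<lambda>n. (\<integral>x. f (w x) - f' (w x) * w x \<partial>leb) + (\<integral>x. f' (w x) \<partial>marg1 (G (r n))))
      \<longlonglongrightarrow> (\<integral>x. f (w x) - f' (w x) * w x \<partial>leb) + (\<integral>x. f' (w x) \<partial>marg1 \<gamma>)"
    proof (rule tendsto_add[OF tendsto_const lim])
      show "continuous_on \<Omega> (\<lambda>x. f' (w x))" by (rule continuous_on_compose2[OF f'_continuous w(1)]) (use w in auto)
    qed
    ultimately show ?thesis unfolding dual_bound_def by (intro LIMSEQ_le[OF _ intlim]) auto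
  qed
  obtain u where u: "lebesgue_density \<Omega> (marg1 \<gamma>) u" "integrable leb (\<lambda>x. f (u x))" "(\<integral>x. f (u x) \<partial>leb) \<le> ?c"
    using internal_energy_of_dual_bound[OF marginals_prob_on(1)[OF \<gamma>] db] by metis
  show ?thesis
  proof (rule that[of \<gamma> u])
    show "admissible \<gamma> u" using \<gamma> u by (simp add: admissible_def)
    fix \<gamma>' u' assume "admissible \<gamma>' u'"
    from m_le[OF this] show "energy \<gamma> u \<le> energy \<gamma>' u'" using u(3) by (simp add: energy_def)
  qed
qed

lemma minimizing_pair_exists: "\<exists>\<mu> \<nu>. minimizing_pair f V \<Omega> \<mu> \<nu>"
proof -
  obtain \<gamma> u where "admissible \<gamma> u" "\<And>\<gamma>' u'. admissible \<gamma>' u' \<Longrightarrow> energy \<gamma> u \<le> energy \<gamma>' u'"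
    using energy_minimizer_exists by metis
  from minimizing_pair_of_energy[OF this] show ?thesis by blast
qed

end

section \<open>Variation of the second marginal\<close>

context concentration begin

lemma cost_mixture:
  assumes "\<gamma> \<in> plans" "\<gamma>' \<in> plans" "0 \<le> \<epsilon>" "\<epsilon> \<le> 1"
  shows "cost (mixture \<epsilon> \<gamma> \<gamma>') = (1 - \<epsilon>) * cost \<gamma> + \<epsilon> * cost \<gamma>'"
proof -
  obtain B where "\<And>z. z \<in> \<Omega> \<times> \<Omega> \<Longrightarrow> \<bar>(norm (fst z - snd z))\<^sup>2\<bar> \<le> B"
    using compact_continuous_bounded[OF compact2 cost_continuous] by metis
  then show ?thesis unfolding cost_def
    by (intro integral_mixture[OF assms borel_measurable_continuous_on_restrict[OF cost_continuous]])
qed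

lemma marginal_mixture:
  assumes "\<gamma> \<in> plans" "\<gamma>' \<in> plans" "0 \<le> \<epsilon>" "\<epsilon> \<le> 1"
  shows "marg1 (mixture \<epsilon> \<gamma> \<gamma>') = mixture \<epsilon> (marg1 \<gamma>) (marg1 \<gamma>')" "marg2 (mixture \<epsilon> \<gamma> \<gamma>') = mixture \<epsilon> (marg2 \<gamma>) (marg2 \<gamma>')"
  by (rule distr_mixture[OF assms projections_measurable(1)], rule distr_mixture[OF assms projections_measurable(2)])

lemma potential_mixture:
  assumes "\<nu> \<in> prob_on \<Omega>" "\<nu>' \<in> prob_on \<Omega>" "0 \<le> \<epsilon>" "\<epsilon> \<le> 1" "z \<in> \<Omega>"
  shows "potential (mixture \<epsilon> \<nu> \<nu>') z = (1 - \<epsilon>) * potential \<nu> z + \<epsilon> * potential \<nu>' z"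
proof -
  obtain B where "\<And>z w. z \<in> \<Omega> \<Longrightarrow> w \<in> \<Omega> \<Longrightarrow> \<bar>V ((norm (z - w))\<^sup>2)\<bar> \<le> B" using kernel_bounded by metis
  then show ?thesis unfolding potential_def using assms(5)
    by (intro integral_mixture[OF assms(1-4) borel_measurable_continuous_on_restrict[OF kernel_section_continuous]])
qed

lemma interaction_mixture:
  assumes \<nu>: "\<nu> \<in> prob_on \<Omega>" and \<nu>': "\<nu>' \<in> prob_on \<Omega>" and \<epsilon>: "0 \<le> \<epsilon>" "\<epsilon> \<le> 1"
  shows "(\<integral>z. potential (mixture \<epsilon> \<nu> \<nu>') z \<partial>mixture \<epsilon> \<nu> \<nu>') =
    (1 - \<epsilon>)\<^sup>2 * (\<integral>z. potential \<nu> z \<partial>\<nu>) + 2 * \<epsilon> * (1 - \<epsilon>) * (\<integral>z. potential \<nu> z \<partial>\<nu>') + \<epsilon>\<^sup>2 * (\<integral>z. potential \<nu>' z \<partial>\<nu>')"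
proof -
  let ?Q = "mixture \<epsilon> \<nu> \<nu>'"
  note Q = mixture_in_prob_on[OF assms]
  have i: "integrable R (potential R')" if "R \<in> prob_on \<Omega>" "R' \<in> prob_on \<Omega>" for R R'
    by (rule prob_on_integrable_continuous[OF that(1) compact potential_continuous[OF that(2)]])
  have split: "(\<integral>z. potential R z \<partial>?Q) = (1 - \<epsilon>) * (\<integral>z. potential R z \<partial>\<nu>) + \<epsilon> * (\<integral>z. potential R z \<partial>\<nu>')"
    if R: "R \<in> prob_on \<Omega>" for R
  proof -
    obtain B where "\<And>z. z \<in> \<Omega> \<Longrightarrow> \<bar>potential R z\<bar> \<le> B"
      using compact_continuous_bounded[OF compact potential_continuous[OF R]] by metis
    then show ?thesis
      by (intro integral_mixture[OF assms borel_measurable_continuous_on_restrict[OF potential_continuous[OF R]]])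
  qed
  have "(\<integral>z. potential ?Q z \<partial>?Q) = (\<integral>z. (1 - \<epsilon>) * potential \<nu> z + \<epsilon> * potential \<nu>' z \<partial>?Q)"
    by (rule Bochner_Integration.integral_cong) (auto simp: prob_onD(3)[OF Q] potential_mixture[OF assms])
  also have "\<dots> = (1 - \<epsilon>) * (\<integral>z. potential \<nu> z \<partial>?Q) + \<epsilon> * (\<integral>z. potential \<nu>' z \<partial>?Q)"
    using i[OF Q \<nu>] i[OF Q \<nu>'] by simp
  finally show ?thesis unfolding split[OF \<nu>] split[OF \<nu>'] potential_symmetric[OF \<nu> \<nu>']
    by (simp add: power2_eq_square algebra_simps)
qed

end

locale energy_minimizer = concentration +
  fixes \<gamma> u
  assumes admissible: "admissible \<gamma> u"
    and energy_minimal: "\<And>\<gamma>' u'. admissible \<gamma>' u' \<Longrightarrow> energy \<gamma> u \<le> energy \<gamma>' u'"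
begin

abbreviation "\<mu> \<equiv> marg1 \<gamma>"
abbreviation "\<nu> \<equiv> marg2 \<gamma>"

lemma \<gamma>: "\<gamma> \<in> plans" and u: "lebesgue_density \<Omega> \<mu> u" and fu: "integrable leb (\<lambda>x. f (u x))"
  using admissible by (auto simp: admissible_def)

lemma \<mu>: "\<mu> \<in> prob_on \<Omega>" and \<nu>: "\<nu> \<in> prob_on \<Omega>"
  using marginals_prob_on[OF \<gamma>] by auto

text \<open>Mixing \<open>\<gamma>\<close> with a plan that has the same first marginal changes the
  cost linearly and the interaction quadratically.\<close>

lemma second_marginal_variation:
  assumes \<gamma>': "\<gamma>' \<in> plans" and m: "marg1 \<gamma>' = \<mu>"
  shows "cost \<gamma> / 2 + 2 * (\<integral>z. potential \<nu> z \<partial>\<nu>) \<le> cost \<gamma>' / 2 + 2 * (\<integral>z. potential \<nu> z \<partial>marg2 \<gamma>')"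
proof -
  let ?\<nu>' = "marg2 \<gamma>'"
  define a where "a = (\<integral>z. potential \<nu> z \<partial>\<nu>)"
  define b where "b = (\<integral>z. potential \<nu> z \<partial>?\<nu>')"
  define c where "c = (\<integral>z. potential ?\<nu>' z \<partial>?\<nu>')"
  have "0 \<le> (cost \<gamma>' - cost \<gamma>) / 2 + 2 * (b - a)"
  proof (rule first_order_nonneg[where b = "a - 2 * b + c"])
    fix \<epsilon> :: real assume "0 < \<epsilon>" "\<epsilon> < 1"
    then have e: "0 \<le> \<epsilon>" "\<epsilon> \<le> 1" by auto
    have m1: "marg1 (mixture \<epsilon> \<gamma> \<gamma>') = \<mu>"
      unfolding marginal_mixture[OF \<gamma> \<gamma>' e] m by (rule mixture_self[OF \<mu> e])
    have "admissible (mixture \<epsilon> \<gamma> \<gamma>') u"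
      unfolding admissible_def m1 using u fu mixture_in_prob_on[OF \<gamma> \<gamma>' e] by simp
    from energy_minimal[OF this]
    have "cost \<gamma> / 2 + a \<le> ((1 - \<epsilon>) * cost \<gamma> + \<epsilon> * cost \<gamma>') / 2 + ((1 - \<epsilon>)\<^sup>2 * a + 2 * \<epsilon> * (1 - \<epsilon>) * b + \<epsilon>\<^sup>2 * c)"
      unfolding energy_def cost_mixture[OF \<gamma> \<gamma>' e] marginal_mixture[OF \<gamma> \<gamma>' e]
        interaction_mixture[OF \<nu> marginals_prob_on(2)[OF \<gamma>'] e] a_def b_def c_def by simp
    then show "0 \<le> \<epsilon> * ((cost \<gamma>' - cost \<gamma>) / 2 + 2 * (b - a)) + \<epsilon>\<^sup>2 * (a - 2 * b + c)"
      by (simp add: power2_eq_square field_simps)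
  qed
  then show ?thesis unfolding a_def b_def by (simp add: field_simps)
qed

text \<open>The first variation of the energy with respect to mass at \<open>(x, z)\<close>, as far
  as it depends on \<open>z\<close>.\<close>

definition second_cost :: "'a \<Rightarrow> 'a \<Rightarrow> real" where
  "second_cost x z = (norm (x - z))\<^sup>2 / 2 + 2 * potential \<nu> z"

lemma second_cost_continuous: "continuous_on (\<Omega> \<times> \<Omega>) (\<lambda>p. second_cost (fst p) (snd p))"
  unfolding second_cost_def
  by (intro continuous_intros continuous_on_compose2[OF potential_continuous[OF \<nu>]]) auto

text \<open>Otherwise the second coordinate would be moved to \<open>z\<close> on the set where that
  is strictly cheaper.\<close>

lemma second_optimality_fixed:
  assumes z: "z \<in> \<Omega>"
  shows "AE p in \<gamma>. second_cost (fst p) (snd p) \<le> second_cost (fst p) z"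
proof -
  let ?B2 = "restrict_space borel (\<Omega> \<times> \<Omega>) :: ('a \<times> 'a) measure"
  interpret g: prob_space \<gamma> by (rule prob_onD[OF \<gamma>])
  have c1: "continuous_on (\<Omega> \<times> \<Omega>) (\<lambda>p. second_cost (fst p) (snd p))" by (rule second_cost_continuous)
  have c2: "continuous_on (\<Omega> \<times> \<Omega>) (\<lambda>p. second_cost (fst p) z)"
    unfolding second_cost_def by (intro continuous_intros) simp
  note m1 = borel_measurable_continuous_on_restrict[OF c1] and m2 = borel_measurable_continuous_on_restrict[OF c2]
  define A where "A = {p \<in> space ?B2. second_cost (fst p) z < second_cost (fst p) (snd p)}"
  have A: "A \<in> sets ?B2" unfolding A_def by (rule borel_measurable_less[OF m2 m1])
  define T where "T = (\<lambda>p. if p \<in> A then (fst p, z) else p)"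
  have T: "T \<in> measurable ?B2 ?B2"
    unfolding T_def
  proof (rule measurable_If_set)
    have "(\<lambda>p::'a\<times>'a. (fst p, z)) \<in> borel_measurable borel" by (intro borel_measurable_continuous_onI continuous_intros)
    then show "(\<lambda>p. (fst p, z)) \<in> measurable ?B2 ?B2"
      using z by (auto intro!: measurable_restrict_space2[OF _ measurable_restrict_space1] simp: space_restrict_space)
    show "A \<inter> space ?B2 \<in> sets ?B2" using A by auto
  qed simp
  note T\<gamma> = prob_on_measurable_restrict[OF \<gamma> T]
  define \<gamma>' where "\<gamma>' = distr \<gamma> ?B2 T"
  have \<gamma>': "\<gamma>' \<in> plans" unfolding \<gamma>'_def by (rule distr_in_prob_on[OF prob_onD(1)[OF \<gamma>] T\<gamma>])
  have m: "marg1 \<gamma>' = \<mu>"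
    unfolding \<gamma>'_def distr_distr[OF projections_measurable(1) T\<gamma>]
    by (rule distr_cong) (auto simp: T_def)
  have split: "cost R / 2 + 2 * (\<integral>z. potential \<nu> z \<partial>marg2 R) = (\<integral>p. second_cost (fst p) (snd p) \<partial>R)" if R: "R \<in> plans" for R
  proof -
    have pm: "potential \<nu> \<in> borel_measurable borel\<Omega>"
      by (rule borel_measurable_continuous_on_restrict[OF potential_continuous[OF \<nu>]])
    have "continuous_on (\<Omega> \<times> \<Omega>) (\<lambda>p. potential \<nu> (snd p))"
      by (rule continuous_on_compose2[OF potential_continuous[OF \<nu>]]) (auto intro!: continuous_intros)
    from prob_on_integrable_continuous[OF R compact2 this] prob_on_integrable_continuous[OF R compact2 cost_continuous]
    show ?thesis unfolding second_cost_def cost_def integral_distr[OF plan_projections(2)[OF R] pm] by simp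
  qed
  have i1: "integrable \<gamma> (\<lambda>p. second_cost (fst p) (snd p))" by (rule prob_on_integrable_continuous[OF \<gamma> compact2 c1])
  have i2: "integrable \<gamma> (\<lambda>p. second_cost (fst p) z)" by (rule prob_on_integrable_continuous[OF \<gamma> compact2 c2])
  have AM: "A \<in> sets \<gamma>" using A prob_onD(2)[OF \<gamma>] by simp
  let ?d = "\<lambda>p. indicator A p * (second_cost (fst p) (snd p) - second_cost (fst p) z)"
  have id: "integrable \<gamma> ?d" using integrable_mult_indicator[OF AM Bochner_Integration.integrable_diff[OF i1 i2]] by simp
  have "(\<integral>p. second_cost (fst p) (snd p) \<partial>\<gamma>) \<le> (\<integral>p. second_cost (fst p) (snd p) \<partial>\<gamma>')"
    using second_marginal_variation[OF \<gamma>' m] unfolding split[OF \<gamma>] split[OF \<gamma>'] .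
  also have "\<dots> = (\<integral>p. second_cost (fst (T p)) (snd (T p)) \<partial>\<gamma>)"
    unfolding \<gamma>'_def by (rule integral_distr[OF T\<gamma> m1])
  also have "\<dots> = (\<integral>p. second_cost (fst p) (snd p) - ?d p \<partial>\<gamma>)"
    by (rule Bochner_Integration.integral_cong) (auto simp: T_def)
  also have "\<dots> = (\<integral>p. second_cost (fst p) (snd p) \<partial>\<gamma>) - (\<integral>p. ?d p \<partial>\<gamma>)" by (rule Bochner_Integration.integral_diff[OF i1 id])
  finally have "(\<integral>p. ?d p \<partial>\<gamma>) \<le> 0" by simp
  moreover have nn: "0 \<le> ?d p" for p by (auto simp: A_def indicator_def)
  ultimately have "(\<integral>p. ?d p \<partial>\<gamma>) = 0" by (intro antisym integral_nonneg_AE) auto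
  then have "AE p in \<gamma>. ?d p = 0" using integral_nonneg_eq_0_iff_AE[OF id] nn by simp
  then show ?thesis using AE_space
    by eventually_elim (auto simp: A_def indicator_def prob_onD(3)[OF \<gamma>] space_restrict_space not_le[symmetric] split: if_splits)
qed

text \<open>The exceptional null set is made independent of \<open>z\<close> by a countable dense
  set of targets and continuity.\<close>

lemma second_optimality:
  "AE p in \<gamma>. \<forall>z\<in>\<Omega>. second_cost (fst p) (snd p) \<le> second_cost (fst p) z"
proof -
  obtain D where D: "countable D" "D \<subseteq> \<Omega>" "\<Omega> \<subseteq> closure D" using separable[of \<Omega>] by blast
  have "AE p in \<gamma>. \<forall>z\<in>D. second_cost (fst p) (snd p) \<le> second_cost (fst p) z"
    using D second_optimality_fixed by (subst AE_ball_countable) auto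
  then show ?thesis
  proof eventually_elim
    case (elim p)
    have c: "continuous_on \<Omega> (second_cost (fst p))"
      unfolding second_cost_def[abs_def] by (intro continuous_intros potential_continuous[OF \<nu>]) simp
    show ?case
    proof
      fix z assume z: "z \<in> \<Omega>"
      then obtain s where s: "\<And>n. s n \<in> D" "s \<longlonglongrightarrow> z" using D(3) closure_sequential by blast
      have "(\<lambda>n. second_cost (fst p) (s n)) \<longlonglongrightarrow> second_cost (fst p) z"
        by (rule continuous_on_tendsto_compose[OF c s(2) z]) (use s(1) D(2) in \<open>blast intro: always_eventually\<close>)
      then show "second_cost (fst p) (snd p) \<le> second_cost (fst p) z"
        by (rule LIMSEQ_le_const) (use elim s(1) in auto)
    qed
  qed
qed

end

section \<open>Bounded density of the second marginal\<close>

text \<open>A set inside an open set \<open>U\<close> is covered by countably many nonoverlapping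
  cubes in \<open>U\<close>, so the estimate passes from cubes to \<open>U\<close>; outer regularity
  of the Lebesgue measure then replaces \<open>U\<close> by the set itself.\<close>

lemma emeasure_le_of_cubes:
  fixes M :: "'b::euclidean_space measure"
  assumes M: "sets M = sets borel"
    and cubes: "\<And>a b s. s > 0 \<Longrightarrow> (\<And>i. i \<in> Basis \<Longrightarrow> b \<bullet> i - a \<bullet> i = s) \<Longrightarrow>
      emeasure M (cbox a b) \<le> ennreal C * emeasure lborel (cbox a b)"
    and A: "A \<in> sets borel" "bounded A"
  shows "emeasure M A \<le> ennreal C * emeasure lborel A"
proof -
  obtain R where R: "R > 0" "\<And>x. x \<in> A \<Longrightarrow> norm x \<le> R" using A(2) unfolding bounded_pos by auto
  define a b :: 'b where "a = - (R *\<^sub>R One)" and "b = R *\<^sub>R One"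
  have Acbox: "A \<subseteq> cbox a b"
  proof
    fix x assume "x \<in> A"
    then have "- R \<le> x \<bullet> i \<and> x \<bullet> i \<le> R" if "i \<in> Basis" for i using Basis_le_norm[OF that, of x] R(2)[of x] by linarith
    then show "x \<in> cbox a b" by (simp add: a_def b_def mem_box)
  qed
  have boxne: "box a b \<noteq> {}" using R by (simp add: a_def b_def box_ne_empty)
  have open_bound: "emeasure M A \<le> ennreal C * emeasure lborel U" if U: "open U" "A \<subseteq> U" for U
  proof -
    define g where "g = (\<lambda>x. if x \<in> U then U else UNIV)"
    have "gauge g" unfolding gauge_def g_def using U by auto
    then obtain \<D> where D: "countable \<D>"
      "\<And>K. K \<in> \<D> \<Longrightarrow> interior K \<noteq> {} \<and> (\<exists>c d. K = cbox c d)"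
      "pairwise (\<lambda>A B. interior A \<inter> interior B = {}) \<D>"
      "\<And>K. K \<in> \<D> \<Longrightarrow> \<exists>x \<in> A \<inter> K. K \<subseteq> g x"
      "\<And>u v. cbox u v \<in> \<D> \<Longrightarrow> \<exists>n. \<forall>i \<in> Basis. v \<bullet> i - u \<bullet> i = (b \<bullet> i - a \<bullet> i) / 2^n"
      "A \<subseteq> \<Union>\<D>"
      by (rule covering_lemma[OF Acbox boxne]) (rule that; assumption)
    \<comment> \<open>An enumeration of the cubes without repetitions, filled up with empty sets, so
      that the interiors form a disjoint family.\<close>
    define X where "X = (\<lambda>n. if n \<in> to_nat_on \<D> ` \<D> then from_nat_into \<D> n else {})"
    have X: "X n \<in> \<D> \<or> X n = {}" for n
      using D(1) by (auto simp: X_def)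
    have XD: "X (to_nat_on \<D> K) = K" if "K \<in> \<D>" for K
      using that D(1) by (simp add: X_def)
    have Xbox: "X n \<in> sets borel" "interior (X n) \<subseteq> U" "emeasure M (X n) \<le> ennreal C * emeasure lborel (interior (X n))" for n
    proof -
      consider (1) "X n \<in> \<D>" | (2) "X n = {}" using X by blast
      then have "X n \<in> sets borel \<and> interior (X n) \<subseteq> U \<and> emeasure M (X n) \<le> ennreal C * emeasure lborel (interior (X n))"
      proof cases
        case 1
        then obtain c d where cd: "X n = cbox c d" using D(2) by blast
        obtain x where "x \<in> A" "X n \<subseteq> g x" using D(4)[OF 1] by blast
        moreover have "g x = U" using U \<open>x \<in> A\<close> by (auto simp: g_def)
        ultimately have "X n \<subseteq> U" by simp
        then have s: "interior (X n) \<subseteq> U" using interior_subset by blast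
        obtain k where k: "\<And>i. i \<in> Basis \<Longrightarrow> d \<bullet> i - c \<bullet> i = (b \<bullet> i - a \<bullet> i) / 2^k" using D(5)[of c d] 1 cd by auto
        have k': "d \<bullet> i - c \<bullet> i = 2 * R / 2^k" if "i \<in> Basis" for i using k[OF that] that by (simp add: a_def b_def)
        have "emeasure M (X n) \<le> ennreal C * emeasure lborel (cbox c d)"
          unfolding cd by (rule cubes[of "2 * R / 2^k"]) (use R k' in auto)
        also have "emeasure lborel (cbox c d) = emeasure lborel (interior (X n))"
          unfolding cd interior_cbox emeasure_lborel_cbox_eq emeasure_lborel_box_eq ..
        finally show ?thesis using s cd by simp
      qed simp
      then show "X n \<in> sets borel" "interior (X n) \<subseteq> U" "emeasure M (X n) \<le> ennreal C * emeasure lborel (interior (X n))"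
        by auto
    qed
    have disj: "disjoint_family (\<lambda>n. interior (X n))"
      unfolding disjoint_family_on_def
    proof (intro ballI impI)
      fix m n :: nat assume mn: "m \<noteq> n"
      show "interior (X m) \<inter> interior (X n) = {}"
      proof (cases "m \<in> to_nat_on \<D> ` \<D> \<and> n \<in> to_nat_on \<D> ` \<D>")
        case True
        then obtain K L where KL: "K \<in> \<D>" "L \<in> \<D>" "m = to_nat_on \<D> K" "n = to_nat_on \<D> L" by auto
        then have "K \<noteq> L" using mn by auto
        then show ?thesis using XD KL pairwiseD[OF D(3) KL(1,2)] by simp
      qed (auto simp: X_def)
    qed
    have "A \<subseteq> (\<Union>n. X n)"
    proof
      fix x assume "x \<in> A"
      then obtain K where K: "K \<in> \<D>" "x \<in> K" using D(6) by blast
      then have "x \<in> X (to_nat_on \<D> K)" by (simp add: XD)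
      then show "x \<in> (\<Union>n. X n)" by blast
    qed
    then have "emeasure M A \<le> emeasure M (\<Union>n. X n)" using Xbox(1) M by (intro emeasure_mono) auto
    also have "\<dots> \<le> (\<Sum>n. emeasure M (X n))" using Xbox(1) M by (intro emeasure_subadditive_countably) auto
    also have "\<dots> \<le> (\<Sum>n. ennreal C * emeasure lborel (interior (X n)))" by (intro suminf_le Xbox(3)) auto
    also have "\<dots> = ennreal C * emeasure lborel (\<Union>n. interior (X n))"
      using suminf_emeasure[of "\<lambda>n. interior (X n)" lborel] disj by (simp add: ennreal_suminf_cmult image_subset_iff)
    also have "\<dots> \<le> ennreal C * emeasure lborel U"
      using Xbox(2) U by (intro mult_left_mono emeasure_mono) auto
    finally show ?thesis .
  qed
  have "emeasure M A \<le> ennreal C * emeasure lborel A + ennreal e" if e: "e > 0" for e :: real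
  proof -
    obtain U where U: "open U" "A \<subseteq> U" "emeasure lborel (U - A) < ennreal (e / (\<bar>C\<bar> + 1))"
    proof (rule outer_regular_lborel[OF A(1)])
      show "0 < e / (\<bar>C\<bar> + 1)" using e by simp
    qed (rule that; assumption)
    have "emeasure lborel U = emeasure lborel A + emeasure lborel (U - A)"
      using U A(1) by (subst plus_emeasure) (auto simp: Un_absorb1)
    then have le: "emeasure M A \<le> ennreal C * emeasure lborel A + ennreal C * emeasure lborel (U - A)"
      using open_bound[OF U(1,2)] by (simp only: distrib_left)
    have "ennreal C * emeasure lborel (U - A) \<le> ennreal \<bar>C\<bar> * ennreal (e / (\<bar>C\<bar> + 1))"
      using U(3) by (intro mult_mono) (auto intro: ennreal_leI)
    also have "\<dots> = ennreal (\<bar>C\<bar> * (e / (\<bar>C\<bar> + 1)))" using e by (intro ennreal_mult[symmetric]) auto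
    also have "\<dots> \<le> ennreal e" using e by (intro ennreal_leI) (simp add: field_simps)
    finally show ?thesis by (intro order_trans[OF le] add_left_mono)
  qed
  then show ?thesis by (rule ennreal_le_epsilon)
qed

context concentration begin

lemma diameter_bound: obtains D where "D > 0" "\<And>z w. z \<in> \<Omega> \<Longrightarrow> w \<in> \<Omega> \<Longrightarrow> norm (z - w) \<le> D"
proof -
  obtain R where R: "R > 0" "\<And>x. x \<in> \<Omega> \<Longrightarrow> norm x \<le> R"
    using compact_imp_bounded[OF compact] unfolding bounded_pos by auto
  show ?thesis
  proof (rule that[of "2 * R"])
    show "norm (z - w) \<le> 2 * R" if "z \<in> \<Omega>" "w \<in> \<Omega>" for z w
      using norm_triangle_ineq4[of z w] R(2)[OF that(1)] R(2)[OF that(2)] by linarith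
  qed (use R in simp)
qed

lemma V_estimates:
  assumes "T \<ge> 0"
  obtains K where "K \<ge> 0" "\<And>t. 0 \<le> t \<Longrightarrow> t \<le> T \<Longrightarrow> \<bar>V' t\<bar> \<le> K"
    "\<And>s t. 0 \<le> s \<Longrightarrow> s \<le> T \<Longrightarrow> 0 \<le> t \<Longrightarrow> t \<le> T \<Longrightarrow> \<bar>V' s - V' t\<bar> \<le> K * \<bar>s - t\<bar>"
    "\<And>s t. 0 \<le> s \<Longrightarrow> s \<le> T \<Longrightarrow> 0 \<le> t \<Longrightarrow> t \<le> T \<Longrightarrow> \<bar>V t - V s - V' s * (t - s)\<bar> \<le> K * (t - s)\<^sup>2"
proof -
  have sub: "{0..T} \<subseteq> {0..}" by auto
  obtain K1 where K1: "K1 > 0" "\<And>t. t \<in> {0..T} \<Longrightarrow> \<bar>V' t\<bar> \<le> K1"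
    by (rule compact_continuous_bounded[OF compact_Icc continuous_on_subset[OF V'_continuous sub]]) (rule that; assumption)
  obtain K2 where K2: "K2 > 0" "\<And>t. t \<in> {0..T} \<Longrightarrow> \<bar>V'' t\<bar> \<le> K2"
    by (rule compact_continuous_bounded[OF compact_Icc continuous_on_subset[OF V''_continuous sub]]) (rule that; assumption)
  have lip: "\<bar>V' s - V' t\<bar> \<le> K2 * \<bar>s - t\<bar>" if "s \<in> {0..T}" "t \<in> {0..T}" for s t
    using field_differentiable_bound[of "{0..T}" V' V'' K2 s t] that K2
      DERIV_subset[OF V'_deriv sub] by auto
  have taylor: "\<bar>V t - V s - V' s * (t - s)\<bar> \<le> K2 * (t - s)\<^sup>2" if st: "s \<in> {0..T}" "t \<in> {0..T}" for s t
  proof -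
    let ?I = "closed_segment s t"
    have I: "?I \<subseteq> {0..T}" using st by (auto simp: closed_segment_eq_real_ivl split: if_splits)
    have "norm ((V t - V' s * t) - (V s - V' s * s)) \<le> K2 * \<bar>t - s\<bar> * norm (t - s)"
    proof (rule field_differentiable_bound[where f="\<lambda>x. V x - V' s * x" and f'="\<lambda>x. V' x - V' s" and S="?I"])
      fix z assume z: "z \<in> ?I"
      then have z0: "z \<in> {0..T}" using I by blast
      have "(V has_field_derivative V' z) (at z within ?I)"
        by (rule DERIV_subset[OF V_deriv]) (use z0 order_trans[OF I sub] in auto)
      then show "((\<lambda>x. V x - V' s * x) has_field_derivative V' z - V' s) (at z within ?I)"
        by (auto intro!: derivative_eq_intros)
      have "\<bar>V' z - V' s\<bar> \<le> K2 * \<bar>z - s\<bar>" using lip z0 st by blast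
      also have "\<dots> \<le> K2 * \<bar>t - s\<bar>"
        using z K2(1) by (intro mult_left_mono) (auto simp: closed_segment_eq_real_ivl split: if_splits)
      finally show "norm (V' z - V' s) \<le> K2 * \<bar>t - s\<bar>" by simp
    qed auto
    also have "K2 * \<bar>t - s\<bar> * norm (t - s) = K2 * (t - s)\<^sup>2" by (simp add: power2_eq_square)
    also have "(V t - V' s * t) - (V s - V' s * s) = V t - V s - V' s * (t - s)" by (simp add: algebra_simps)
    finally show ?thesis by simp
  qed
  show ?thesis
  proof (rule that[of "K1 + K2"])
    show "\<bar>V' t\<bar> \<le> K1 + K2" if "0 \<le> t" "t \<le> T" for t using K1(2)[of t] K2(1) that by simp
    show "\<bar>V' s - V' t\<bar> \<le> (K1 + K2) * \<bar>s - t\<bar>" if "0 \<le> s" "s \<le> T" "0 \<le> t" "t \<le> T" for s t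
    proof -
      have "K2 * \<bar>s - t\<bar> \<le> (K1 + K2) * \<bar>s - t\<bar>" using K1(1) by (intro mult_right_mono) auto
      then show ?thesis using lip[of s t] that by simp
    qed
    show "\<bar>V t - V s - V' s * (t - s)\<bar> \<le> (K1 + K2) * (t - s)\<^sup>2" if "0 \<le> s" "s \<le> T" "0 \<le> t" "t \<le> T" for s t
    proof -
      have "K2 * (t - s)\<^sup>2 \<le> (K1 + K2) * (t - s)\<^sup>2" using K1(1) by (intro mult_right_mono) auto
      then show ?thesis using taylor[of s t] that by simp
    qed
  qed (use K1 K2 in auto)
qed

text \<open>Half the gradient of \<open>V(|y - w|\<^sup>2)\<close> with respect to
  \<open>y\<close>.\<close>

definition force :: "'a \<Rightarrow> 'a \<Rightarrow> 'a" where
  "force y w = V' ((norm (y - w))\<^sup>2) *\<^sub>R (y - w)"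

lemma force_section_continuous: "continuous_on S (force y)"
  unfolding force_def[abs_def] by (intro continuous_intros continuous_on_compose2[OF V'_continuous]) auto

definition mean_force :: "'a measure \<Rightarrow> 'a \<Rightarrow> 'a" where
  "mean_force \<nu> y = (\<integral>w. force y w \<partial>\<nu>)"

lemma force_integrable:
  assumes \<nu>: "\<nu> \<in> prob_on \<Omega>"
  shows "integrable \<nu> (force y)"
proof -
  interpret prob_space \<nu> by (rule prob_onD[OF \<nu>])
  have "bounded (force y ` \<Omega>)"
    by (intro compact_imp_bounded compact_continuous_image force_section_continuous compact)
  then obtain B where "\<And>w. w \<in> \<Omega> \<Longrightarrow> norm (force y w) \<le> B" unfolding bounded_pos by force
  then show ?thesis
    using prob_on_measurable_continuous[OF \<nu> force_section_continuous]
    by (intro integrable_const_bound[of _ B]) (auto simp: prob_onD(3)[OF \<nu>] intro!: AE_I2)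
qed

text \<open>The one-sided estimate suffices for a first variation, and it spares differentiating
  under the integral. The constant comes from \<open>|z - w|\<^sup>2 - |y - w|\<^sup>2 = 2 (y - w)
  \<bullet> (z - y) + |z - y|\<^sup>2\<close>, whose square is at most \<open>(2 D |z -
  y|)\<^sup>2\<close> with \<open>D\<close> a bound of the diameter.\<close>

lemma potential_taylor:
  assumes \<nu>: "\<nu> \<in> prob_on \<Omega>"
  obtains C where "\<And>y z. y \<in> \<Omega> \<Longrightarrow> z \<in> \<Omega> \<Longrightarrow>
    potential \<nu> z \<le> potential \<nu> y + 2 * (mean_force \<nu> y \<bullet> (z - y)) + C * (norm (z - y))\<^sup>2"
proof -
  interpret prob_space \<nu> by (rule prob_onD[OF \<nu>])
  obtain D where D: "D > 0" "\<And>z w. z \<in> \<Omega> \<Longrightarrow> w \<in> \<Omega> \<Longrightarrow> norm (z - w) \<le> D" using diameter_bound by metis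
  obtain K where K: "K \<ge> 0" "\<And>t. 0 \<le> t \<Longrightarrow> t \<le> D\<^sup>2 \<Longrightarrow> \<bar>V' t\<bar> \<le> K"
    "\<And>s t. 0 \<le> s \<Longrightarrow> s \<le> D\<^sup>2 \<Longrightarrow> 0 \<le> t \<Longrightarrow> t \<le> D\<^sup>2 \<Longrightarrow> \<bar>V t - V s - V' s * (t - s)\<bar> \<le> K * (t - s)\<^sup>2"
    by (rule V_estimates[OF zero_le_power2[of D]]) (rule that; assumption)
  define C where "C = K + K * (2 * D)\<^sup>2"
  have pointwise: "V ((norm (z - w))\<^sup>2) \<le> V ((norm (y - w))\<^sup>2) + 2 * (force y w \<bullet> (z - y)) + C * (norm (z - y))\<^sup>2"
    if y: "y \<in> \<Omega>" and z: "z \<in> \<Omega>" and w: "w \<in> \<Omega>" for y z w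
  proof -
    define a b where "a = (norm (y - w))\<^sup>2" and "b = (norm (z - w))\<^sup>2"
    have a: "0 \<le> a" "a \<le> D\<^sup>2" and b: "0 \<le> b" "b \<le> D\<^sup>2"
      unfolding a_def b_def using D(2)[OF y w] D(2)[OF z w] by (auto intro: power_mono)
    have ba: "b - a = 2 * ((y - w) \<bullet> (z - y)) + (norm (z - y))\<^sup>2"
      unfolding a_def b_def by (simp add: power2_norm_eq_inner inner_simps inner_commute algebra_simps)
    have "\<bar>b - a\<bar> \<le> 2 * D * norm (z - y)"
    proof -
      have "b - a = (norm (z - w) - norm (y - w)) * (norm (z - w) + norm (y - w))"
        unfolding a_def b_def by (simp add: power2_eq_square algebra_simps)
      moreover have "\<bar>norm (z - w) - norm (y - w)\<bar> \<le> norm (z - y)"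
        using norm_triangle_ineq3[of "z - w" "y - w"] by simp
      moreover have "\<bar>norm (z - w) + norm (y - w)\<bar> \<le> 2 * D"
        using D(2)[OF y w] D(2)[OF z w] by simp
      ultimately show ?thesis
        using mult_mono[of "\<bar>norm (z - w) - norm (y - w)\<bar>" "norm (z - y)" "\<bar>norm (z - w) + norm (y - w)\<bar>" "2 * D"]
        by (simp add: abs_mult mult.commute)
    qed
    then have "\<bar>b - a\<bar>\<^sup>2 \<le> (2 * D * norm (z - y))\<^sup>2" by (intro power_mono) auto
    then have sq: "(b - a)\<^sup>2 \<le> (2 * D)\<^sup>2 * (norm (z - y))\<^sup>2" by (simp add: power_mult_distrib)
    have "V b \<le> V a + V' a * (b - a) + K * (b - a)\<^sup>2" using K(3)[OF a b] by linarith
    also have "V' a * (b - a) = 2 * (force y w \<bullet> (z - y)) + V' a * (norm (z - y))\<^sup>2"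
      unfolding ba force_def a_def[symmetric] by (simp add: algebra_simps)
    also have "V' a * (norm (z - y))\<^sup>2 \<le> K * (norm (z - y))\<^sup>2"
      using K(2)[OF a] by (intro mult_right_mono) auto
    also have "K * (b - a)\<^sup>2 \<le> K * ((2 * D)\<^sup>2 * (norm (z - y))\<^sup>2)" using sq K(1) by (rule mult_left_mono)
    finally have "V b \<le> V a + (2 * (force y w \<bullet> (z - y)) + K * (norm (z - y))\<^sup>2) + K * ((2 * D)\<^sup>2 * (norm (z - y))\<^sup>2)"
      by simp
    then show ?thesis unfolding a_def b_def C_def by (simp add: algebra_simps)
  qed
  show ?thesis
  proof (rule that[of C])
    fix y z assume y: "y \<in> \<Omega>" and z: "z \<in> \<Omega>"
    have iV: "integrable \<nu> (\<lambda>w. V ((norm (x - w))\<^sup>2))" for x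
      by (rule prob_on_integrable_continuous[OF \<nu> compact kernel_section_continuous])
    have iF: "integrable \<nu> (\<lambda>w. force y w \<bullet> (z - y))" using force_integrable[OF \<nu>] by simp
    have "potential \<nu> z \<le> (\<integral>w. V ((norm (y - w))\<^sup>2) + 2 * (force y w \<bullet> (z - y)) + C * (norm (z - y))\<^sup>2 \<partial>\<nu>)"
      unfolding potential_def
      by (rule integral_mono[OF iV]) (use iV iF pointwise[OF y z] in \<open>auto simp: prob_onD(3)[OF \<nu>]\<close>)
    also have "\<dots> = potential \<nu> y + 2 * (mean_force \<nu> y \<bullet> (z - y)) + C * (norm (z - y))\<^sup>2"
      unfolding potential_def mean_force_def using iV iF force_integrable[OF \<nu>] by (simp add: prob_space)
    finally show "potential \<nu> z \<le> potential \<nu> y + 2 * (mean_force \<nu> y \<bullet> (z - y)) + C * (norm (z - y))\<^sup>2" .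
  qed
qed

lemma mean_force_lipschitz:
  assumes \<nu>: "\<nu> \<in> prob_on \<Omega>"
  obtains \<Lambda> where "\<Lambda> \<ge> 0" "\<And>y z. y \<in> \<Omega> \<Longrightarrow> z \<in> \<Omega> \<Longrightarrow> norm (mean_force \<nu> y - mean_force \<nu> z) \<le> \<Lambda> * norm (y - z)"
proof -
  interpret prob_space \<nu> by (rule prob_onD[OF \<nu>])
  obtain D where D: "D > 0" "\<And>z w. z \<in> \<Omega> \<Longrightarrow> w \<in> \<Omega> \<Longrightarrow> norm (z - w) \<le> D" using diameter_bound by metis
  obtain K where K: "K \<ge> 0" "\<And>t. 0 \<le> t \<Longrightarrow> t \<le> D\<^sup>2 \<Longrightarrow> \<bar>V' t\<bar> \<le> K"
    "\<And>s t. 0 \<le> s \<Longrightarrow> s \<le> D\<^sup>2 \<Longrightarrow> 0 \<le> t \<Longrightarrow> t \<le> D\<^sup>2 \<Longrightarrow> \<bar>V' s - V' t\<bar> \<le> K * \<bar>s - t\<bar>"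
    by (rule V_estimates[OF zero_le_power2[of D]]) (rule that; assumption)
  define \<Lambda> where "\<Lambda> = K + K * (2 * D) * D"
  have pointwise: "norm (force y w - force z w) \<le> \<Lambda> * norm (y - z)" if y: "y \<in> \<Omega>" and z: "z \<in> \<Omega>" and w: "w \<in> \<Omega>" for y z w
  proof -
    define a b where "a = (norm (y - w))\<^sup>2" and "b = (norm (z - w))\<^sup>2"
    have a: "0 \<le> a" "a \<le> D\<^sup>2" and b: "0 \<le> b" "b \<le> D\<^sup>2"
      unfolding a_def b_def using D(2)[OF y w] D(2)[OF z w] by (auto intro: power_mono)
    have "a - b = (norm (y - w) - norm (z - w)) * (norm (y - w) + norm (z - w))"
      unfolding a_def b_def by (simp add: power2_eq_square algebra_simps)
    moreover have "\<bar>norm (y - w) - norm (z - w)\<bar> \<le> norm (y - z)"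
      using norm_triangle_ineq3[of "y - w" "z - w"] by simp
    moreover have "\<bar>norm (y - w) + norm (z - w)\<bar> \<le> 2 * D"
      using D(2)[OF y w] D(2)[OF z w] by simp
    ultimately have ab: "\<bar>a - b\<bar> \<le> norm (y - z) * (2 * D)"
      by (simp only: abs_mult) (intro mult_mono, auto)
    have "force y w - force z w = V' a *\<^sub>R (y - z) + (V' a - V' b) *\<^sub>R (z - w)"
      unfolding force_def a_def b_def by (simp add: algebra_simps)
    then have "norm (force y w - force z w) \<le> \<bar>V' a\<bar> * norm (y - z) + \<bar>V' a - V' b\<bar> * norm (z - w)"
      using norm_triangle_ineq[of "V' a *\<^sub>R (y - z)" "(V' a - V' b) *\<^sub>R (z - w)"] by simp
    also have "\<bar>V' a\<bar> * norm (y - z) \<le> K * norm (y - z)" using K(2)[OF a] by (intro mult_right_mono) auto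
    also have "\<bar>V' a - V' b\<bar> * norm (z - w) \<le> (K * (norm (y - z) * (2 * D))) * D"
    proof (rule mult_mono)
      have "\<bar>V' a - V' b\<bar> \<le> K * \<bar>a - b\<bar>" by (rule K(3)[OF a b])
      also have "\<dots> \<le> K * (norm (y - z) * (2 * D))" using ab K(1) by (rule mult_left_mono)
      finally show "\<bar>V' a - V' b\<bar> \<le> K * (norm (y - z) * (2 * D))" .
    qed (use D(1) D(2)[OF z w] K(1) in auto)
    finally show ?thesis by (simp add: \<Lambda>_def algebra_simps)
  qed
  show ?thesis
  proof (rule that[of \<Lambda>])
    show "\<Lambda> \<ge> 0" using K(1) D(1) by (simp add: \<Lambda>_def)
    fix y z assume y: "y \<in> \<Omega>" and z: "z \<in> \<Omega>"
    have i: "integrable \<nu> (\<lambda>w. force y w - force z w)" using force_integrable[OF \<nu>] by simp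
    have "norm (mean_force \<nu> y - mean_force \<nu> z) = norm (\<integral>w. force y w - force z w \<partial>\<nu>)"
      unfolding mean_force_def using force_integrable[OF \<nu>] by simp
    also have "\<dots> \<le> (\<integral>w. norm (force y w - force z w) \<partial>\<nu>)" by (rule integral_norm_bound)
    also have "\<dots> \<le> (\<integral>w. \<Lambda> * norm (y - z) \<partial>\<nu>)"
      by (rule integral_mono) (use i pointwise[OF y z] in \<open>auto simp: prob_onD(3)[OF \<nu>]\<close>)
    also have "\<dots> = \<Lambda> * norm (y - z)" by (simp add: prob_space)
    finally show "norm (mean_force \<nu> y - mean_force \<nu> z) \<le> \<Lambda> * norm (y - z)" .
  qed
qed

end

context energy_minimizer begin

text \<open>The first order condition on the convex set \<open>\<Omega>\<close> only says that the
  gradient \<open>g\<close> of the second cost at \<open>y\<close> satisfies \<open>g \<bullet> (z -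
  y) \<ge> 0\<close> for all \<open>z\<close> in \<open>\<Omega>\<close>. But \<open>g = (y - x) + 4
  \<integral> V'(|y - w|\<^sup>2) (y - w) d\<nu>(w)\<close> with \<open>x\<close> and all
  \<open>w\<close> in \<open>\<Omega>\<close> and with \<open>V' > 0\<close>, so pairing
  \<open>g\<close> with itself gives \<open>g \<bullet> g \<le> 0\<close>. This excludes a boundary
  effect.\<close>

lemma transport_relation:
  "AE p in \<gamma>. fst p = snd p + 4 *\<^sub>R mean_force \<nu> (snd p)"
  using second_optimality AE_space
proof eventually_elim
  case (elim p)
  define x y where "x = fst p" and "y = snd p"
  have xy: "x \<in> \<Omega>" "y \<in> \<Omega>" using elim prob_onD(3)[OF \<gamma>] by (auto simp: x_def y_def)
  have opt: "second_cost x y \<le> second_cost x z" if "z \<in> \<Omega>" for z using elim that by (simp add: x_def y_def)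
  obtain C where C: "\<And>y z. y \<in> \<Omega> \<Longrightarrow> z \<in> \<Omega> \<Longrightarrow>
    potential \<nu> z \<le> potential \<nu> y + 2 * (mean_force \<nu> y \<bullet> (z - y)) + C * (norm (z - y))\<^sup>2"
    using potential_taylor[OF \<nu>] by metis
  \<comment> \<open>The gradient of the second cost at \<open>y\<close>; the claim is that it
    vanishes.\<close>
  define g where "g = y + 4 *\<^sub>R mean_force \<nu> y - x"
  have normal: "0 \<le> g \<bullet> (z - y)" if z: "z \<in> \<Omega>" for z
  proof (rule first_order_nonneg)
    fix \<epsilon> :: real assume e: "0 < \<epsilon>" "\<epsilon> < 1"
    define z' where "z' = y + \<epsilon> *\<^sub>R (z - y)"
    have "z' = (1 - \<epsilon>) *\<^sub>R y + \<epsilon> *\<^sub>R z" by (simp add: z'_def algebra_simps)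
    then have z': "z' \<in> \<Omega>" using convexD[OF convex xy(2) z, of "1 - \<epsilon>" \<epsilon>] e by simp
    have d: "z' - y = \<epsilon> *\<^sub>R (z - y)" by (simp add: z'_def)
    have "(norm (x - z'))\<^sup>2 = (norm (x - y))\<^sup>2 + 2 * \<epsilon> * ((y - x) \<bullet> (z - y)) + \<epsilon>\<^sup>2 * (norm (z - y))\<^sup>2"
      unfolding z'_def power2_norm_eq_inner by (simp add: inner_simps inner_commute algebra_simps power2_eq_square)
    moreover have "potential \<nu> z' \<le> potential \<nu> y + 2 * \<epsilon> * (mean_force \<nu> y \<bullet> (z - y)) + C * (\<epsilon>\<^sup>2 * (norm (z - y))\<^sup>2)"
      using C[OF xy(2) z'] unfolding d by (simp add: power_mult_distrib)
    ultimately show "0 \<le> \<epsilon> * (g \<bullet> (z - y)) + \<epsilon>\<^sup>2 * ((1/2 + 2 * C) * (norm (z - y))\<^sup>2)"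
      using opt[OF z'] unfolding second_cost_def g_def
      by (simp add: inner_simps algebra_simps)
  qed
  have "g \<bullet> g = - (g \<bullet> (x - y)) + 4 * (g \<bullet> mean_force \<nu> y)"
    by (simp add: g_def inner_simps algebra_simps)
  moreover have "g \<bullet> mean_force \<nu> y \<le> 0"
  proof -
    have "g \<bullet> mean_force \<nu> y = (\<integral>w. g \<bullet> force y w \<partial>\<nu>)"
      unfolding mean_force_def using force_integrable[OF \<nu>] by simp
    also have "\<dots> \<le> (\<integral>w. 0 \<partial>\<nu>)"
    proof (rule integral_mono)
      fix w assume "w \<in> space \<nu>"
      then have "0 \<le> g \<bullet> (w - y)" using normal by (simp add: space_restrict_space)
      then have "g \<bullet> (y - w) \<le> 0" by (simp add: inner_simps)
      then show "g \<bullet> force y w \<le> 0"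
        using V'_pos[of "(norm (y - w))\<^sup>2"] by (simp add: force_def mult_nonneg_nonpos less_imp_le)
    qed (use force_integrable[OF \<nu>] in auto)
    finally show ?thesis by simp
  qed
  ultimately have "g \<bullet> g \<le> 0" using normal[OF xy(1)] by linarith
  then have "g = 0" by (metis inner_eq_zero_iff inner_ge_zero order_antisym)
  then show ?case by (simp add: g_def x_def y_def)
qed

text \<open>If \<open>y\<close> ranges over a cube of side \<open>s\<close>, then \<open>x = S
  y\<close> ranges over a cube of side \<open>2 k s\<close>, so the second marginal of the small
  cube is at most the first marginal of the large one.\<close>

lemma second_marginal_bounded_density:
  assumes U: "AE x in leb. u x \<le> U"
  obtains v C where "lebesgue_density \<Omega> \<nu> v" "AE x in leb. \<bar>v x\<bar> \<le> C"
proof -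
  interpret n: prob_space \<nu> by (rule prob_onD[OF \<nu>])
  obtain \<Lambda> where L: "\<Lambda> \<ge> 0" "\<And>y z. y \<in> \<Omega> \<Longrightarrow> z \<in> \<Omega> \<Longrightarrow> norm (mean_force \<nu> y - mean_force \<nu> z) \<le> \<Lambda> * norm (y - z)"
    using mean_force_lipschitz[OF \<nu>] by metis
  define S where "S = (\<lambda>y. y + 4 *\<^sub>R mean_force \<nu> y)"
  \<comment> \<open>The factor \<open>DIM('a)\<close> compares the Euclidean norm with the side
    length of a cube.\<close>
  define k where "k = (1 + 4 * \<Lambda>) * real DIM('a)"
  have k: "k > 0" using L(1) by (simp add: k_def)
  define U' where "U' = max U 0"
  define C where "C = U' * (2 * k) ^ DIM('a)"
  have C0: "C \<ge> 0" using k by (simp add: C_def U'_def)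
  have S: "norm (S y - S z) \<le> (1 + 4 * \<Lambda>) * norm (y - z)" if "y \<in> \<Omega>" "z \<in> \<Omega>" for y z
  proof -
    have "norm (S y - S z) = norm ((y - z) + 4 *\<^sub>R (mean_force \<nu> y - mean_force \<nu> z))"
      by (simp add: S_def algebra_simps)
    also have "\<dots> \<le> norm (y - z) + 4 * norm (mean_force \<nu> y - mean_force \<nu> z)"
      using norm_triangle_ineq[of "y - z" "4 *\<^sub>R (mean_force \<nu> y - mean_force \<nu> z)"] by simp
    also have "\<dots> \<le> norm (y - z) + 4 * (\<Lambda> * norm (y - z))" using L(2)[OF that] by simp
    finally show ?thesis by (simp add: algebra_simps)
  qed
  let ?M = "distr \<nu> borel (\<lambda>x. x)"
  have id: "(\<lambda>x. x) \<in> borel_measurable \<nu>" by (rule prob_on_measurable[OF \<nu>]) simp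
  have eM: "emeasure ?M A = emeasure \<nu> (A \<inter> \<Omega>)" if "A \<in> sets borel" for A
    using that by (subst emeasure_distr[OF id]) (auto simp: prob_onD(3)[OF \<nu>])
  have cube: "emeasure ?M (cbox a b) \<le> ennreal C * emeasure lborel (cbox a b)"
    if s: "s > 0" and ab: "\<And>i. i \<in> Basis \<Longrightarrow> b \<bullet> i - a \<bullet> i = s" for a b :: 'a and s
  proof (cases "cbox a b \<inter> \<Omega> = {}")
    case True
    then show ?thesis by (simp add: eM)
  next
    case False
    then obtain y0 where y0: "y0 \<in> cbox a b" "y0 \<in> \<Omega>" by blast
    define Q where "Q = cbox (S y0 - (k * s) *\<^sub>R One) (S y0 + (k * s) *\<^sub>R One)"
    have SQ: "S y \<in> Q" if y: "y \<in> cbox a b" "y \<in> \<Omega>" for y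
    proof -
      have "norm (y - y0) \<le> (\<Sum>i\<in>Basis. \<bar>(y - y0) \<bullet> i\<bar>)" by (rule norm_le_l1)
      also have "\<dots> \<le> (\<Sum>i\<in>(Basis :: 'a set). s)"
      proof (rule sum_mono)
        fix i :: 'a assume i: "i \<in> Basis"
        then have "a \<bullet> i \<le> y \<bullet> i" "y \<bullet> i \<le> b \<bullet> i" "a \<bullet> i \<le> y0 \<bullet> i" "y0 \<bullet> i \<le> b \<bullet> i"
          using y y0 by (auto simp: mem_box)
        then show "\<bar>(y - y0) \<bullet> i\<bar> \<le> s" using ab[OF i] unfolding inner_diff_left by linarith
      qed
      also have "\<dots> = real DIM('a) * s" by simp
      finally have "(1 + 4 * \<Lambda>) * norm (y - y0) \<le> (1 + 4 * \<Lambda>) * (real DIM('a) * s)"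
        using L(1) by (intro mult_left_mono) auto
      then have "norm (S y - S y0) \<le> k * s" using S[OF y(2) y0(2)] by (simp add: k_def)
      then have *: "\<bar>S y \<bullet> i - S y0 \<bullet> i\<bar> \<le> k * s" if "i \<in> Basis" for i
        using Basis_le_norm[OF that, of "S y - S y0"] by (simp add: inner_diff_left)
      show ?thesis unfolding Q_def mem_box
      proof
        fix i :: 'a assume i: "i \<in> Basis"
        have "((k * s) *\<^sub>R One :: 'a) \<bullet> i = k * s" using i by simp
        then show "(S y0 - (k * s) *\<^sub>R One) \<bullet> i \<le> S y \<bullet> i \<and> S y \<bullet> i \<le> (S y0 + (k * s) *\<^sub>R One) \<bullet> i"
          unfolding inner_diff_left inner_add_left using *[OF i] by linarith
      qed
    qed
    have Qm: "Q \<inter> \<Omega> \<in> sets borel\<Omega>" by (auto simp: Q_def sets_restrict_space_iff)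
    have abm: "cbox a b \<inter> \<Omega> \<in> sets borel\<Omega>" by (auto simp: sets_restrict_space_iff)
    have "emeasure \<nu> (cbox a b \<inter> \<Omega>) = emeasure \<gamma> (snd -` (cbox a b \<inter> \<Omega>) \<inter> space \<gamma>)"
      by (rule emeasure_distr[OF plan_projections(2)[OF \<gamma>] abm])
    also have "\<dots> \<le> emeasure \<gamma> (fst -` (Q \<inter> \<Omega>) \<inter> space \<gamma>)"
    proof (rule emeasure_mono_AE)
      show "fst -` (Q \<inter> \<Omega>) \<inter> space \<gamma> \<in> sets \<gamma>" by (rule measurable_sets[OF plan_projections(1)[OF \<gamma>] Qm])
      show "AE p in \<gamma>. p \<in> snd -` (cbox a b \<inter> \<Omega>) \<inter> space \<gamma> \<longrightarrow> p \<in> fst -` (Q \<inter> \<Omega>) \<inter> space \<gamma>"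
        using transport_relation AE_space
      proof eventually_elim
        case (elim p)
        have fs: "fst p = S (snd p)" unfolding S_def by (rule elim(1))
        show ?case
        proof
          assume p: "p \<in> snd -` (cbox a b \<inter> \<Omega>) \<inter> space \<gamma>"
          have "fst p \<in> Q" unfolding fs by (rule SQ) (use p in simp_all)
          moreover have "fst p \<in> \<Omega>" using elim(2) prob_onD(3)[OF \<gamma>] by (simp add: mem_Times_iff)
          ultimately show "p \<in> fst -` (Q \<inter> \<Omega>) \<inter> space \<gamma>" using elim(2) by simp
        qed
      qed
    qed
    also have "\<dots> = emeasure \<mu> (Q \<inter> \<Omega>)"
      by (rule emeasure_distr[OF plan_projections(1)[OF \<gamma>] Qm, symmetric])
    also have "\<dots> = (\<integral>\<^sup>+x. ennreal (u x) * indicator (Q \<inter> \<Omega>) x \<partial>leb)"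
    proof -
      have d: "\<mu> = density leb (\<lambda>x. ennreal (u x))" using u by (simp add: lebesgue_density_def)
      show ?thesis unfolding d using density_measurable(1)[OF u] Qm sets_leb by (intro emeasure_density) auto
    qed
    also have "\<dots> \<le> (\<integral>\<^sup>+x. ennreal U' * indicator (Q \<inter> \<Omega>) x \<partial>leb)"
    proof (rule nn_integral_mono_AE)
      show "AE x in leb. ennreal (u x) * indicator (Q \<inter> \<Omega>) x \<le> ennreal U' * indicator (Q \<inter> \<Omega>) x"
        using U
      proof eventually_elim
        case (elim x)
        then have "u x \<le> U'" by (simp add: U'_def)
        then show ?case by (intro mult_right_mono ennreal_leI) auto
      qed
    qed
    also have "\<dots> = ennreal U' * emeasure leb (Q \<inter> \<Omega>)"
      using Qm sets_leb by (intro nn_integral_cmult_indicator) auto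
    also have "\<dots> \<le> ennreal U' * emeasure lborel Q"
    proof (rule mult_left_mono)
      have "emeasure leb (Q \<inter> \<Omega>) = emeasure lborel (Q \<inter> \<Omega>)" by (rule emeasure_restrict_space) auto
      also have "\<dots> \<le> emeasure lborel Q" by (rule emeasure_mono) (auto simp: Q_def)
      finally show "emeasure leb (Q \<inter> \<Omega>) \<le> emeasure lborel Q" .
    qed simp
    also have "emeasure lborel Q = ennreal ((2 * (k * s)) ^ DIM('a))"
    proof -
      have One: "((k * s) *\<^sub>R One :: 'a) \<bullet> i = k * s" if "i \<in> Basis" for i using that by simp
      have ks: "k * s \<ge> 0" using k s by simp
      have "emeasure lborel Q = ennreal (\<Prod>i\<in>Basis. ((S y0 + (k * s) *\<^sub>R One) - (S y0 - (k * s) *\<^sub>R One)) \<bullet> i)"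
        unfolding Q_def
      proof (rule emeasure_lborel_cbox)
        fix i :: 'a assume "i \<in> Basis"
        from One[OF this] show "(S y0 - (k * s) *\<^sub>R One) \<bullet> i \<le> (S y0 + (k * s) *\<^sub>R One) \<bullet> i"
          unfolding inner_diff_left inner_add_left using ks by linarith
      qed
      also have "(\<Prod>i\<in>Basis. ((S y0 + (k * s) *\<^sub>R One) - (S y0 - (k * s) *\<^sub>R One)) \<bullet> i) = (\<Prod>i\<in>(Basis::'a set). 2 * (k * s))"
      proof (rule prod.cong[OF refl])
        fix i :: 'a assume "i \<in> Basis"
        from One[OF this] show "((S y0 + (k * s) *\<^sub>R One) - (S y0 - (k * s) *\<^sub>R One)) \<bullet> i = 2 * (k * s)"
          unfolding inner_diff_left inner_add_left by linarith
      qed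
      finally show ?thesis by simp
    qed
    also have "ennreal U' * ennreal ((2 * (k * s)) ^ DIM('a)) = ennreal C * ennreal (s ^ DIM('a))"
    proof -
      have "U' * (2 * (k * s)) ^ DIM('a) = C * s ^ DIM('a)" by (simp add: C_def power_mult_distrib)
      moreover have "0 \<le> (2 * (k * s)) ^ DIM('a)" "0 \<le> s ^ DIM('a)" "0 \<le> U'" using k s by (auto simp: U'_def)
      ultimately show ?thesis using C0 ennreal_mult[of U' "(2 * (k * s)) ^ DIM('a)"] ennreal_mult[of C "s ^ DIM('a)"] by simp
    qed
    also have "ennreal (s ^ DIM('a)) = emeasure lborel (cbox a b)"
    proof -
      have le: "a \<bullet> i \<le> b \<bullet> i" if "i \<in> Basis" for i using ab[OF that] s by linarith
      have "emeasure lborel (cbox a b) = ennreal (\<Prod>i\<in>Basis. (b - a) \<bullet> i)" by (rule emeasure_lborel_cbox[OF le])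
      also have "(\<Prod>i\<in>Basis. (b - a) \<bullet> i) = (\<Prod>i\<in>(Basis::'a set). s)"
        by (rule prod.cong[OF refl]) (simp only: inner_diff_left ab)
      finally show ?thesis by simp
    qed
    finally show ?thesis by (simp add: eM)
  qed
  have bound: "emeasure \<nu> A \<le> ennreal C * emeasure leb A" if A: "A \<in> sets leb" for A
  proof -
    have Ab: "A \<in> sets borel" "A \<subseteq> \<Omega>" using A by (auto simp: sets_restrict_space_iff)
    have "emeasure ?M A \<le> ennreal C * emeasure lborel A"
      by (rule emeasure_le_of_cubes[OF _ cube Ab(1)])
         (use bounded_subset[OF compact_imp_bounded[OF compact] Ab(2)] in auto)
    then show ?thesis using Ab by (simp add: eM Int_absorb2 emeasure_restrict_space)
  qed
  have "absolutely_continuous leb \<nu>"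
    unfolding absolutely_continuous_def
  proof
    fix N assume N: "N \<in> null_sets leb"
    then have "emeasure \<nu> N \<le> 0" using bound[of N] null_setsD1[OF N] null_setsD2[OF N] by simp
    then show "N \<in> null_sets \<nu>" using N prob_onD(2)[OF \<nu>] sets_leb by (auto simp: null_sets_def)
  qed
  then obtain v where v: "lebesgue_density \<Omega> \<nu> v" using density_exists[OF \<nu>] by metis
  have "AE x in leb. x \<in> space leb \<longrightarrow> v x \<le> C"
  proof (rule density_le_on[OF v \<nu> _ sets.top])
    fix E assume E: "E \<in> sets leb"
    have "ennreal (measure \<nu> E) \<le> ennreal (C * measure leb E)"
      using bound[OF E] C0 by (simp add: n.emeasure_eq_measure leb.emeasure_eq_measure ennreal_mult)
    then have "measure \<nu> E \<le> C * measure leb E" using C0 by (simp add: ennreal_le_iff)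
    then show "measure \<nu> E \<le> (\<integral>x. C * indicator E x \<partial>leb)"
      using sets.sets_into_space[OF E] by (simp add: Int_absorb2)
  qed simp
  then have "AE x in leb. \<bar>v x\<bar> \<le> C"
    using AE_space
  proof eventually_elim
    case (elim x)
    then show ?case using density_measurable(2)[OF v, of x] by (simp add: space_leb)
  qed
  with v that show ?thesis by blast
qed

end

section \<open>Variation of the first marginal\<close>

context concentration begin

lemma density_mixture:
  assumes u: "lebesgue_density \<Omega> \<mu> u" and \<mu>: "\<mu> \<in> prob_on \<Omega>"
    and u': "lebesgue_density \<Omega> \<mu>' u'" and \<mu>': "\<mu>' \<in> prob_on \<Omega>" and \<epsilon>: "0 \<le> \<epsilon>" "\<epsilon> \<le> 1"
  shows "lebesgue_density \<Omega> (mixture \<epsilon> \<mu> \<mu>') (\<lambda>x. (1 - \<epsilon>) * u x + \<epsilon> * u' x)"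
proof -
  let ?w = "\<lambda>x. (1 - \<epsilon>) * u x + \<epsilon> * u' x"
  note Q = mixture_in_prob_on[OF \<mu> \<mu>' \<epsilon>]
  note um = density_measurable[OF u] and um' = density_measurable[OF u']
  have d: "\<mu> = density leb (\<lambda>x. ennreal (u x))" "\<mu>' = density leb (\<lambda>x. ennreal (u' x))"
    using u u' by (simp_all add: lebesgue_density_def)
  have wm: "?w \<in> borel_measurable leb" using um(1) um'(1) by simp
  have "mixture \<epsilon> \<mu> \<mu>' = density leb (\<lambda>x. ennreal (?w x))"
  proof (rule measure_eqI)
    show "sets (mixture \<epsilon> \<mu> \<mu>') = sets (density leb (\<lambda>x. ennreal (?w x)))" using prob_onD(2)[OF Q] sets_leb by simp
    fix E assume "E \<in> sets (mixture \<epsilon> \<mu> \<mu>')"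
    then have E: "E \<in> sets (mixture \<epsilon> \<mu> \<mu>')" "E \<in> sets borel\<Omega>" "E \<in> sets leb" "E \<in> sets \<mu>" "E \<in> sets \<mu>'"
      using prob_onD(2)[OF Q] prob_onD(2)[OF \<mu>] prob_onD(2)[OF \<mu>'] sets_leb by simp_all
    have e1: "emeasure \<mu> E = (\<integral>\<^sup>+x. ennreal (u x) * indicator E x \<partial>leb)"
      unfolding d by (rule emeasure_density) (use um(1) E in auto)
    have e2: "emeasure \<mu>' E = (\<integral>\<^sup>+x. ennreal (u' x) * indicator E x \<partial>leb)"
      unfolding d by (rule emeasure_density) (use um'(1) E in auto)
    have "emeasure (mixture \<epsilon> \<mu> \<mu>') E = (\<integral>\<^sup>+x. indicator E x \<partial>mixture \<epsilon> \<mu> \<mu>')" using E(1) by simp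
    also have "\<dots> = ennreal (1 - \<epsilon>) * (\<integral>\<^sup>+x. indicator E x \<partial>\<mu>) + ennreal \<epsilon> * (\<integral>\<^sup>+x. indicator E x \<partial>\<mu>')"
      by (rule nn_integral_mixture[OF \<mu> \<mu>' \<epsilon>]) (use E(2) in simp)
    also have "\<dots> = ennreal (1 - \<epsilon>) * emeasure \<mu> E + ennreal \<epsilon> * emeasure \<mu>' E" using E by simp
    also have "\<dots> = (\<integral>\<^sup>+x. ennreal (1 - \<epsilon>) * (ennreal (u x) * indicator E x) + ennreal \<epsilon> * (ennreal (u' x) * indicator E x) \<partial>leb)"
      unfolding e1 e2 using um(1) um'(1) E(3) by (simp add: nn_integral_add nn_integral_cmult)
    also have "\<dots> = (\<integral>\<^sup>+x. ennreal (?w x) * indicator E x \<partial>leb)"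
    proof (rule nn_integral_cong)
      fix x assume "x \<in> space leb"
      then have "0 \<le> u x" "0 \<le> u' x" using um(2) um'(2) by (auto simp: space_leb)
      then show "ennreal (1 - \<epsilon>) * (ennreal (u x) * indicator E x) + ennreal \<epsilon> * (ennreal (u' x) * indicator E x) = ennreal (?w x) * indicator E x"
        using \<epsilon> by (cases "x \<in> E") (simp_all add: ennreal_mult ennreal_plus)
    qed
    also have "\<dots> = emeasure (density leb (\<lambda>x. ennreal (?w x))) E"
      by (rule emeasure_density[symmetric]) (use wm E in auto)
    finally show "emeasure (mixture \<epsilon> \<mu> \<mu>') E = emeasure (density leb (\<lambda>x. ennreal (?w x))) E" .
  qed
  then show ?thesis using wm um(2) um'(2) \<epsilon> by (auto simp: lebesgue_density_def)
qed

text \<open>If \<open>\<mu>'\<close> agrees with \<open>\<mu>\<close> where \<open>u > M\<close> and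
  exceeds it by at most a multiple of the Lebesgue measure, its density \<open>u'\<close> differs
  from \<open>u\<close> only where both are bounded. The first variation of the internal energy is
  then the difference of two integrals of the bounded function \<open>f' (min u M)\<close>, since
  \<open>u' = u\<close> where the truncation acts.\<close>

lemma local_change_of_density:
  assumes u: "lebesgue_density \<Omega> \<mu> u" and \<mu>: "\<mu> \<in> prob_on \<Omega>" and \<mu>': "\<mu>' \<in> prob_on \<Omega>"
    and le: "\<And>E. E \<in> sets leb \<Longrightarrow> measure \<mu>' E \<le> measure \<mu> E + c * measure leb E"
    and same: "\<And>E. E \<in> sets leb \<Longrightarrow> E \<subseteq> {x \<in> space leb. M < u x} \<Longrightarrow> measure \<mu>' E = measure \<mu> E"
    and c0: "c > 0" and M0: "M \<ge> 0"
  obtains u' where "lebesgue_density \<Omega> \<mu>' u'" "AE x in leb. u' x = u x \<or> (u x \<le> M + c \<and> u' x \<le> M + c)"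
    "(\<integral>x. f' (u x) * (u' x - u x) \<partial>leb) = (\<integral>x. f' (min (u x) M) \<partial>\<mu>') - (\<integral>x. f' (min (u x) M) \<partial>\<mu>)"
proof -
  note um = density_measurable[OF u]
  interpret m': prob_space \<mu>' by (rule prob_onD[OF \<mu>'])
  define \<phi> where "\<phi> = (\<lambda>x. f' (min (u x) M))"
  have "absolutely_continuous leb \<mu>'"
    unfolding absolutely_continuous_def
  proof
    fix N assume N: "N \<in> null_sets leb"
    have Ns: "N \<in> sets leb" "emeasure leb N = 0" using N by (auto dest: null_setsD1 null_setsD2)
    have "measure leb N = 0" using Ns(2) by (simp add: measure_def)
    moreover have "measure \<mu> N = 0"
      unfolding density_measure[OF u \<mu> Ns(1)]
    proof (rule integral_eq_zero_AE)
      show "AE x in leb. u x * indicator N x = 0" using AE_not_in[OF N] by eventually_elim simp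
    qed
    ultimately have "measure \<mu>' N = 0" using le[OF Ns(1)] by (simp add: measure_le_0_iff)
    then have "emeasure \<mu>' N = 0" by (simp add: m'.emeasure_eq_measure)
    moreover have "N \<in> sets \<mu>'" using Ns(1) sets_leb prob_onD(2)[OF \<mu>'] by simp
    ultimately show "N \<in> null_sets \<mu>'" by (rule null_setsI)
  qed
  then obtain u' where u': "lebesgue_density \<Omega> \<mu>' u'" by (rule density_exists[OF \<mu>']) (rule that; assumption)
  have F: "{x \<in> space leb. M < u x} \<in> sets leb" "{x \<in> space leb. u x \<le> M} \<in> sets leb"
    by (rule borel_measurable_less[OF borel_measurable_const um(1)], rule borel_measurable_le[OF um(1) borel_measurable_const])
  have le1: "AE x in leb. x \<in> {x \<in> space leb. M < u x} \<longrightarrow> u' x \<le> u x"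
  proof (rule density_le_on[OF u' \<mu>' density_integrable(1)[OF u \<mu>] F(1)])
    fix E assume E: "E \<in> sets leb" "E \<subseteq> {x \<in> space leb. M < u x}"
    show "measure \<mu>' E \<le> (\<integral>x. u x * indicator E x \<partial>leb)"
      unfolding density_measure[OF u \<mu> E(1), symmetric] same[OF E] by (rule order_refl)
  qed
  have le2: "AE x in leb. x \<in> {x \<in> space leb. M < u x} \<longrightarrow> u x \<le> u' x"
  proof (rule density_le_on[OF u \<mu> density_integrable(1)[OF u' \<mu>'] F(1)])
    fix E assume E: "E \<in> sets leb" "E \<subseteq> {x \<in> space leb. M < u x}"
    show "measure \<mu> E \<le> (\<integral>x. u' x * indicator E x \<partial>leb)"
      unfolding density_measure[OF u' \<mu>' E(1), symmetric] same[OF E] by (rule order_refl)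
  qed
  have le3: "AE x in leb. x \<in> {x \<in> space leb. u x \<le> M} \<longrightarrow> u' x \<le> M + c"
  proof (rule density_le_on[OF u' \<mu>' _ F(2)])
    fix E assume E: "E \<in> sets leb" "E \<subseteq> {x \<in> space leb. u x \<le> M}"
    have iE: "integrable leb (\<lambda>x. k * indicator E x)" for k :: real
      using E(1) leb.emeasure_finite[of E] by (simp add: integrable_real_indicator less_top[symmetric])
    have "measure \<mu> E \<le> (\<integral>x. M * indicator E x \<partial>leb)"
      unfolding density_measure[OF u \<mu> E(1)]
    proof (rule integral_mono[OF _ iE])
      show "integrable leb (\<lambda>x. u x * indicator E x)"
        using integrable_mult_indicator[OF E(1) density_integrable(1)[OF u \<mu>]] by (simp add: mult.commute)
      show "u x * indicator E x \<le> M * indicator E x" for x using E(2) by (auto simp: indicator_def)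
    qed
    also have "\<dots> = M * measure leb E" using E(1) sets.sets_into_space[OF E(1)] by (simp add: Int_absorb2)
    finally have "measure \<mu>' E \<le> M * measure leb E + c * measure leb E" using le[OF E(1)] by simp
    also have "\<dots> = (\<integral>x. (M + c) * indicator E x \<partial>leb)"
      using sets.sets_into_space[OF E(1)] unfolding distrib_right[symmetric] by (simp add: Int_absorb2)
    finally show "measure \<mu>' E \<le> (\<integral>x. (M + c) * indicator E x \<partial>leb)" .
  qed simp
  have local: "AE x in leb. u' x = u x \<or> (u x \<le> M + c \<and> u' x \<le> M + c)"
    using le1 le2 le3 AE_space
  proof eventually_elim
    case (elim x)
    then show ?case using c0 by (cases "u x \<le> M") auto
  qed
  have um\<Omega>: "u \<in> borel_measurable borel\<Omega>" using um(1) by (simp only: measurable_leb_iff)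
  have \<phi>m: "\<phi> \<in> borel_measurable borel\<Omega>"
    unfolding \<phi>_def by (rule measurable_nonneg_compose[OF f'_continuous]) (use um\<Omega> um(2) M0 in \<open>auto simp: space_restrict_space\<close>)
  obtain K where K: "\<And>t. t \<in> {0..M} \<Longrightarrow> \<bar>f' t\<bar> \<le> K" by (rule f_bounds[of M]) (rule that; assumption)
  have \<phi>K: "\<bar>\<phi> x\<bar> \<le> K" if "x \<in> \<Omega>" for x unfolding \<phi>_def using um(2)[OF that] M0 by (intro K) auto
  have \<phi>int: "integrable R \<phi>" if "R \<in> prob_on \<Omega>" for R
    by (rule prob_on_integrable_bounded[OF that prob_on_measurable_restrict[OF that \<phi>m] \<phi>K])
  have deriv: "(\<integral>x. f' (u x) * (u' x - u x) \<partial>leb) = (\<integral>x. \<phi> x \<partial>\<mu>') - (\<integral>x. \<phi> x \<partial>\<mu>)"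
  proof -
    have i1: "integrable leb (\<lambda>x. u' x * \<phi> x)" using density_integral(2)[OF u' \<phi>m] \<phi>int[OF \<mu>'] by simp
    have i2: "integrable leb (\<lambda>x. u x * \<phi> x)" using density_integral(2)[OF u \<phi>m] \<phi>int[OF \<mu>] by simp
    have "(\<integral>x. f' (u x) * (u' x - u x) \<partial>leb) = (\<integral>x. u' x * \<phi> x - u x * \<phi> x \<partial>leb)"
    proof (rule integral_cong_AE)
      show "AE x in leb. f' (u x) * (u' x - u x) = u' x * \<phi> x - u x * \<phi> x"
        using le1 le2 AE_space
      proof eventually_elim
        case (elim x)
        show ?case
        proof (cases "u x \<le> M")
          case True
          then show ?thesis by (simp add: \<phi>_def algebra_simps)
        next
          case False
          then have "u' x = u x" using elim by simp
          then show ?thesis by simp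
        qed
      qed
    qed (use i1 i2 um density_measurable[OF u'] in auto)
    also have "\<dots> = (\<integral>x. u' x * \<phi> x \<partial>leb) - (\<integral>x. u x * \<phi> x \<partial>leb)" by (rule Bochner_Integration.integral_diff[OF i1 i2])
    finally show ?thesis unfolding density_integral(1)[OF u' \<phi>m] density_integral(1)[OF u \<phi>m] .
  qed
  show ?thesis using deriv unfolding \<phi>_def by (rule that[OF u' local])
qed

end

context energy_minimizer begin

text \<open>By convexity, the tangent at an intermediate density \<open>w\<close> of the segment
  from \<open>u\<close> to \<open>u'\<close> bounds the difference quotient of the internal energy
  by \<open>f' (w x) (u' x - u x)\<close>. As \<open>u\<close> and \<open>u'\<close> differ only
  where both are bounded, dominated convergence lets \<open>w\<close> tend to
  \<open>u\<close>.\<close>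

lemma first_marginal_variation:
  assumes \<gamma>': "\<gamma>' \<in> plans" and m2: "marg2 \<gamma>' = \<nu>" and u': "lebesgue_density \<Omega> (marg1 \<gamma>') u'"
    and local: "AE x in leb. u' x = u x \<or> (u x \<le> M \<and> u' x \<le> M)"
  shows "0 \<le> (cost \<gamma>' - cost \<gamma>) / 2 + (\<integral>x. f' (u x) * (u' x - u x) \<partial>leb)"
proof -
  note um = density_measurable[OF u] and um' = density_measurable[OF u']
  define \<epsilon> where "\<epsilon> = (\<lambda>n. 1 / (real n + 2))"
  have e: "0 < \<epsilon> n" "\<epsilon> n < 1" for n by (auto simp: \<epsilon>_def)
  have e': "0 \<le> \<epsilon> n" "\<epsilon> n \<le> 1" for n using e[of n] by auto
  define w where "w = (\<lambda>n x. (1 - \<epsilon> n) * u x + \<epsilon> n * u' x)"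
  have w_eq: "w n x = u x + \<epsilon> n * (u' x - u x)" for n x by (simp add: w_def algebra_simps)
  have wd: "lebesgue_density \<Omega> (marg1 (mixture (\<epsilon> n) \<gamma> \<gamma>')) (w n)" for n
    unfolding marginal_mixture(1)[OF \<gamma> \<gamma>' e'] w_def by (rule density_mixture[OF u \<mu> u' marginals_prob_on(1)[OF \<gamma>'] e'])
  note wm = density_measurable[OF wd]
  define M' where "M' = max M 0"
  obtain C where C: "C > 0" and C1: "\<And>t. t \<in> {0..M'} \<Longrightarrow> \<bar>f t\<bar> \<le> C" and C2: "\<And>t. t \<in> {0..M'} \<Longrightarrow> \<bar>f' t\<bar> \<le> C"
    by (rule f_bounds[of M']) (rule that; assumption)
  have bounds: "AE x in leb. 0 \<le> u x \<and> 0 \<le> u' x \<and>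
      (u' x = u x \<or> (u x \<in> {0..M'} \<and> u' x \<in> {0..M'} \<and> (\<forall>n. w n x \<in> {0..M'})))"
    using local AE_space
  proof eventually_elim
    case (elim x)
    have nn: "0 \<le> u x" "0 \<le> u' x" using elim(2) um(2) um'(2) by (auto simp: space_leb)
    have "w n x \<in> {0..M'}" if "u x \<le> M" "u' x \<le> M" for n
    proof -
      have "(1 - \<epsilon> n) * u x + \<epsilon> n * u' x \<le> (1 - \<epsilon> n) * M' + \<epsilon> n * M'"
        using that e'[of n] by (intro add_mono mult_left_mono) (auto simp: M'_def)
      moreover have "0 \<le> (1 - \<epsilon> n) * u x + \<epsilon> n * u' x" using nn e'[of n] by simp
      ultimately show ?thesis unfolding w_def by (simp add: algebra_simps)
    qed
    then show ?case using elim(1) nn by (auto simp: M'_def)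
  qed
  have id: "integrable leb (\<lambda>x. f (w n x) - f (u x))" for n
  proof (rule leb.integrable_const_bound[of _ "C + C"])
    show "AE x in leb. norm (f (w n x) - f (u x)) \<le> C + C"
      using bounds
    proof eventually_elim
      case (elim x)
      show ?case
      proof (cases "u' x = u x")
        case False
        then have "\<bar>f (w n x)\<bar> \<le> C" "\<bar>f (u x)\<bar> \<le> C" using elim C1 by auto
        then show ?thesis by simp
      qed (use C in \<open>simp add: w_eq\<close>)
    qed
  qed (use wm um in simp)
  have iw: "integrable leb (\<lambda>x. f (w n x))" for n
    using Bochner_Integration.integrable_add[OF id fu, of n] by simp
  have gb: "AE x in leb. norm (f' (w n x) * (u' x - u x)) \<le> C * M'" for n
    using bounds
  proof eventually_elim
    case (elim x)
    show ?case
    proof (cases "u' x = u x")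
      case False
      then have "\<bar>f' (w n x)\<bar> \<le> C" "\<bar>u' x - u x\<bar> \<le> M'" using elim C2 by auto
      then show ?thesis using C by (simp add: abs_mult mult_mono)
    qed (use C in \<open>simp add: M'_def\<close>)
  qed
  have ig: "integrable leb (\<lambda>x. f' (w n x) * (u' x - u x))" for n
    by (rule leb.integrable_const_bound[OF gb]) (use wm um um' in simp)
  have step: "0 \<le> (cost \<gamma>' - cost \<gamma>) / 2 + (\<integral>x. f' (w n x) * (u' x - u x) \<partial>leb)" for n
  proof -
    let ?Q = "mixture (\<epsilon> n) \<gamma> \<gamma>'"
    have "admissible ?Q (w n)" unfolding admissible_def using wd iw mixture_in_prob_on[OF \<gamma> \<gamma>' e'] by simp
    from energy_minimal[OF this]
    have "cost \<gamma> / 2 + (\<integral>x. f (u x) \<partial>leb) \<le> cost ?Q / 2 + (\<integral>x. f (w n x) \<partial>leb)"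
      unfolding energy_def marginal_mixture(2)[OF \<gamma> \<gamma>' e'] m2 mixture_self[OF \<nu> e'] by simp
    then have *: "0 \<le> \<epsilon> n * ((cost \<gamma>' - cost \<gamma>) / 2) + (\<integral>x. f (w n x) - f (u x) \<partial>leb)"
      unfolding cost_mixture[OF \<gamma> \<gamma>' e'] Bochner_Integration.integral_diff[OF iw fu] by (simp add: algebra_simps add_divide_distrib diff_divide_distrib)
    have **: "(\<integral>x. f (w n x) - f (u x) \<partial>leb) \<le> (\<integral>x. \<epsilon> n * (f' (w n x) * (u' x - u x)) \<partial>leb)"
    proof (rule integral_mono)
      fix x assume x: "x \<in> space leb"
      then have "0 \<le> w n x" "0 \<le> u x" using wm(2) um(2) by (auto simp: space_leb)
      from f_tangent[OF this] have "f (w n x) + f' (w n x) * (u x - w n x) \<le> f (u x)" .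
      then show "f (w n x) - f (u x) \<le> \<epsilon> n * (f' (w n x) * (u' x - u x))" by (simp add: w_eq algebra_simps)
    qed (use id ig in simp_all)
    have "0 \<le> \<epsilon> n * ((cost \<gamma>' - cost \<gamma>) / 2 + (\<integral>x. f' (w n x) * (u' x - u x) \<partial>leb))"
      using order_trans[OF * add_left_mono[OF **]] unfolding integral_mult_right_zero distrib_left .
    then show ?thesis using e[of n] by (simp add: zero_le_mult_iff)
  qed
  have "(\<lambda>n. \<integral>x. f' (w n x) * (u' x - u x) \<partial>leb) \<longlonglongrightarrow> (\<integral>x. f' (u x) * (u' x - u x) \<partial>leb)"
  proof (rule integral_dominated_convergence[where w="\<lambda>_. C * M'"])
    show "AE x in leb. (\<lambda>n. f' (w n x) * (u' x - u x)) \<longlonglongrightarrow> f' (u x) * (u' x - u x)"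
    proof (rule AE_I2)
      fix x assume x: "x \<in> space leb"
      have "\<epsilon> \<longlonglongrightarrow> 0" unfolding \<epsilon>_def by real_asymp
      then have "(\<lambda>n. w n x) \<longlonglongrightarrow> u x + 0 * (u' x - u x)" unfolding w_eq by (intro tendsto_intros)
      then have wl: "(\<lambda>n. w n x) \<longlonglongrightarrow> u x" by simp
      have "(\<lambda>n. f' (w n x)) \<longlonglongrightarrow> f' (u x)"
        by (rule continuous_on_tendsto_compose[OF f'_continuous wl]) (use x wm(2) um(2) in \<open>auto simp: space_leb\<close>)
      then show "(\<lambda>n. f' (w n x) * (u' x - u x)) \<longlonglongrightarrow> f' (u x) * (u' x - u x)" by (intro tendsto_intros)
    qed
    show "AE x in leb. norm (f' (w n x) * (u' x - u x)) \<le> C * M'" for n by (rule gb)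
  qed (use wm um um' in simp_all)
  then have "(\<lambda>n. (cost \<gamma>' - cost \<gamma>) / 2 + (\<integral>x. f' (w n x) * (u' x - u x) \<partial>leb)) \<longlonglongrightarrow> (cost \<gamma>' - cost \<gamma>) / 2 + (\<integral>x. f' (u x) * (u' x - u x) \<partial>leb)"
    by (intro tendsto_intros)
  then show ?thesis by (rule LIMSEQ_le_const) (use step in auto)
qed

text \<open>The competitor replaces the first coordinate of a pair in \<open>A\<close> by an
  independent uniformly distributed point of \<open>B\<close>. This keeps the second marginal,
  changes the density of the first marginal only where it is at most \<open>M\<close>, and by the
  hypothesis on \<open>A \<times> B\<close> decreases the energy to first order unless
  \<open>A\<close> is null. A genuine point mass as new first coordinate would have infinite
  internal energy, hence the spreading over \<open>B\<close>.\<close>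

lemma first_exchange:
  assumes A: "A \<in> sets (restrict_space borel (\<Omega> \<times> \<Omega>))" and B: "B \<in> sets borel\<Omega>" "measure leb B > 0"
    and AM: "\<And>p. p \<in> A \<Longrightarrow> u (fst p) \<le> M" and BM: "\<And>x. x \<in> B \<Longrightarrow> u x \<le> M"
    and gain: "\<And>p x. p \<in> A \<Longrightarrow> x \<in> B \<Longrightarrow>
      (norm (x - snd p))\<^sup>2 / 2 + f' (u x) < (norm (fst p - snd p))\<^sup>2 / 2 + f' (u (fst p))"
  shows "AE p in \<gamma>. p \<notin> A"
proof -
  let ?B2 = "restrict_space borel (\<Omega> \<times> \<Omega>) :: ('a \<times> 'a) measure"
  note um = density_measurable[OF u]
  interpret g: prob_space \<gamma> by (rule prob_onD[OF \<gamma>])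
  have B\<Omega>: "B \<subseteq> \<Omega>" using B(1) by (auto simp: sets_restrict_space)
  have Bl: "B \<in> sets leb" using B(1) sets_leb by simp
  have "B \<noteq> {}" using B(2) by auto
  then have M0: "M \<ge> 0" using BM um(2) B\<Omega> by force
  define c where "c = 1 / measure leb B"
  have c0: "c > 0" using B(2) by (simp add: c_def)
  define \<beta> where "\<beta> = uniform_measure leb B"
  have e\<beta>: "emeasure leb B \<noteq> 0" "emeasure leb B \<noteq> \<infinity>" using B(2) by (auto simp: leb.emeasure_eq_measure)
  interpret \<beta>: prob_space \<beta> unfolding \<beta>_def by (rule prob_space_uniform_measure[OF e\<beta>])
  have s\<beta>: "sets \<beta> = sets borel\<Omega>" by (simp add: \<beta>_def sets_leb)
  have "measure \<beta> B = 1" using B(2) Bl e\<beta> by (simp add: \<beta>_def measure_uniform_measure)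
  \<comment> \<open>Restricting the space to \<open>B\<close> makes every sampled point, and not
    just almost every one, lie in \<open>B\<close>.\<close>
  define \<eta> where "\<eta> = restrict_space \<beta> B"
  have B\<beta>: "B \<in> sets \<beta>" using s\<beta> B(1) by simp
  interpret \<eta>: prob_space \<eta> unfolding \<eta>_def
    by (rule prob_space_restrict_space[OF B\<beta>]) (use \<open>measure \<beta> B = 1\<close> in \<open>simp add: \<beta>.emeasure_eq_measure\<close>)
  interpret pair_prob_space \<gamma> \<eta> ..
  let ?P = "\<gamma> \<Otimes>\<^sub>M \<eta>"
  have sp: "space ?P = (\<Omega> \<times> \<Omega>) \<times> B"
  proof -
    have "space \<eta> = B" using sets.sets_into_space[OF B\<beta>] by (simp add: \<eta>_def space_restrict_space Int_absorb2)
    then show ?thesis by (simp only: space_pair_measure prob_onD(3)[OF \<gamma>])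
  qed
  have \<eta>id: "(\<lambda>x. x) \<in> measurable \<eta> borel\<Omega>"
    unfolding \<eta>_def by (rule measurable_restrict_space1) (simp add: measurable_cong_sets[OF s\<beta> refl])
  have \<gamma>id: "(\<lambda>p. p) \<in> measurable \<gamma> ?B2" by (rule prob_on_measurable_restrict[OF \<gamma>]) simp
  have i\<Omega>: "(\<lambda>x. x) \<in> measurable borel\<Omega> borel" by (rule measurable_restrict_space1) simp
  have m1: "fst \<in> measurable ?P ?B2" by (rule measurable_compose[OF measurable_fst \<gamma>id])
  have m2: "snd \<in> measurable ?P borel\<Omega>" by (rule measurable_compose[OF measurable_snd \<eta>id])
  define T where "T = (\<lambda>z. if z \<in> fst -` A \<inter> space ?P then (snd z, snd (fst z)) else fst z)"
  have T: "T \<in> measurable ?P ?B2"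
    unfolding T_def
  proof (rule measurable_If_set)
    have "snd \<in> borel_measurable ?P" by (rule measurable_compose[OF m2 i\<Omega>])
    moreover have "(\<lambda>z. snd (fst z)) \<in> borel_measurable ?P"
      by (rule measurable_compose[OF measurable_compose[OF m1 projections_measurable(2)] i\<Omega>])
    ultimately have "(\<lambda>z. (snd z, snd (fst z))) \<in> borel_measurable ?P" by (rule borel_measurable_Pair)
    then show "(\<lambda>z. (snd z, snd (fst z))) \<in> measurable ?P ?B2"
    proof (rule measurable_restrict_space2[rotated])
      show "(\<lambda>z. (snd z, snd (fst z))) \<in> space ?P \<rightarrow> \<Omega> \<times> \<Omega>"
        unfolding sp using B\<Omega> by auto
    qed
    show "(fst -` A \<inter> space ?P) \<inter> space ?P \<in> sets ?P"
      using measurable_sets[OF m1 A] by (simp only: Int_assoc Int_absorb)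
  qed (rule m1)
  define \<gamma>' where "\<gamma>' = distr ?P ?B2 T"
  have \<gamma>': "\<gamma>' \<in> plans" unfolding \<gamma>'_def by (rule distr_in_prob_on[OF P.prob_space_axioms T])
  have fst_distr: "distr ?P \<gamma> fst = \<gamma>" by (rule \<eta>.distr_pair_fst)
  have integral_fst_pair: "(\<integral>z. k (fst z) \<partial>?P) = (\<integral>p. k p \<partial>\<gamma>)" if "k \<in> borel_measurable \<gamma>" for k :: "'a \<times> 'a \<Rightarrow> real"
    using integral_distr[OF measurable_fst that, of \<eta>] fst_distr by simp
  have marg2': "marg2 \<gamma>' = \<nu>"
  proof -
    have "marg2 \<gamma>' = distr ?P borel\<Omega> (snd \<circ> fst)"
      unfolding \<gamma>'_def distr_distr[OF projections_measurable(2) T] by (rule distr_cong) (auto simp: T_def)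
    also have "\<dots> = distr (distr ?P \<gamma> fst) borel\<Omega> snd"
      by (rule distr_distr[OF plan_projections(2)[OF \<gamma>] measurable_fst, symmetric])
    finally show ?thesis unfolding fst_distr .
  qed
  let ?\<mu>' = "marg1 \<gamma>'"
  note \<mu>' = marginals_prob_on(1)[OF \<gamma>']
  have mT: "(\<lambda>z. fst (T z)) \<in> measurable ?P borel\<Omega>" by (rule measurable_compose[OF T projections_measurable(1)])
  have \<mu>'_eq: "?\<mu>' = distr ?P borel\<Omega> (\<lambda>z. fst (T z))"
    unfolding \<gamma>'_def by (subst distr_distr[OF projections_measurable(1) T]) (simp add: comp_def)
  have mff: "(\<lambda>z. fst (fst z)) \<in> measurable ?P borel\<Omega>" by (rule measurable_compose[OF m1 projections_measurable(1)])
  have \<mu>_pair: "\<mu> = distr ?P borel\<Omega> (\<lambda>z. fst (fst z))"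
  proof -
    have "distr (distr ?P \<gamma> fst) borel\<Omega> fst = distr ?P borel\<Omega> (fst \<circ> fst)"
      by (rule distr_distr[OF plan_projections(1)[OF \<gamma>] measurable_fst])
    then show ?thesis unfolding fst_distr by (simp add: comp_def)
  qed
  have meas_\<mu>': "measure ?\<mu>' E = P.prob ((\<lambda>z. fst (T z)) -` E \<inter> space ?P)" if "E \<in> sets borel\<Omega>" for E
    unfolding \<mu>'_eq by (rule measure_distr[OF mT that])
  have meas_\<mu>: "measure \<mu> E = P.prob ((\<lambda>z. fst (fst z)) -` E \<inter> space ?P)" if "E \<in> sets borel\<Omega>" for E
    by (subst \<mu>_pair) (rule measure_distr[OF mff that])
  have \<mu>'_le: "measure ?\<mu>' E \<le> measure \<mu> E + c * measure leb E" if E: "E \<in> sets leb" for E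
  proof -
    have E': "E \<in> sets borel\<Omega>" "E \<in> sets \<beta>" using E sets_leb s\<beta> by simp_all
    have "measure ?\<mu>' E \<le> P.prob (((\<lambda>z. fst (fst z)) -` E \<inter> space ?P) \<union> (snd -` E \<inter> space ?P))"
      unfolding meas_\<mu>'[OF E'(1)]
      by (rule P.finite_measure_mono)
         (use measurable_sets[OF mff E'(1)] measurable_sets[OF m2 E'(1)] in \<open>auto simp: T_def split: if_splits\<close>)
    also have "\<dots> \<le> measure \<mu> E + P.prob (snd -` E \<inter> space ?P)"
      unfolding meas_\<mu>[OF E'(1)]
      by (rule measure_Un_le) (use measurable_sets[OF mff E'(1)] measurable_sets[OF m2 E'(1)] in auto)
    finally have 1: "measure ?\<mu>' E \<le> measure \<mu> E + P.prob (snd -` E \<inter> space ?P)" .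
    have "P.prob (snd -` E \<inter> space ?P) = measure \<eta> (E \<inter> B)"
    proof -
      have EB: "E \<inter> B \<in> sets \<eta>" using E' B\<beta> by (auto simp: \<eta>_def sets_restrict_space_iff)
      have "snd -` E \<inter> space ?P = space \<gamma> \<times> (E \<inter> B)" using sp by (auto simp: prob_onD(3)[OF \<gamma>])
      then show ?thesis
        by (simp only: measure_def \<eta>.emeasure_pair_measure_Times[OF sets.top EB] g.emeasure_space_1 mult_1)
    qed
    also have "measure \<eta> (E \<inter> B) = measure \<beta> (E \<inter> B)"
      unfolding \<eta>_def using B\<beta> E' by (intro measure_restrict_space) auto
    also have "\<dots> = measure leb (B \<inter> (E \<inter> B)) / measure leb B"
      unfolding \<beta>_def using e\<beta> E Bl by (intro measure_uniform_measure) auto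
    also have "\<dots> \<le> c * measure leb E"
    proof -
      have "measure leb (B \<inter> (E \<inter> B)) \<le> measure leb E" by (rule leb.finite_measure_mono) (use E in auto)
      then have "measure leb (B \<inter> (E \<inter> B)) / measure leb B \<le> measure leb E / measure leb B"
        by (rule divide_right_mono) simp
      then show ?thesis by (simp add: c_def)
    qed
    finally show ?thesis by (rule order_trans[OF 1 add_left_mono])
  qed
  have same: "measure ?\<mu>' E = measure \<mu> E" if E: "E \<in> sets leb" "E \<subseteq> {x \<in> space leb. M < u x}" for E
  proof -
    have E': "E \<in> sets borel\<Omega>" using E sets_leb by simp
    have "fst (T z) \<in> E \<longleftrightarrow> fst (fst z) \<in> E" if z: "z \<in> space ?P" for z
    proof (cases "fst z \<in> A")
      case True
      have zB: "snd z \<in> B" using z unfolding sp by (rule mem_Times_iff[THEN iffD1, THEN conjunct2])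
      have "u (snd z) \<le> M" "u (fst (fst z)) \<le> M" by (rule BM[OF zB], rule AM[OF True])
      then have "snd z \<notin> E" "fst (fst z) \<notin> E" using E(2) by fastforce+
      moreover have "T z = (snd z, snd (fst z))" unfolding T_def using True z by (intro if_P) auto
      ultimately show ?thesis by simp
    next
      case False
      then have "T z = fst z" unfolding T_def by (intro if_not_P) auto
      then show ?thesis by simp
    qed
    then have "(\<lambda>z. fst (T z)) -` E \<inter> space ?P = (\<lambda>z. fst (fst z)) -` E \<inter> space ?P" by blast
    then show ?thesis unfolding meas_\<mu>'[OF E'] meas_\<mu>[OF E'] by (rule arg_cong)
  qed
  obtain u' where u': "lebesgue_density \<Omega> ?\<mu>' u'" and local: "AE x in leb. u' x = u x \<or> (u x \<le> M + c \<and> u' x \<le> M + c)"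
    and deriv: "(\<integral>x. f' (u x) * (u' x - u x) \<partial>leb) = (\<integral>x. f' (min (u x) M) \<partial>?\<mu>') - (\<integral>x. f' (min (u x) M) \<partial>\<mu>)"
    by (rule local_change_of_density[OF u \<mu> \<mu>' _ _ c0 M0]) (erule \<mu>'_le, erule (1) same, (rule that; assumption))
  \<comment> \<open>The truncation makes \<open>f' u\<close> bounded without changing it on the
    coordinates that are exchanged.\<close>
  define \<phi> where "\<phi> = (\<lambda>x. f' (min (u x) M))"
  have um\<Omega>: "u \<in> borel_measurable borel\<Omega>" using um(1) by (simp only: measurable_leb_iff)
  have \<phi>m: "\<phi> \<in> borel_measurable borel\<Omega>"
    unfolding \<phi>_def by (rule measurable_nonneg_compose[OF f'_continuous]) (use um\<Omega> um(2) M0 in \<open>auto simp: space_restrict_space\<close>)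
  obtain K where K: "\<And>t. t \<in> {0..M} \<Longrightarrow> \<bar>f' t\<bar> \<le> K" by (rule f_bounds[of M]) (rule that; assumption)
  have \<phi>K: "\<bar>\<phi> x\<bar> \<le> K" if "x \<in> \<Omega>" for x unfolding \<phi>_def using um(2)[OF that] M0 by (intro K) auto
  define k where "k = (\<lambda>p. (norm (fst p - snd p))\<^sup>2 / 2 + \<phi> (fst p))"
  have km: "k \<in> borel_measurable ?B2"
    unfolding k_def
  proof (rule borel_measurable_add)
    show "(\<lambda>p. (norm (fst p - snd p))\<^sup>2 / 2) \<in> borel_measurable ?B2"
      by (rule borel_measurable_continuous_on_restrict) (intro continuous_intros, simp)
    show "(\<lambda>p. \<phi> (fst p)) \<in> borel_measurable ?B2" by (rule measurable_compose[OF projections_measurable(1) \<phi>m])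
  qed
  have split: "cost R / 2 + (\<integral>x. \<phi> x \<partial>marg1 R) = (\<integral>p. k p \<partial>R)" if R: "R \<in> plans" for R
  proof -
    have "integrable R (\<lambda>p. \<phi> (fst p))"
      by (rule prob_on_integrable_bounded[OF R prob_on_measurable_restrict[OF R measurable_compose[OF projections_measurable(1) \<phi>m]], of K])
         (use \<phi>K in auto)
    then show ?thesis
      using prob_on_integrable_continuous[OF R compact2 cost_continuous]
      unfolding k_def cost_def integral_distr[OF plan_projections(1)[OF R] \<phi>m] by simp
  qed
  obtain B0 where B0: "B0 > 0" "\<And>p. p \<in> \<Omega> \<times> \<Omega> \<Longrightarrow> \<bar>(norm (fst p - snd p))\<^sup>2\<bar> \<le> B0"
    by (rule compact_continuous_bounded[OF compact2 cost_continuous]) (rule that; assumption)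
  have kb: "\<bar>k p\<bar> \<le> B0 + K" if p: "p \<in> \<Omega> \<times> \<Omega>" for p
  proof -
    have "\<bar>\<phi> (fst p)\<bar> \<le> K" by (rule \<phi>K) (use p in auto)
    then show ?thesis using B0(2)[OF p] B0(1) zero_le_power2[of "norm (fst p - snd p)"] unfolding k_def abs_le_iff by linarith
  qed
  have T_in: "T z \<in> \<Omega> \<times> \<Omega>" "fst z \<in> \<Omega> \<times> \<Omega>" if "z \<in> space ?P" for z
    using measurable_space[OF T that] measurable_space[OF m1 that] by (simp_all add: space_restrict_space)
  have ik1: "integrable ?P (\<lambda>z. k (T z))"
  proof (rule P.integrable_const_bound)
    show "AE z in ?P. norm (k (T z)) \<le> B0 + K"
      unfolding real_norm_def by (intro AE_I2 kb T_in)
  qed (rule measurable_compose[OF T km])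
  have ik2: "integrable ?P (\<lambda>z. k (fst z))"
  proof (rule P.integrable_const_bound)
    show "AE z in ?P. norm (k (fst z)) \<le> B0 + K"
      unfolding real_norm_def by (intro AE_I2 kb T_in)
  qed (rule measurable_compose[OF m1 km])
  have "0 \<le> (cost \<gamma>' - cost \<gamma>) / 2 + ((\<integral>x. \<phi> x \<partial>?\<mu>') - (\<integral>x. \<phi> x \<partial>\<mu>))"
    using first_marginal_variation[OF \<gamma>' marg2' u' local] unfolding deriv \<phi>_def .
  then have "(\<integral>p. k p \<partial>\<gamma>) \<le> (\<integral>p. k p \<partial>\<gamma>')" unfolding split[OF \<gamma>, symmetric] split[OF \<gamma>', symmetric] by (simp add: field_simps)
  also have "(\<integral>p. k p \<partial>\<gamma>') = (\<integral>z. k (T z) \<partial>?P)" unfolding \<gamma>'_def by (rule integral_distr[OF T km])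
  also have "(\<integral>p. k p \<partial>\<gamma>) = (\<integral>z. k (fst z) \<partial>?P)"
    by (rule integral_fst_pair[OF prob_on_measurable_restrict[OF \<gamma> km], symmetric])
  finally have le: "(\<integral>z. k (fst z) - k (T z) \<partial>?P) \<le> 0"
    using Bochner_Integration.integral_diff[OF ik2 ik1] by simp
  have pos: "0 < k (fst z) - k (T z)" if z: "z \<in> space ?P" "fst z \<in> A" for z
  proof -
    have zB: "snd z \<in> B" using z(1) unfolding sp by (rule mem_Times_iff[THEN iffD1, THEN conjunct2])
    have "T z = (snd z, snd (fst z))" unfolding T_def using z by (intro if_P) auto
    moreover have "\<phi> (snd z) = f' (u (snd z))" "\<phi> (fst (fst z)) = f' (u (fst (fst z)))"
      using BM[OF zB] AM[OF z(2)] by (simp_all add: \<phi>_def)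
    ultimately show ?thesis using gain[OF z(2) zB] unfolding k_def by simp
  qed
  have nn: "AE z in ?P. 0 \<le> k (fst z) - k (T z)"
  proof (rule AE_I2)
    fix z assume z: "z \<in> space ?P"
    show "0 \<le> k (fst z) - k (T z)"
    proof (cases "fst z \<in> A")
      case True
      then show ?thesis using pos[OF z] by simp
    next
      case False
      then have "T z = fst z" unfolding T_def by (intro if_not_P) auto
      then show ?thesis by simp
    qed
  qed
  have "(\<integral>z. k (fst z) - k (T z) \<partial>?P) = 0" using le integral_nonneg_AE[OF nn] by simp
  then have "AE z in ?P. k (fst z) - k (T z) = 0"
    using integral_nonneg_eq_0_iff_AE[OF Bochner_Integration.integrable_diff[OF ik2 ik1] nn] by simp
  then have "AE z in ?P. fst z \<notin> A"
    using AE_space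
  proof eventually_elim
    case (elim z)
    show ?case
    proof
      assume "fst z \<in> A"
      from pos[OF elim(2) this] show False using elim(1) by simp
    qed
  qed
  then have "AE p in distr ?P \<gamma> fst. p \<notin> A"
  proof (subst AE_distr_iff[OF measurable_fst])
    have "A \<in> sets \<gamma>" using A prob_onD(2)[OF \<gamma>] by simp
    then have "space \<gamma> - A \<in> sets \<gamma>" by auto
    also have "space \<gamma> - A = {x \<in> space \<gamma>. x \<notin> A}" by auto
    finally show "{x \<in> space \<gamma>. x \<notin> A} \<in> sets \<gamma>" .
  qed
  then show ?thesis unfolding fst_distr .
qed

end

section \<open>Continuous density of the first marginal\<close>

lemma half_square_lipschitz:
  fixes x y y' :: "'b::real_normed_vector"
  assumes D: "norm (x - y) \<le> D" "norm (x - y') \<le> D"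
  shows "(norm (x - y))\<^sup>2 / 2 \<le> (norm (x - y'))\<^sup>2 / 2 + D * norm (y - y')"
proof -
  have d: "norm (x - y) - norm (x - y') \<le> norm (y - y')"
    using norm_triangle_ineq2[of "x - y" "x - y'"] by (simp add: norm_minus_commute)
  have "(norm (x - y))\<^sup>2 - (norm (x - y'))\<^sup>2 = (norm (x - y) - norm (x - y')) * (norm (x - y) + norm (x - y'))"
    by (simp add: power2_eq_square algebra_simps)
  also have "\<dots> \<le> norm (y - y') * (norm (x - y) + norm (x - y'))" using d by (intro mult_right_mono) auto
  also have "\<dots> \<le> norm (y - y') * (2 * D)" using D by (intro mult_left_mono) auto
  finally show ?thesis by (simp add: algebra_simps)
qed

context energy_minimizer begin

text \<open>The first variation of the energy with respect to mass at \<open>(x, y)\<close>, as far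
  as it depends on \<open>x\<close>.\<close>

definition first_cost :: "'a \<Rightarrow> 'a \<Rightarrow> real" where
  "first_cost x y = (norm (x - y))\<^sup>2 / 2 + f' (u x)"

text \<open>A violation at \<open>(x, y)\<close> and \<open>x'\<close> is witnessed by countable
  data: a rational number \<open>s\<close> strictly between the two costs, a bound \<open>M\<close>
  of the densities at both points, and a point \<open>y0\<close> of a dense set with a radius
  \<open>1 / Suc n\<close> so small that replacing \<open>y\<close> by \<open>y0\<close> does not
  close the gap. For fixed data the sets \<open>A\<close> of pairs and \<open>B\<close> of points
  form a product on which the exchange is favourable, so one of them is null; all null sets are
  removed at once. This yields the inequality for all remaining pairs and points
  simultaneously.\<close>

lemma first_optimality:
  obtains \<Gamma> N where "AE p in \<gamma>. p \<in> \<Gamma>" "\<Gamma> \<subseteq> \<Omega> \<times> \<Omega>" "AE x in leb. x \<notin> N"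
    "\<And>p x. p \<in> \<Gamma> \<Longrightarrow> x \<in> \<Omega> - N \<Longrightarrow> first_cost (fst p) (snd p) \<le> first_cost x (snd p)"
proof -
  let ?B2 = "restrict_space borel (\<Omega> \<times> \<Omega>) :: ('a \<times> 'a) measure"
  note um = density_measurable[OF u]
  have conv: "g \<in> borel_measurable borel\<Omega>" if "g \<in> borel_measurable leb" for g :: "'a \<Rightarrow> real"
    using that by (simp only: measurable_leb_iff)
  note um\<Omega> = conv[OF um(1)] and hm\<Omega> = conv[OF um(4)]
  obtain D0 where D0: "D0 > 0" "\<And>z w. z \<in> \<Omega> \<Longrightarrow> w \<in> \<Omega> \<Longrightarrow> norm (z - w) \<le> D0"
    by (rule diameter_bound) (rule that; assumption)
  obtain D where D: "countable D" "D \<subseteq> \<Omega>" "\<Omega> \<subseteq> closure D" using separable[of \<Omega>] by blast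
  define I where "I = (\<rat> :: real set) \<times> (UNIV :: nat set) \<times> D \<times> (UNIV :: nat set)"
  have I: "countable I" unfolding I_def by (intro countable_SIGMA countable_rat D(1)) auto
  define A where "A = (\<lambda>(s, M, y0, n). {p \<in> space ?B2. s < first_cost (fst p) (snd p)} \<inter>
     {p \<in> space ?B2. u (fst p) \<le> real M} \<inter> {p \<in> space ?B2. norm (snd p - y0) < 1 / real (Suc n)})"
  define B where "B = (\<lambda>(s, M, y0, n). {x \<in> space borel\<Omega>. first_cost x y0 + D0 / real (Suc n) < s} \<inter>
     {x \<in> space borel\<Omega>. u x \<le> real M})"
  have A: "A i \<in> sets ?B2" for i
  proof -
    have 1: "(\<lambda>p. first_cost (fst p) (snd p)) \<in> borel_measurable ?B2"
      unfolding first_cost_def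
    proof (rule borel_measurable_add)
      show "(\<lambda>p. (norm (fst p - snd p))\<^sup>2 / 2) \<in> borel_measurable ?B2"
        by (rule borel_measurable_continuous_on_restrict) (intro continuous_intros, simp)
      show "(\<lambda>p. f' (u (fst p))) \<in> borel_measurable ?B2" by (rule measurable_compose[OF projections_measurable(1) hm\<Omega>])
    qed
    have 2: "(\<lambda>p. u (fst p)) \<in> borel_measurable ?B2" by (rule measurable_compose[OF projections_measurable(1) um\<Omega>])
    have 3: "(\<lambda>p. norm (snd p - y0)) \<in> borel_measurable ?B2" for y0
      by (rule borel_measurable_continuous_on_restrict) (intro continuous_intros)
    obtain s M y0 n where i: "i = (s, M, y0, n)" by (cases i)
    show ?thesis unfolding i A_def prod.case
      by (intro sets.Int borel_measurable_less[OF borel_measurable_const 1] borel_measurable_le[OF 2 borel_measurable_const]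
          borel_measurable_less[OF 3 borel_measurable_const])
  qed
  have B: "B i \<in> sets borel\<Omega>" for i
  proof -
    have 1: "(\<lambda>x. first_cost x y0 + c) \<in> borel_measurable borel\<Omega>" for y0 c
      unfolding first_cost_def
    proof (intro borel_measurable_add hm\<Omega> borel_measurable_const)
      show "(\<lambda>x. (norm (x - y0))\<^sup>2 / 2) \<in> borel_measurable borel\<Omega>"
        by (rule borel_measurable_continuous_on_restrict) (intro continuous_intros, simp)
    qed
    obtain s M y0 n where i: "i = (s, M, y0, n)" by (cases i)
    show ?thesis unfolding i B_def prod.case
      by (intro sets.Int borel_measurable_less[OF 1 borel_measurable_const] borel_measurable_le[OF um\<Omega> borel_measurable_const])
  qed
  have exchange: "AE p in \<gamma>. p \<notin> A i" if i: "i \<in> I" and pos: "measure leb (B i) > 0" for i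
  proof -
    obtain s M y0 n where i_eq: "i = (s, M, y0, n)" by (cases i)
    have y0: "y0 \<in> \<Omega>" using i D(2) by (auto simp: i_eq I_def)
    show ?thesis
    proof (rule first_exchange[OF A B pos, where M="real M"])
      show "u (fst p) \<le> real M" if "p \<in> A i" for p using that by (simp add: A_def i_eq)
      show "u x \<le> real M" if "x \<in> B i" for x using that by (simp add: B_def i_eq)
      fix p x assume p: "p \<in> A i" and x: "x \<in> B i"
      have p': "p \<in> \<Omega> \<times> \<Omega>" "s < first_cost (fst p) (snd p)" "norm (snd p - y0) < 1 / real (Suc n)"
        using p by (simp_all add: A_def i_eq space_restrict_space)
      have x': "x \<in> \<Omega>" "first_cost x y0 + D0 / real (Suc n) < s"
        using x by (simp_all add: B_def i_eq space_restrict_space)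
      have y: "snd p \<in> \<Omega>" using p'(1) by (simp add: mem_Times_iff)
      have "(norm (x - snd p))\<^sup>2 / 2 \<le> (norm (x - y0))\<^sup>2 / 2 + D0 * norm (snd p - y0)"
        by (rule half_square_lipschitz[OF D0(2)[OF x'(1) y] D0(2)[OF x'(1) y0]])
      also have "D0 * norm (snd p - y0) \<le> D0 * (1 / real (Suc n))"
        using p'(3) D0(1) by (intro mult_left_mono) auto
      finally have "first_cost x (snd p) \<le> first_cost x y0 + D0 / real (Suc n)" by (simp add: first_cost_def)
      then have "first_cost x (snd p) < first_cost (fst p) (snd p)" using p' x' by linarith
      then show "(norm (x - snd p))\<^sup>2 / 2 + f' (u x) < (norm (fst p - snd p))\<^sup>2 / 2 + f' (u (fst p))"
        by (simp add: first_cost_def)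
    qed
  qed
  define \<Gamma> where "\<Gamma> = {p \<in> \<Omega> \<times> \<Omega>. \<forall>i\<in>I. measure leb (B i) > 0 \<longrightarrow> p \<notin> A i}"
  define N where "N = (\<Union>i\<in>{i \<in> I. \<not> measure leb (B i) > 0}. B i)"
  have "AE p in \<gamma>. \<forall>i\<in>I. measure leb (B i) > 0 \<longrightarrow> p \<notin> A i"
    unfolding AE_ball_countable[OF I]
  proof
    fix i assume i: "i \<in> I"
    show "AE p in \<gamma>. measure leb (B i) > 0 \<longrightarrow> p \<notin> A i"
      using exchange[OF i] by (cases "measure leb (B i) > 0") simp_all
  qed
  then have \<Gamma>: "AE p in \<gamma>. p \<in> \<Gamma>"
    using AE_space unfolding \<Gamma>_def by eventually_elim (use prob_onD(3)[OF \<gamma>] in blast)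
  have "N \<in> null_sets leb"
    unfolding N_def
  proof (rule null_sets_UN')
    show "countable {i \<in> I. \<not> measure leb (B i) > 0}" using I by simp
    fix i assume "i \<in> {i \<in> I. \<not> measure leb (B i) > 0}"
    then have "measure leb (B i) = 0" by (simp add: zero_less_measure_iff)
    then have "emeasure leb (B i) = 0" by (simp add: leb.emeasure_eq_measure)
    then show "B i \<in> null_sets leb" using B[of i] sets_leb by (simp add: null_sets_def)
  qed
  then have N: "AE x in leb. x \<notin> N" by (rule AE_not_in)
  have opt: "first_cost (fst p) (snd p) \<le> first_cost x (snd p)" if p: "p \<in> \<Gamma>" and x: "x \<in> \<Omega> - N" for p x
  proof (rule ccontr)
    assume "\<not> first_cost (fst p) (snd p) \<le> first_cost x (snd p)"
    then obtain s where s: "s \<in> \<rat>" "first_cost x (snd p) < s" "s < first_cost (fst p) (snd p)"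
      using Rats_dense_in_real[of "first_cost x (snd p)" "first_cost (fst p) (snd p)"] by auto
    have y: "fst p \<in> \<Omega>" "snd p \<in> \<Omega>" using p by (auto simp: \<Gamma>_def)
    \<comment> \<open>Passing from \<open>y\<close> to \<open>y0\<close> costs \<open>D0 / Suc
      n\<close>, and the definition of \<open>B\<close> asks for the same margin once more; hence
      the factor 2.\<close>
    define gap where "gap = (s - first_cost x (snd p)) / (2 * D0)"
    have gap: "gap > 0" using s D0(1) by (simp add: gap_def)
    obtain n :: nat where n: "1 / real (Suc n) < gap" using gap reals_Archimedean[of gap] by (auto simp: inverse_eq_divide)
    obtain y0 where y0: "y0 \<in> D" "dist y0 (snd p) < 1 / real (Suc n)"
      using D(3) y(2) closure_approachable[of "snd p" D] by (metis divide_pos_pos of_nat_0_less_iff subsetD zero_less_Suc zero_less_one)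
    obtain M :: nat where M: "max (u (fst p)) (u x) \<le> real M" using real_arch_simple by blast
    let ?i = "(s, M, y0, n)"
    have i: "?i \<in> I" using s y0 by (simp add: I_def)
    have d: "norm (snd p - y0) < 1 / real (Suc n)" using y0(2) by (simp add: dist_norm norm_minus_commute)
    have pA: "p \<in> A ?i" using p s M d by (simp add: A_def \<Gamma>_def space_restrict_space)
    have y0\<Omega>: "y0 \<in> \<Omega>" using y0 D(2) by blast
    have "(norm (x - y0))\<^sup>2 / 2 \<le> (norm (x - snd p))\<^sup>2 / 2 + D0 * norm (y0 - snd p)"
      by (rule half_square_lipschitz[OF D0(2) D0(2)]) (use x y y0\<Omega> in auto)
    also have "D0 * norm (y0 - snd p) \<le> D0 * (1 / real (Suc n))"
      using d D0(1) by (intro mult_left_mono) (auto simp: norm_minus_commute)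
    finally have "first_cost x y0 \<le> first_cost x (snd p) + D0 * (1 / real (Suc n))" by (simp add: first_cost_def)
    moreover have "2 * (D0 * (1 / real (Suc n))) < s - first_cost x (snd p)"
      using n D0(1) by (simp add: gap_def field_simps)
    ultimately have "first_cost x y0 + D0 / real (Suc n) < s" by simp
    then have xB: "x \<in> B ?i" using x M by (simp add: B_def space_restrict_space)
    show False
    proof (cases "measure leb (B ?i) > 0")
      case True
      then show False using p i pA by (auto simp: \<Gamma>_def)
    next
      case False
      then have "x \<in> N" unfolding N_def using i xB by blast
      then show False using x by simp
    qed
  qed
  show ?thesis by (rule that[OF \<Gamma> _ N opt]) (auto simp: \<Gamma>_def)
qed

text \<open>The supremum \<open>H\<close> is at most \<open>f' u\<close> almost everywhere, and at
  least \<open>f' u\<close> almost everywhere with respect to the first marginal, that is, where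
  \<open>u > 0\<close>. Where \<open>u = 0\<close> it is at most \<open>f' 0\<close>. So \<open>f'
  u\<close> is the maximum of \<open>f' 0\<close> and \<open>H\<close>, and \<open>f'\<close> is
  inverted.\<close>

lemma first_marginal_continuous_density:
  obtains w where "lebesgue_density \<Omega> \<mu> w" "continuous_on \<Omega> w" "AE x in leb. u x = w x"
proof -
  note um = density_measurable[OF u]
  interpret g: prob_space \<gamma> by (rule prob_onD[OF \<gamma>])
  obtain \<Gamma> N where \<Gamma>: "AE p in \<gamma>. p \<in> \<Gamma>" "\<Gamma> \<subseteq> \<Omega> \<times> \<Omega>" and N: "AE x in leb. x \<notin> N"
    and opt: "\<And>p x. p \<in> \<Gamma> \<Longrightarrow> x \<in> \<Omega> - N \<Longrightarrow> first_cost (fst p) (snd p) \<le> first_cost x (snd p)"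
    by (rule first_optimality) (rule that; assumption)
  obtain D where D: "D > 0" "\<And>z w. z \<in> \<Omega> \<Longrightarrow> w \<in> \<Omega> \<Longrightarrow> norm (z - w) \<le> D"
    by (rule diameter_bound) (rule that; assumption)
  define k where "k = (\<lambda>p x. first_cost (fst p) (snd p) - (norm (x - snd p))\<^sup>2 / 2)"
  define H where "H = (\<lambda>x. SUP p\<in>\<Gamma>. k p x)"
  have ne: "\<Gamma> \<noteq> {}"
  proof
    assume "\<Gamma> = {}"
    then have "AE p in \<gamma>. False" using \<Gamma>(1) by simp
    then show False by simp
  qed
  have "\<exists>x0. x0 \<in> \<Omega> - N"
  proof (rule ccontr)
    assume "\<not> (\<exists>x0. x0 \<in> \<Omega> - N)"
    then have "\<And>x. x \<in> space leb \<Longrightarrow> x \<in> N" by (auto simp: space_leb)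
    with N AE_space have "AE x in leb. False" by (auto elim: eventually_elim2)
    then have "emeasure leb (space leb) = 0" using emeasure_eq_0_AE[of "\<lambda>_. True" leb] by simp
    then show False using measure_leb_pos by (simp add: space_leb measure_def)
  qed
  then obtain x0 where x0: "x0 \<in> \<Omega> - N" by blast
  have k_lip: "k p x \<le> k p x' + D * norm (x - x')" if "p \<in> \<Gamma>" "x \<in> \<Omega>" "x' \<in> \<Omega>" for p x x'
  proof -
    have y: "snd p \<in> \<Omega>" using that(1) \<Gamma>(2) by auto
    have "(norm (snd p - x'))\<^sup>2 / 2 \<le> (norm (snd p - x))\<^sup>2 / 2 + D * norm (x' - x)"
      by (rule half_square_lipschitz[OF D(2)[OF y that(3)] D(2)[OF y that(2)]])
    then show ?thesis by (simp add: k_def norm_minus_commute)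
  qed
  have k_le: "k p x \<le> f' (u x)" if "p \<in> \<Gamma>" "x \<in> \<Omega> - N" for p x
    using opt[OF that] by (simp add: k_def first_cost_def)
  have bdd: "bdd_above ((\<lambda>p. k p x) ` \<Gamma>)" if x: "x \<in> \<Omega>" for x
  proof (rule bdd_aboveI2)
    fix p assume p: "p \<in> \<Gamma>"
    show "k p x \<le> f' (u x0) + D * norm (x - x0)"
      using k_lip[OF p x, of x0] k_le[OF p x0] x0 by simp
  qed
  have H_lip: "H x \<le> H x' + D * norm (x - x')" if x: "x \<in> \<Omega>" "x' \<in> \<Omega>" for x x'
    unfolding H_def
  proof (rule cSUP_least[OF ne])
    fix p assume p: "p \<in> \<Gamma>"
    have "k p x' \<le> (SUP p\<in>\<Gamma>. k p x')" by (rule cSUP_upper[OF p bdd[OF x(2)]])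
    then show "k p x \<le> (SUP p\<in>\<Gamma>. k p x') + D * norm (x - x')" using k_lip[OF p x] by linarith
  qed
  have H_cont: "continuous_on \<Omega> H"
  proof (rule lipschitz_on_continuous_on)
    show "D-lipschitz_on \<Omega> H"
    proof (rule lipschitz_onI)
      fix x x' assume x: "x \<in> \<Omega>" "x' \<in> \<Omega>"
      show "dist (H x) (H x') \<le> D * dist x x'"
        using H_lip[OF x] H_lip[OF x(2,1)] by (simp add: dist_norm norm_minus_commute abs_le_iff)
    qed (use D in simp)
  qed
  have H_le: "H x \<le> f' (u x)" if "x \<in> \<Omega> - N" for x
    unfolding H_def by (rule cSUP_least[OF ne]) (rule k_le[OF _ that])
  have H_ge: "f' (u (fst p)) \<le> H (fst p)" if p: "p \<in> \<Gamma>" for p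
  proof -
    have "fst p \<in> \<Omega>" using p \<Gamma>(2) by auto
    from cSUP_upper[OF p bdd[OF this]] show ?thesis by (simp add: H_def k_def first_cost_def)
  qed
  have conv: "g \<in> borel_measurable borel\<Omega>" if "g \<in> borel_measurable leb" for g :: "'a \<Rightarrow> real"
    using that by (simp only: measurable_leb_iff)
  have Hm: "H \<in> borel_measurable borel\<Omega>" by (rule borel_measurable_continuous_on_restrict[OF H_cont])
  have "AE x in \<mu>. f' (u x) \<le> H x"
  proof (subst AE_distr_iff[OF plan_projections(1)[OF \<gamma>]])
    show "{x \<in> space borel\<Omega>. f' (u x) \<le> H x} \<in> sets borel\<Omega>" by (rule borel_measurable_le[OF conv[OF um(4)] Hm])
    show "AE p in \<gamma>. f' (u (fst p)) \<le> H (fst p)" using \<Gamma>(1) by eventually_elim (rule H_ge)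
  qed
  moreover have "\<mu> = density leb (\<lambda>x. ennreal (u x))" using u by (simp add: lebesgue_density_def)
  ultimately have "AE x in density leb (\<lambda>x. ennreal (u x)). f' (u x) \<le> H x" by (rule subst[rotated])
  then have ge: "AE x in leb. 0 < ennreal (u x) \<longrightarrow> f' (u x) \<le> H x"
    by (subst (asm) AE_density) (use um(1) in auto)
  have eq: "AE x in leb. f' (u x) = max (f' 0) (H x)"
    using ge N AE_space
  proof eventually_elim
    case (elim x)
    have x: "x \<in> \<Omega> - N" "0 \<le> u x" using elim um(2) by (auto simp: space_leb)
    show ?case
    proof (cases "u x = 0")
      case True
      then show ?thesis using H_le[OF x(1)] by simp
    next
      case False
      then have "0 < u x" using x(2) by simp
      then have "f' (u x) = H x" using elim(1) H_le[OF x(1)] by (simp add: antisym)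
      moreover have "f' 0 \<le> f' (u x)" using f'_mono[of 0 "u x"] x(2) by simp
      ultimately show ?thesis by simp
    qed
  qed
  have inj: "inj_on f' {0..}" using f'_less_iff by (auto intro!: linorder_inj_onI' dest: f'_strict_mono)
  define G where "G = inv_into {0..} f'"
  have Gf: "G (f' t) = t" if "t \<ge> 0" for t unfolding G_def using inj that by (simp add: inv_into_f_f)
  define w where "w = (\<lambda>x. G (max (f' 0) (H x)))"
  have "bounded (H ` \<Omega>)" by (intro compact_imp_bounded compact_continuous_image H_cont compact)
  then obtain hb where hb: "\<And>x. x \<in> \<Omega> \<Longrightarrow> \<bar>H x\<bar> \<le> hb" unfolding bounded_pos by auto
  obtain T where T: "T > 0" "f' T > hb" by (rule f'_unbounded) (rule that; assumption)
  have cT: "continuous_on {0..T} f'" by (rule continuous_on_subset[OF f'_continuous]) auto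
  have range: "max (f' 0) (H x) \<in> f' ` {0..T}" if x: "x \<in> \<Omega>" for x
  proof -
    have "f' 0 \<le> max (f' 0) (H x)" "max (f' 0) (H x) \<le> f' T"
      using hb[OF x] T f'_mono[of 0 T] by auto
    from IVT'[OF this less_imp_le[OF T(1)] cT] show ?thesis by force
  qed
  have G_cont: "continuous_on (f' ` {0..T}) G" by (rule continuous_on_inv[OF cT]) (use Gf in auto)
  have w_cont: "continuous_on \<Omega> w"
    unfolding w_def by (rule continuous_on_compose2[OF G_cont]) (use range H_cont in \<open>auto intro!: continuous_intros\<close>)
  have w_nn: "0 \<le> w x" if x: "x \<in> \<Omega>" for x
  proof -
    obtain t where "t \<ge> 0" "max (f' 0) (H x) = f' t" using range[OF x] by auto
    then show ?thesis by (simp add: w_def Gf)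
  qed
  have uw: "AE x in leb. u x = w x"
    using eq AE_space
  proof eventually_elim
    case (elim x)
    then show ?case using Gf[of "u x"] um(2)[of x] by (simp add: w_def space_leb)
  qed
  have wm: "w \<in> borel_measurable leb"
    using borel_measurable_continuous_on_restrict[OF w_cont] by (simp only: measurable_leb_iff)
  have d: "density leb (\<lambda>x. ennreal (u x)) = density leb (\<lambda>x. ennreal (w x))"
  proof (rule density_cong)
    show "AE x in leb. ennreal (u x) = ennreal (w x)" using uw by eventually_elim simp
  qed (use um(1) wm in simp_all)
  have "\<mu> = density leb (\<lambda>x. ennreal (w x))" using u d unfolding lebesgue_density_def by argo
  then have "lebesgue_density \<Omega> \<mu> w" unfolding lebesgue_density_def using wm w_nn by blast
  with w_cont uw that show ?thesis by blast
qed

lemma regular_densities: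
  "\<exists>w v. lebesgue_density \<Omega> \<mu> w \<and> continuous_on \<Omega> w \<and>
    lebesgue_density \<Omega> \<nu> v \<and> (\<exists>C. AE x in leb. \<bar>v x\<bar> \<le> C)"
proof -
  obtain w where w: "lebesgue_density \<Omega> \<mu> w" "continuous_on \<Omega> w" "AE x in leb. u x = w x"
    by (rule first_marginal_continuous_density) (rule that; assumption)
  obtain U where U: "U > 0" "\<And>x. x \<in> \<Omega> \<Longrightarrow> \<bar>w x\<bar> \<le> U"
    by (rule compact_continuous_bounded[OF compact w(2)]) (rule that; assumption)
  have "AE x in leb. u x \<le> U"
    using w(3) AE_space
  proof eventually_elim
    case (elim x)
    then show ?case using U(2)[of x] by (simp add: space_leb)
  qed
  then obtain v C where v: "lebesgue_density \<Omega> \<nu> v" "AE x in leb. \<bar>v x\<bar> \<le> C"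
    by (rule second_marginal_bounded_density) (rule that; assumption)
  with w show ?thesis by blast
qed

end

section \<open>Minimizing pairs\<close>

theorem corollary3p5:
  fixes \<Omega> :: "'a::euclidean_space set"
    and f f' V V' V'' :: "real \<Rightarrow> real"
  assumes "compact \<Omega>" and "convex \<Omega>" and "interior \<Omega> \<noteq> {}"
    and "\<And>t. t \<ge> 0 \<Longrightarrow> (f has_real_derivative f' t) (at t within {0..})"
    and "continuous_on {0..} f'"
    and "strictly_convex_on {0..} f"
    and "f 0 = 0"
    and "filterlim (\<lambda>t. f t / t) at_top at_top"
    and "\<And>t. t \<ge> 0 \<Longrightarrow> V t \<ge> 0"
    and "\<And>t. t \<ge> 0 \<Longrightarrow> (V has_real_derivative V' t) (at t within {0..})"
    and "\<And>t. t \<ge> 0 \<Longrightarrow> (V' has_real_derivative V'' t) (at t within {0..})"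
    and "continuous_on {0..} V''"
    and "\<And>t. t \<ge> 0 \<Longrightarrow> V' t > 0"
  shows "(\<exists>\<mu> \<nu>. minimizing_pair f V \<Omega> \<mu> \<nu>) \<and>
    (\<forall>\<mu> \<nu>. minimizing_pair f V \<Omega> \<mu> \<nu> \<longrightarrow>
      (\<exists>u v. lebesgue_density \<Omega> \<mu> u \<and> continuous_on \<Omega> u \<and>
             lebesgue_density \<Omega> \<nu> v \<and> (\<exists>C. AE x in restrict_space lborel \<Omega>. \<bar>v x\<bar> \<le> C)))"
proof -
  interpret concentration \<Omega> f f' V V' V'' by (rule concentration.intro) (rule assms; assumption)+
  have "\<exists>u v. lebesgue_density \<Omega> \<mu> u \<and> continuous_on \<Omega> u \<and>
      lebesgue_density \<Omega> \<nu> v \<and> (\<exists>C. AE x in leb. \<bar>v x\<bar> \<le> C)"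
    if minimizing: "minimizing_pair f V \<Omega> \<mu> \<nu>" for \<mu> \<nu>
  proof -
    obtain \<gamma> u where adm: "admissible \<gamma> u" and marginals: "marg1 \<gamma> = \<mu>" "marg2 \<gamma> = \<nu>"
      and least: "\<And>\<gamma>' u'. admissible \<gamma>' u' \<Longrightarrow> energy \<gamma> u \<le> energy \<gamma>' u'"
      by (rule minimizing_pair_energy[OF minimizing]) (rule that; assumption)
    interpret energy_minimizer \<Omega> f f' V V' V'' \<gamma> u
      by unfold_locales (rule adm, rule least)
    show ?thesis using regular_densities unfolding marginals .
  qed
  then show ?thesis using minimizing_pair_exists by blast
qed

end
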